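(* Let $j\ge 2$ be an integer and set $C_j := -j/\ln \mathrm{L}(j)$ if $j<\theta^{\ast}$, and $C_j := C^{\ast}$ if $j\ge \theta^{\ast}$. Then, almost surely, $H_{n,j}\sim C_j\ln n$ as $n\to\infty$. More precisely, $$H_{n,j}\le C_j\ln n+O(\ln\ln n)\quad\text{a.s.},$$ and this inequality is an equality, i.e. $H_{n,j}=C_j\ln n+O(\ln\ln n)$ a.s., if $j<\theta^{\ast}$ or if the following condition holds: there exists $\delta>0$ such that $$\mathrm{L}(-\delta)<\infty\quad\text{and}\quad \int \Big(\sum_{i\in\mathbb N}\mathbf 1_{p_i>0}\Big)^{1+\delta}\nu(\mathrm d\mathbf p)<\infty .$$
   Context: Model. Let $\mathbb N=\{1,2,\dots\}$ and $\mathcal U=\bigcup_{k\ge 0}\mathbb N^k$ with $\mathbb N^0=\{\varnothing\}$; write $|i|=k$ if $i\in\mathbb N^k$ (generation $k$), and $ij\in\mathbb N^{k+1}$ for the $j$-th child of $i\in\mathbb N^k$. Let $\rho=(\rho_1,\rho_2,\dots)$ be a random probability measure on $\mathbb N$, with law $\nu$ (a probability measure on the space of probability measures $\mathbf p=(p_1,p_2,\dots)$ on $\mathbb N$). Standing assumption: $\nu$ is not geometric, i.e. there is no $r\in(0,1)$ such that almost surely all masses of the atoms of $\rho$ belong to $\{r^n:n\in\mathbb Z_+\}$ (in particular $\rho$ is not a.s. a Dirac mass). Let $(\rho(i),i\in\mathcal U)$ be i.i.d. copies of $\rho$, and define $p_\varnothing=1$, $p_{ij}=p_i\rho_j(i)$.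 Each $i$ with $p_i>0$ is a box, of size $p_i$ (individuals with $p_i=0$ are ignored). An infinite sequence of balls is thrown: conditionally on $(\rho(i))_{i\in\mathcal U}$ the balls behave independently, each ball starts in $\varnothing$, and a ball located in box $i$ goes to the sub-box $ij$ with probability $\rho_j(i)=p_{ij}/p_i$ (so each ball occupies exactly one box at each generation). $H_{n,j}$ is the first generation $k$ at which all boxes contain less than $j$ balls when the first $n$ balls have been thrown. Constants. $\mathrm L(\theta)=\mathbb E\big[\sum_{j\in\mathbb N}\rho_j^\theta\big]$ for $\theta\in\mathbb R$, with the convention $0^\theta=0$ for all $\theta\in\mathbb{R}$; $\underline\theta=\inf\{\theta\in\mathbb R:\mathrm L(\theta)<\infty\}$; $\varphi(\theta)=\ln \mathrm L(\theta)-\theta\,\mathrm L'(\theta)/\mathrm L(\theta)$ for $\theta>\underline\theta$; $\theta^{\ast}=\sup\{\theta>\underline\theta:\varphi(\theta)>0\}\in(1,\infty]$; $C^{\ast}=\lim_{\theta\uparrow\theta^{\ast}}-\mathrm L(\theta)/\mathrm L'(\theta)$ (an increasing limit). Asymptotic notation: $X_n\le a\ln n+O(\ln\ln n)$ a.s. means that almost surely there is a finite (random) constant $K$ with $X_n\le a\ln n+K\ln\ln n$ for all large $n$; $X_n=a\ln n+O(\ln\ln n)$ a.s. means that almost surely $|X_n-a\ln n|\le K\ln\ln n$ for some finite random $K$ and all large $n$. *)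

theory Defs
  imports "HOL-Probability.Probability" "HOL-Library.Landau_Symbols"
begin

text \<open>
  Labels of children are natural numbers counted from 0, so \<^typ>\<open>nat\<close> plays the role of the set
  of positive integers. The space of probability measures on the labels carries the usual
  sigma-algebra, generated by the evaluation maps; a law \<open>\<nu>\<close> of a random probability measure is a
  probability measure on this space.
\<close>

abbreviation prob_on_labels :: "nat measure measure" where
  "prob_on_labels \<equiv> prob_algebra (count_space UNIV)"

abbreviation mass :: "nat measure \<Rightarrow> nat \<Rightarrow> real" where
  "mass p j \<equiv> measure p {j}"

definition geometric_law :: "nat measure measure \<Rightarrow> bool" where
  "geometric_law \<nu> \<longleftrightarrow>
     (\<exists>r::real. 0 < r \<and> r < 1 \<and> (AE p in \<nu>. \<forall>j. mass p j > 0 \<longrightarrow> (\<exists>n::nat. mass p j = r ^ n)))"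


text \<open>
  An individual is a list of labels whose head is the most recent one: the child with label \<open>j\<close> of
  \<open>i\<close> is \<^term>\<open>j # i\<close>, the root is \<^term>\<open>[]\<close>, and the generation is the length.
  \<open>\<rho> i \<omega>\<close> is the probability measure that splits the box \<open>i\<close>.
\<close>

primrec box_size :: "(nat list \<Rightarrow> 'w \<Rightarrow> nat measure) \<Rightarrow> 'w \<Rightarrow> nat list \<Rightarrow> real" where
  "box_size \<rho> \<omega> [] = 1"
| "box_size \<rho> \<omega> (j # i) = box_size \<rho> \<omega> i * mass (\<rho> i \<omega>) j"

definition cond_indep_vars ::
    "'w measure \<Rightarrow> 'w measure \<Rightarrow> ('i \<Rightarrow> 'b measure) \<Rightarrow> ('i \<Rightarrow> 'w \<Rightarrow> 'b) \<Rightarrow> 'i set \<Rightarrow> bool" where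
  "cond_indep_vars M F N X I \<longleftrightarrow>
     (\<forall>i\<in>I. X i \<in> measurable M (N i)) \<and>
     (\<forall>J A. J \<subseteq> I \<longrightarrow> finite J \<longrightarrow> (\<forall>i\<in>J. A i \<in> sets (N i)) \<longrightarrow>
        (AE \<omega> in M. real_cond_exp M F (indicator {\<omega>' \<in> space M. \<forall>i\<in>J. X i \<omega>' \<in> A i}) \<omega> =
           (\<Prod>i\<in>J. real_cond_exp M F (indicator {\<omega>' \<in> space M. X i \<omega>' \<in> A i}) \<omega>)))"

definition environment :: "'w measure \<Rightarrow> (nat list \<Rightarrow> 'w \<Rightarrow> nat measure) \<Rightarrow> 'w measure" where
  "environment M \<rho> = vimage_algebra (space M) (\<lambda>\<omega> i. \<rho> i \<omega>) (\<Pi>\<^sub>M i\<in>UNIV. prob_on_labels)"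

text \<open>
  \<open>X l \<omega> k\<close> is the box of generation \<open>k\<close> that contains ball number \<open>l\<close>; balls are numbered from 0.
  Since the box at generation \<open>length i\<close> determines its ancestors, assumption \<open>ball_step\<close> is the
  Markov transition, given the environment, from box \<open>i\<close> to its child \<^term>\<open>j # i\<close>; written as a
  product, it needs no case distinction for boxes of size 0.
\<close>

locale nested_occupancy = prob_space M
  for M :: "'w measure" +
  fixes \<nu> :: "nat measure measure"
    and \<rho> :: "nat list \<Rightarrow> 'w \<Rightarrow> nat measure"
    and X :: "nat \<Rightarrow> 'w \<Rightarrow> nat \<Rightarrow> nat list"
  assumes splitting_indep: "indep_vars (\<lambda>_. prob_on_labels) \<rho> UNIV"
    and splitting_law: "\<And>i. distr M prob_on_labels (\<rho> i) = \<nu>"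
    and balls_cond_indep:
      "cond_indep_vars M (environment M \<rho>) (\<lambda>_. \<Pi>\<^sub>M k\<in>UNIV. count_space UNIV) X UNIV"
    and ball_start: "\<And>l. AE \<omega> in M. X l \<omega> 0 = []"
    and ball_step: "\<And>l i j. AE \<omega> in M.
      real_cond_exp M (environment M \<rho>)
          (indicator {\<omega>' \<in> space M. X l \<omega>' (length i) = i \<and> X l \<omega>' (Suc (length i)) = j # i}) \<omega> =
        mass (\<rho> i \<omega>) j *
        real_cond_exp M (environment M \<rho>)
          (indicator {\<omega>' \<in> space M. X l \<omega>' (length i) = i}) \<omega>"

text \<open>
  The infimum of the empty set of generations is \<open>\<infinity>\<close>. Only individuals of positive size are boxes.
\<close>

definition saturation_height ::
    "(nat list \<Rightarrow> 'w \<Rightarrow> nat measure) \<Rightarrow> (nat \<Rightarrow> 'w \<Rightarrow> nat \<Rightarrow> nat list) \<Rightarrow> nat \<Rightarrow> nat \<Rightarrow> 'w \<Rightarrow> enat" where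
  "saturation_height \<rho> X n j \<omega> =
     Inf (enat ` {k. \<forall>i. length i = k \<longrightarrow> box_size \<rho> \<omega> i > 0 \<longrightarrow> card {l. l < n \<and> X l \<omega> k = i} < j})"


text \<open>The convention that 0 to any real power is 0 is the one built into \<^const>\<open>powr\<close>.\<close>

definition Lfun :: "nat measure measure \<Rightarrow> real \<Rightarrow> ennreal" where
  "Lfun \<nu> \<theta> = (\<integral>\<^sup>+ p. (\<Sum>j. ennreal (mass p j powr \<theta>)) \<partial>\<nu>)"

definition Lreal :: "nat measure measure \<Rightarrow> real \<Rightarrow> real" where
  "Lreal \<nu> \<theta> = enn2real (Lfun \<nu> \<theta>)"

definition theta_low :: "nat measure measure \<Rightarrow> ereal" where
  "theta_low \<nu> = Inf (ereal ` {\<theta>. Lfun \<nu> \<theta> < \<infinity>})"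

definition phi :: "nat measure measure \<Rightarrow> real \<Rightarrow> real" where
  "phi \<nu> \<theta> = ln (Lreal \<nu> \<theta>) - \<theta> * deriv (Lreal \<nu>) \<theta> / Lreal \<nu> \<theta>"

definition theta_star :: "nat measure measure \<Rightarrow> ereal" where
  "theta_star \<nu> = Sup (ereal ` {\<theta>. theta_low \<nu> < ereal \<theta> \<and> phi \<nu> \<theta> > 0})"

text \<open>
  The limit is taken in the extended reals, which covers the case where \<^const>\<open>theta_star\<close> is
  \<open>\<infinity>\<close>, and then the limit may be infinite as well.
\<close>

definition C_star :: "nat measure measure \<Rightarrow> ereal" where
  "C_star \<nu> = Lim (at_left (theta_star \<nu>))
     (\<lambda>x. ereal (- Lreal \<nu> (real_of_ereal x) / deriv (Lreal \<nu>) (real_of_ereal x)))"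

text \<open>
  The second branch is reached only if \<^const>\<open>theta_star\<close> is finite, and then so is
  \<^const>\<open>C_star\<close>.
\<close>

definition C_const :: "nat measure measure \<Rightarrow> nat \<Rightarrow> real" where
  "C_const \<nu> j =
     (if ereal (real j) < theta_star \<nu> then - real j / ln (Lreal \<nu> (real j))
      else real_of_ereal (C_star \<nu>))"

definition moment_condition :: "nat measure measure \<Rightarrow> bool" where
  "moment_condition \<nu> \<longleftrightarrow>
     (\<exists>\<delta>>0. Lfun \<nu> (- \<delta>) < \<infinity> \<and>
        (\<integral>\<^sup>+ p. (if finite {i. mass p i > 0}
                then ennreal (real (card {i. mass p i > 0}) powr (1 + \<delta>)) else \<infinity>) \<partial>\<nu>) < \<infinity>)"

end

theory Submission
  imports Defs
begin

text \<open>
  Write \<open>S k = \<Sum>|i| = k. p_i ^ j\<close> and let \<open>\<theta>\<close> be \<open>j\<close> if \<open>j < \<theta>*\<close> and \<open>\<theta>*\<close> otherwise, so that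
  \<open>C_j = - \<theta> / ln (L \<theta>)\<close> and \<open>\<phi> \<theta> \<ge> 0\<close>, with equality if \<open>\<theta> < j\<close>. Heights are monotone in \<open>n\<close>, so it
  suffices to treat \<open>n = 2 ^ s\<close> and to use the Borel--Cantelli lemma.

  Upper bound: a box of size \<open>p\<close> receives \<open>j\<close> of \<open>n\<close> balls with probability at most \<open>(n p) powr \<theta>\<close>, so a
  box with \<open>j\<close> balls exists at generation \<open>k\<close> with probability at most \<open>n powr \<theta> * L \<theta> ^ k\<close>.

  Lower bound: given the environment, the second moment method shows that such a box exists with
  high probability once \<open>n ^ j * S k\<close> exceeds a power of \<open>ln n\<close>; hence one needs \<open>S k\<close> to be at least
  \<open>L \<theta> powr (j * k / \<theta>)\<close> up to a power of \<open>k\<close>. Tilting by \<open>\<theta>\<close> turns the logarithms of the box sizes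
  into a random walk with drift \<open>\<phi> \<theta>\<close>. A second moment estimate for the boxes whose ancestral walk
  stays above \<open>- B\<close>, with \<open>B\<close> a multiple of \<open>ln k\<close>, gives the bound on \<open>S k\<close> with probability at least a
  power of \<open>1 / k\<close>; all that is needed about the walk is a polynomial lower bound for the
  probability to stay above \<open>- B\<close> (and, if the drift vanishes, to end below \<open>B\<close>). Finally, the first
  generations contain a binary tree whose boxes shrink at most geometrically, so that \<open>O(ln k)\<close> of
  them already provide enough independent attempts to make the failure probability summable.
\<close>

section \<open>Sums over a generation and product measures\<close>

text \<open>Heights are of order \<open>ln n\<close>, so a factor that is a power of the generation
  \<open>k\<close>, whether in a size, a probability or a moment, shifts the height by
  \<open>O(ln k)\<close>, which is \<open>O(ln ln n)\<close>. This margin permits crude tools: union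
  bounds over rotations in place of sharp ballot estimates, a logarithmic barrier, and generations
  spent on restarts.

  The obstacle is that means overestimate typical values. If \<open>j\<close> lies above the
  critical exponent, the mean \<open>L j ^ k\<close> of \<open>S k\<close> comes from rare
  environments with atypically large boxes, hence the tilt at \<theta> instead of \<open>j\<close>;
  and even at \<theta> the untruncated second moment may grow exponentially. On the barrier event
  each normalised weight is at most \<open>exp B\<close>, a power of \<open>k\<close>, and the
  second moment then grows only linearly in \<open>k\<close>.

  Sums over boxes are taken in \<open>ennreal\<close>, so that exchanging them with integrals needs
  no summability. The environment is analysed on a canonical product space, where independence
  amounts to depending on disjoint sets of coordinates.\<close>

definition gsum :: "nat \<Rightarrow> (nat list \<Rightarrow> ennreal) \<Rightarrow> ennreal" where
  "gsum k f = (\<integral>\<^sup>+ i. f i \<partial>count_space {i. length i = k})"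

lemma gsum_0 [simp]: "gsum 0 f = f []"
proof -
  have "{i :: nat list. length i = 0} = {[]}" by auto
  then show ?thesis by (simp add: gsum_def nn_integral_count_space_finite)
qed

lemma gsum_cong: "(\<And>i. length i = k \<Longrightarrow> f i = g i) \<Longrightarrow> gsum k f = gsum k g"
  unfolding gsum_def by (intro nn_integral_cong) auto

lemma gsum_mono: "(\<And>i. length i = k \<Longrightarrow> f i \<le> g i) \<Longrightarrow> gsum k f \<le> gsum k g"
  unfolding gsum_def by (intro nn_integral_mono) auto

lemma gsum_cmult: "gsum k (\<lambda>i. c * f i) = c * gsum k f"
  unfolding gsum_def by (intro nn_integral_cmult) auto

lemma gsum_multc: "gsum k (\<lambda>i. f i * c) = gsum k f * c"
  unfolding gsum_def by (intro nn_integral_multc) auto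

lemma gsum_plus: "gsum k (\<lambda>i. f i + g i) = gsum k f + gsum k g"
  unfolding gsum_def by (intro nn_integral_add) auto

lemma nn_integral_count_space_prod:
  fixes f :: "'a \<Rightarrow> 'b \<Rightarrow> ennreal"
  shows "(\<integral>\<^sup>+ x. f (fst x) (snd x) \<partial>count_space (A \<times> B)) =
    (\<integral>\<^sup>+ a. \<integral>\<^sup>+ b. f a b \<partial>count_space B \<partial>count_space A)"
proof -
  have "(\<integral>\<^sup>+ a. \<integral>\<^sup>+ b. f a b \<partial>count_space B \<partial>count_space A)
     = (\<integral>\<^sup>+ a. \<integral>\<^sup>+ b. f a b * indicator B b * indicator A a \<partial>count_space UNIV \<partial>count_space UNIV)"
    by (auto simp: nn_integral_count_space_indicator nn_integral_multc intro!: nn_integral_cong)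
  also have "\<dots> = (\<integral>\<^sup>+ x. f (fst x) (snd x) * indicator B (snd x) * indicator A (fst x) \<partial>count_space UNIV)"
    by (subst nn_integral_fst_count_space[symmetric]) simp
  also have "\<dots> = (\<integral>\<^sup>+ x. f (fst x) (snd x) \<partial>count_space (A \<times> B))"
    by (auto simp: nn_integral_count_space_indicator indicator_def intro!: nn_integral_cong)
  finally show ?thesis by simp
qed

text \<open>Since the head of a list is its latest label, a node of generation \<open>g + k\<close>
  is uniquely \<open>i @ u\<close> with \<open>u\<close> its ancestor in generation \<open>g\<close>
  and \<open>i\<close> the path below \<open>u\<close>.\<close>

lemma gsum_add: "gsum (g + k) f = gsum g (\<lambda>u. gsum k (\<lambda>i. f (i @ u)))"
proof -
  have "bij_betw (\<lambda>x. snd x @ fst x) ({u. length u = g} \<times> {i. length i = k}) {i :: nat list. length i = g + k}"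
    by (intro bij_betwI[where g="\<lambda>i. (drop k i, take k i)"]) auto
  then show ?thesis
    unfolding gsum_def nn_integral_count_space_prod[symmetric]
    by (subst nn_integral_bij_count_space[symmetric]) auto
qed

lemma gsum_1: "gsum (Suc 0) f = (\<Sum>c. f [c])"
proof -
  have "bij_betw (\<lambda>c. [c]) UNIV {i :: nat list. length i = Suc 0}"
    by (intro bij_betwI[where g="hd"]) (auto simp: length_Suc_conv)
  then show ?thesis
    unfolding gsum_def nn_integral_count_space_nat[symmetric]
    by (subst nn_integral_bij_count_space[symmetric]) auto
qed

lemma gsum_Suc: "gsum (Suc k) f = gsum k (\<lambda>i. \<Sum>c. f (c # i))"
  using gsum_add[of k "Suc 0" f] by (simp add: gsum_1)

lemma borel_measurable_gsum [measurable]: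
  assumes "\<And>i. f i \<in> borel_measurable M"
  shows "(\<lambda>x. gsum k (\<lambda>i. f i x)) \<in> borel_measurable M"
  using assms
proof (induction k arbitrary: f)
  case 0
  then show ?case by simp
next
  case (Suc k)
  have "(\<lambda>x. \<Sum>c. f (c # i) x) \<in> borel_measurable M" for i
    using Suc.prems by measurable
  from Suc.IH[OF this] show ?case by (simp add: gsum_Suc)
qed

lemma nn_integral_gsum:
  assumes "\<And>i. f i \<in> borel_measurable M"
  shows "(\<integral>\<^sup>+ x. gsum k (\<lambda>i. f i x) \<partial>M) = gsum k (\<lambda>i. \<integral>\<^sup>+ x. f i x \<partial>M)"
  unfolding gsum_def by (intro nn_integral_count_space_nn_integral assms) auto

lemma gsum_ge: "length i = k \<Longrightarrow> f i \<le> gsum k f"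
  unfolding gsum_def by (rule nn_integral_ge_point) auto

text \<open>A value strictly below a supremum of partial sums is exceeded by one of them; an
  infinite generation is enumerated for this. It reduces estimates on a whole generation to finitely
  many boxes.\<close>

lemma less_gsumD:
  assumes "s < gsum k f"
  shows "\<exists>B. finite B \<and> (\<forall>i\<in>B. length i = k) \<and> s < (\<Sum>i\<in>B. f i)"
proof (cases "finite {i :: nat list. length i = k}")
  case True
  then show ?thesis using assms
    by (intro exI[of _ "{i. length i = k}"]) (auto simp: gsum_def nn_integral_count_space_finite)
next
  case False
  let ?e = "from_nat_into {i :: nat list. length i = k}"
  have b: "bij_betw ?e UNIV {i :: nat list. length i = k}"
    using False by (intro bij_betw_from_nat_into) auto
  have "gsum k f = (\<Sum>n. f (?e n))"
    unfolding gsum_def nn_integral_count_space_nat[symmetric]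
    by (rule nn_integral_bij_count_space[OF b, symmetric])
  also have "\<dots> = (SUP n. \<Sum>i<n. f (?e i))"
    by (rule suminf_eq_SUP)
  finally obtain n where n: "s < (\<Sum>i<n. f (?e i))"
    using assms by (auto simp: less_SUP_iff)
  have "inj_on ?e {..<n}" using b by (auto simp: bij_betw_def intro: inj_on_subset)
  then have "(\<Sum>i<n. f (?e i)) = (\<Sum>i\<in>?e ` {..<n}. f i)"
    by (simp add: sum.reindex)
  moreover have "length (?e m) = k" for m
    using bij_betwE[OF b] by blast
  ultimately show ?thesis using n by (intro exI[of _ "?e ` {..<n}"]) auto
qed

text \<open>Plays the part of measurability with respect to the coordinates in \<open>K\<close>, but
  as a pointwise condition on all families, inside the space or not; measurability on the full
  product is assumed separately.\<close>

definition depends_on :: "'i set \<Rightarrow> (('i \<Rightarrow> 'a) \<Rightarrow> 'b) \<Rightarrow> bool" where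
  "depends_on K F \<longleftrightarrow> (\<forall>x y. (\<forall>i\<in>K. x i = y i) \<longrightarrow> F x = F y)"

lemma depends_onI: "(\<And>x y. (\<And>i. i \<in> K \<Longrightarrow> x i = y i) \<Longrightarrow> F x = F y) \<Longrightarrow> depends_on K F"
  unfolding depends_on_def by blast

lemma depends_onD: "depends_on K F \<Longrightarrow> (\<And>i. i \<in> K \<Longrightarrow> x i = y i) \<Longrightarrow> F x = F y"
  unfolding depends_on_def by blast

lemma depends_on_subset: "depends_on K F \<Longrightarrow> K \<subseteq> J \<Longrightarrow> depends_on J F"
  unfolding depends_on_def by blast

lemma depends_on_comp2: "depends_on K F \<Longrightarrow> depends_on K G \<Longrightarrow> depends_on K (\<lambda>x. h (F x) (G x))"
  by (intro depends_onI arg_cong2[where f=h]) (rule depends_onD, assumption, simp)+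

lemma (in prob_space) indep_vars_coordinates:
  "prob_space.indep_vars (PiM UNIV (\<lambda>_ :: 'i. M)) (\<lambda>_. M) (\<lambda>i x. x i) UNIV"
proof -
  interpret P: product_prob_space "\<lambda>_ :: 'i. M" UNIV by unfold_locales
  let ?E = "PiM UNIV (\<lambda>_ :: 'i. M)"
  have "distr ?E ?E (\<lambda>x. \<lambda>i\<in>UNIV. x i) = ?E"
    by (simp add: restrict_UNIV distr_id)
  moreover have "distr ?E M (\<lambda>x. x i) = M" for i
    by (rule P.PiM_component) simp
  ultimately show ?thesis
    by (subst P.indep_vars_iff_distr_eq_PiM') auto
qed

text \<open>\<open>F\<close> factors through the restriction to \<open>K\<close>: restrict, fill up
  with a constant point \<open>d\<close>, apply \<open>F\<close>. Restrictions to disjoint index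
  sets are independent because the coordinates are.\<close>

lemma (in prob_space) nn_integral_PiM_mult:
  assumes F [measurable]: "F \<in> borel_measurable (PiM UNIV (\<lambda>_ :: 'i. M))" and dF: "depends_on K F"
    and G [measurable]: "G \<in> borel_measurable (PiM UNIV (\<lambda>_ :: 'i. M))" and dG: "depends_on J G"
    and disj: "K \<inter> J = {}"
  shows "(\<integral>\<^sup>+ x. F x * G x \<partial>PiM UNIV (\<lambda>_. M)) =
    (\<integral>\<^sup>+ x. F x \<partial>PiM UNIV (\<lambda>_. M)) * (\<integral>\<^sup>+ x. G x \<partial>PiM UNIV (\<lambda>_. M))"
proof -
  let ?E = "PiM UNIV (\<lambda>_ :: 'i. M)"
  interpret E: prob_space ?E by (rule prob_space_PiM) unfold_locales
  obtain d where d: "d \<in> space M" using not_empty by auto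
  define ext where "ext K x = (\<lambda>i. if i \<in> K then x i else d)" for K :: "'i set" and x
  have ext [measurable]: "ext K \<in> measurable (PiM K (\<lambda>_. M)) ?E" for K
    unfolding ext_def
  proof (rule measurable_PiM_single')
    fix i :: 'i
    show "(\<lambda>x. if i \<in> K then x i else d) \<in> PiM K (\<lambda>_. M) \<rightarrow>\<^sub>M M"
      using d by (cases "i \<in> K") auto
  qed (use d in \<open>auto simp: space_PiM PiE_iff extensional_def\<close>)
  have iv: "E.indep_var (PiM K (\<lambda>_. M)) (\<lambda>x. restrict (\<lambda>i. x i) K) (PiM J (\<lambda>_. M)) (\<lambda>x. restrict (\<lambda>i. x i) J)"
    by (rule E.indep_var_restrict[OF indep_vars_coordinates disj]) auto
  have FK: "F \<circ> ext K \<in> borel_measurable (PiM K (\<lambda>_. M))" by (intro measurable_comp[OF ext F])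
  have GJ: "G \<circ> ext J \<in> borel_measurable (PiM J (\<lambda>_. M))" by (intro measurable_comp[OF ext G])
  have Fe: "(F \<circ> ext K) (restrict (\<lambda>i. x i) K) = F x" for x
    unfolding o_def by (rule depends_onD[OF dF]) (simp add: ext_def)
  have Ge: "(G \<circ> ext J) (restrict (\<lambda>i. x i) J) = G x" for x
    unfolding o_def by (rule depends_onD[OF dG]) (simp add: ext_def)
  have "E.indep_var borel ((F \<circ> ext K) \<circ> (\<lambda>x. restrict (\<lambda>i. x i) K)) borel ((G \<circ> ext J) \<circ> (\<lambda>x. restrict (\<lambda>i. x i) J))"
    by (rule E.indep_var_compose[OF iv FK GJ])
  then have *: "E.indep_var borel F borel G"
    using Fe Ge by (simp add: comp_def)
  have "(\<integral>\<^sup>+ x. (\<Prod>b\<in>UNIV. case_bool F G b x) \<partial>?E) = (\<Prod>b\<in>UNIV. \<integral>\<^sup>+ x. case_bool F G b x \<partial>?E)"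
  proof (rule E.indep_vars_nn_integral)
    have "(\<lambda>_. borel) = case_bool borel (borel :: ennreal measure)" by (auto simp: fun_eq_iff split: bool.split)
    then show "E.indep_vars (\<lambda>_. borel) (case_bool F G) UNIV"
      using * unfolding E.indep_var_def by simp
  qed auto
  then show ?thesis by (simp add: UNIV_bool mult.commute)
qed

lemma (in prob_space) nn_integral_PiM_prod:
  assumes "finite U"
    and F: "\<And>u. u \<in> U \<Longrightarrow> F u \<in> borel_measurable (PiM UNIV (\<lambda>_ :: 'i. M))"
    and dF: "\<And>u. u \<in> U \<Longrightarrow> depends_on (K u) (F u)"
    and disj: "disjoint_family_on K U"
  shows "(\<integral>\<^sup>+ x. (\<Prod>u\<in>U. F u x) \<partial>PiM UNIV (\<lambda>_. M)) = (\<Prod>u\<in>U. \<integral>\<^sup>+ x. F u x \<partial>PiM UNIV (\<lambda>_. M))"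
  using assms
proof (induction U)
  case empty
  interpret E: prob_space "PiM UNIV (\<lambda>_ :: 'i. M)" by (rule prob_space_PiM) unfold_locales
  show ?case by (simp add: E.emeasure_space_1)
next
  case (insert u U)
  have "(\<integral>\<^sup>+ x. F u x * (\<Prod>u\<in>U. F u x) \<partial>PiM UNIV (\<lambda>_. M)) =
    (\<integral>\<^sup>+ x. F u x \<partial>PiM UNIV (\<lambda>_. M)) * (\<integral>\<^sup>+ x. (\<Prod>u\<in>U. F u x) \<partial>PiM UNIV (\<lambda>_. M))"
  proof (rule nn_integral_PiM_mult[where K="K u" and J="\<Union>(K ` U)"])
    show "F u \<in> borel_measurable (PiM UNIV (\<lambda>_. M))" "depends_on (K u) (F u)"
      using insert by auto
    show "(\<lambda>x. \<Prod>u\<in>U. F u x) \<in> borel_measurable (PiM UNIV (\<lambda>_. M))"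
      using insert by (intro borel_measurable_prod_ennreal) auto
    show "depends_on (\<Union>(K ` U)) (\<lambda>x. \<Prod>u\<in>U. F u x)"
    proof (intro depends_onI prod.cong refl)
      fix x y :: "'i \<Rightarrow> 'a" and v assume xy: "\<And>i. i \<in> \<Union>(K ` U) \<Longrightarrow> x i = y i" and v: "v \<in> U"
      have "depends_on (K v) (F v)" using insert.prems v by auto
      then show "F v x = F v y" by (rule depends_onD) (use xy v in auto)
    qed
    show "K u \<inter> \<Union>(K ` U) = {}"
      using insert by (auto simp: disjoint_family_on_def)
  qed
  moreover have "(\<integral>\<^sup>+ x. (\<Prod>u\<in>U. F u x) \<partial>PiM UNIV (\<lambda>_. M)) = (\<Prod>u\<in>U. \<integral>\<^sup>+ x. F u x \<partial>PiM UNIV (\<lambda>_. M))"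
    using insert by (intro insert.IH) (auto simp: disjoint_family_on_def)
  ultimately show ?case using insert by simp
qed

lemma (in prob_space) distr_PiM_inj:
  fixes f :: "'j \<Rightarrow> 'i"
  assumes "inj f"
  shows "distr (PiM UNIV (\<lambda>_. M)) (PiM UNIV (\<lambda>_. M)) (\<lambda>x n. x (f n)) = PiM UNIV (\<lambda>_. M)"
  using distr_PiM_reindex[of UNIV "\<lambda>_ :: 'i. M" f UNIV] assms prob_space_axioms
  by (simp add: restrict_UNIV)

lemma measurable_PiM_inj:
  "(\<lambda>x n. x (f n)) \<in> measurable (PiM UNIV (\<lambda>_. M)) (PiM UNIV (\<lambda>_. M))"
  by (rule measurable_PiM_single') (auto simp: space_PiM PiE_iff)

lemma (in prob_space) nn_integral_PiM_inj:
  fixes f :: "'j \<Rightarrow> 'i"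
  assumes "inj f" and [measurable]: "F \<in> borel_measurable (PiM UNIV (\<lambda>_. M))"
  shows "(\<integral>\<^sup>+ x. F (\<lambda>n. x (f n)) \<partial>PiM UNIV (\<lambda>_. M)) = (\<integral>\<^sup>+ x. F x \<partial>PiM UNIV (\<lambda>_. M))"
proof -
  have "(\<integral>\<^sup>+ x. F x \<partial>PiM UNIV (\<lambda>_. M)) = (\<integral>\<^sup>+ x. F x \<partial>distr (PiM UNIV (\<lambda>_. M)) (PiM UNIV (\<lambda>_. M)) (\<lambda>x n. x (f n)))"
    by (simp add: distr_PiM_inj[OF assms(1)])
  also have "\<dots> = (\<integral>\<^sup>+ x. F (\<lambda>n. x (f n)) \<partial>PiM UNIV (\<lambda>_. M))"
    by (rule nn_integral_distr[OF measurable_PiM_inj]) measurable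
  finally show ?thesis by simp
qed

section \<open>The environment and its size-biased paths\<close>

text \<open>Coordinate \<open>i\<close> is independent of all others, so if \<Phi> sees the family
  only off \<open>i\<close>, the value \<open>x i\<close> in the second argument may be resampled.
  This serves both for the split of a box given its past and for the last step of a walk.\<close>

lemma (in prob_space) nn_integral_PiM_coordinate:
  assumes Phi [measurable]: "(\<lambda>(x, p). \<Phi> x p) \<in> borel_measurable (PiM UNIV (\<lambda>_ :: 'i. M) \<Otimes>\<^sub>M M)"
    and dep: "\<And>p. depends_on (- {i}) (\<lambda>x. \<Phi> x p)"
  shows "(\<integral>\<^sup>+ x. \<Phi> x (x i) \<partial>PiM UNIV (\<lambda>_. M)) = (\<integral>\<^sup>+ x. \<integral>\<^sup>+ p. \<Phi> x p \<partial>M \<partial>PiM UNIV (\<lambda>_. M))"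
proof -
  let ?E = "PiM UNIV (\<lambda>_ :: 'i. M)" and ?A = "PiM (- {i}) (\<lambda>_. M)" and ?B = "PiM {i} (\<lambda>_. M)"
  interpret P: product_prob_space "\<lambda>_ :: 'i. M" UNIV by unfold_locales
  obtain d where d: "d \<in> space M" using not_empty by auto
  define ext where "ext x = (\<lambda>n. if n \<in> - {i} then x n else d)" for x
  have ext [measurable]: "ext \<in> measurable ?A ?E"
    unfolding ext_def
  proof (rule measurable_PiM_single')
    fix n :: 'i
    show "(\<lambda>x. if n \<in> - {i} then x n else d) \<in> ?A \<rightarrow>\<^sub>M M"
      using d by (cases "n \<in> - {i}") auto
  qed (use d in \<open>auto simp: space_PiM PiE_iff extensional_def\<close>)
  have iv: "P.indep_var ?A (\<lambda>x. restrict x (- {i})) (PiM {i} (\<lambda>_. M)) (\<lambda>x. restrict x {i})"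
    by (rule P.indep_var_restrict[OF indep_vars_coordinates]) auto
  have eq: "distr ?E ?A (\<lambda>x. restrict x (- {i})) \<Otimes>\<^sub>M distr ?E ?B (\<lambda>x. restrict x {i}) =
      distr ?E (?A \<Otimes>\<^sub>M ?B) (\<lambda>x. (restrict x (- {i}), restrict x {i}))"
    using iv unfolding P.indep_var_distribution_eq by simp
  have \<Phi>e: "\<Phi> (ext (restrict x (- {i}))) p = \<Phi> x p" for x p
    by (rule depends_onD[OF dep]) (simp add: ext_def)
  have m [measurable]: "(\<lambda>(a, y). \<Phi> (ext a) (y i)) \<in> borel_measurable (?A \<Otimes>\<^sub>M ?B)"
    by measurable
  interpret D: prob_space "distr ?E ?B (\<lambda>x. restrict x {i})"
    by (rule P.prob_space_distr) measurable
  have "(\<integral>\<^sup>+ x. \<Phi> x (x i) \<partial>?E) = (\<integral>\<^sup>+ x. (case (restrict x (- {i}), restrict x {i}) of (a, y) \<Rightarrow> \<Phi> (ext a) (y i)) \<partial>?E)"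
    by (simp add: \<Phi>e)
  also have "\<dots> = (\<integral>\<^sup>+ z. (case z of (a, y) \<Rightarrow> \<Phi> (ext a) (y i)) \<partial>distr ?E (?A \<Otimes>\<^sub>M ?B) (\<lambda>x. (restrict x (- {i}), restrict x {i})))"
    by (rule nn_integral_distr[symmetric]) measurable
  also have "\<dots> = (\<integral>\<^sup>+ a. \<integral>\<^sup>+ y. \<Phi> (ext a) (y i) \<partial>distr ?E ?B (\<lambda>x. restrict x {i}) \<partial>distr ?E ?A (\<lambda>x. restrict x (- {i})))"
    unfolding eq[symmetric] using m
    by (subst D.nn_integral_fst[symmetric]) (auto cong: measurable_cong_sets)
  also have "\<dots> = (\<integral>\<^sup>+ x. \<integral>\<^sup>+ y. \<Phi> (ext (restrict x (- {i}))) (y i) \<partial>distr ?E ?B (\<lambda>x. restrict x {i}) \<partial>?E)"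
    using m by (subst nn_integral_distr) (auto cong: measurable_cong_sets)
  also have "\<dots> = (\<integral>\<^sup>+ x. \<integral>\<^sup>+ p. \<Phi> x p \<partial>M \<partial>?E)"
  proof (rule nn_integral_cong)
    fix x assume "x \<in> space ?E"
    then have [measurable]: "\<Phi> x \<in> borel_measurable M"
      using measurable_compose[OF measurable_Pair1' Phi, of x] by simp
    have "(\<integral>\<^sup>+ y. \<Phi> x (y i) \<partial>distr ?E ?B (\<lambda>x. restrict x {i})) = (\<integral>\<^sup>+ z. \<Phi> x (z i) \<partial>?E)"
      by (subst nn_integral_distr) auto
    also have "\<dots> = (\<integral>\<^sup>+ p. \<Phi> x p \<partial>distr ?E M (\<lambda>z. z i))"
      by (rule nn_integral_distr[symmetric]) measurable
    finally show "(\<integral>\<^sup>+ y. \<Phi> (ext (restrict x (- {i}))) (y i) \<partial>distr ?E ?B (\<lambda>x. restrict x {i})) = (\<integral>\<^sup>+ p. \<Phi> x p \<partial>M)"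
      by (simp add: \<Phi>e P.PiM_component)
  qed
  finally show ?thesis .
qed

section \<open>Boxes, subtrees and increments in a fixed environment\<close>

abbreviation bsize :: "(nat list \<Rightarrow> nat measure) \<Rightarrow> nat list \<Rightarrow> real" where
  "bsize \<equiv> box_size (\<lambda>i e. e i)"

abbreviation subtree :: "nat list \<Rightarrow> (nat list \<Rightarrow> 'a) \<Rightarrow> nat list \<Rightarrow> 'a" where
  "subtree u e \<equiv> \<lambda>n. e (n @ u)"

lemma box_size_eq_bsize: "box_size \<rho> \<omega> i = bsize (\<lambda>i. \<rho> i \<omega>) i"
  by (induction i) auto

lemma bsize_nonneg [simp]: "0 \<le> bsize e i"
  by (induction i) auto

lemma bsize_append: "bsize e (i @ u) = bsize e u * bsize (subtree u e) i"
  by (induction i) auto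

lemma depends_on_bsize: "length u \<le> k \<Longrightarrow> depends_on {i. length i < k} (\<lambda>e. bsize e u)"
proof (induction u)
  case Nil
  then show ?case by (auto intro: depends_onI)
next
  case (Cons c u)
  then have "depends_on {i. length i < k} (\<lambda>e. bsize e u)" "depends_on {i. length i < k} (\<lambda>e. mass (e u) c)"
    by (auto intro!: depends_onI)
  then show ?case by (auto intro: depends_on_comp2)
qed

text \<open>Increments are indexed chronologically, although a list starts with its most recent label; beyond the
  length of the list they are 0.\<close>

primrec incs :: "(nat list \<Rightarrow> nat measure) \<Rightarrow> nat list \<Rightarrow> nat \<Rightarrow> real" where
  "incs e [] = (\<lambda>_. 0)"
| "incs e (c # i) = (incs e i)(length i := - ln (mass (e i) c))"

lemma depends_on_incs: "length u \<le> k \<Longrightarrow> depends_on {i. length i < k} (\<lambda>e. incs e u)"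
proof (induction u)
  case Nil
  then show ?case by (auto intro: depends_onI)
next
  case (Cons c u)
  then have "depends_on {i. length i < k} (\<lambda>e. incs e u)" "depends_on {i. length i < k} (\<lambda>e. - ln (mass (e u) c))"
    by (auto intro!: depends_onI)
  from depends_on_comp2[OF this, of "\<lambda>f y. f(length u := y)"]
  show ?case unfolding incs.simps .
qed

lemma ln_bsize: "bsize e i > 0 \<Longrightarrow> - ln (bsize e i) = (\<Sum>m<length i. incs e i m)"
proof (induction i)
  case (Cons c i)
  have pos: "bsize e i > 0" "mass (e i) c > 0"
    using Cons.prems bsize_nonneg[of e i] measure_nonneg[of "e i" "{c}"]
    by (auto simp: zero_less_mult_iff)
  have "(\<Sum>m<length i. incs e (c # i) m) = (\<Sum>m<length i. incs e i m)"
    by (intro sum.cong) auto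
  then show ?case using Cons.IH pos by (simp add: ln_mult)
qed auto

section \<open>The canonical environment and its tilted displacement law\<close>

locale splitting = prob_space \<nu> for \<nu> :: "nat measure measure" +
  assumes sets_nu: "sets \<nu> = sets prob_on_labels"
begin

abbreviation E :: "(nat list \<Rightarrow> nat measure) measure" where
  "E \<equiv> PiM UNIV (\<lambda>_. \<nu>)"

sublocale E: product_prob_space "\<lambda>_ :: nat list. \<nu>" UNIV
  by unfold_locales

lemma space_nu: "space \<nu> = {p. sets p = UNIV \<and> prob_space p}"
  using sets_eq_imp_space_eq[OF sets_nu] by (simp add: space_prob_algebra)

lemma measurable_mass [measurable]: "(\<lambda>p. mass p c) \<in> borel_measurable \<nu>"
proof -
  have "(\<lambda>p. mass p c) \<in> borel_measurable prob_on_labels" by measurable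
  then show ?thesis using sets_nu by (simp cong: measurable_cong_sets)
qed

lemma measurable_mass2 [measurable]: "(\<lambda>(p, c). mass p c) \<in> borel_measurable (\<nu> \<Otimes>\<^sub>M count_space UNIV)"
  using measurable_compose_countable[of "\<lambda>c z. mass (fst z) c" "\<nu> \<Otimes>\<^sub>M count_space UNIV" borel snd]
  by (simp add: case_prod_beta)

lemma mass_le_1: "p \<in> space \<nu> \<Longrightarrow> mass p c \<le> 1"
  by (simp add: space_nu prob_space.prob_le_1)

lemma mass_sums: "p \<in> space \<nu> \<Longrightarrow> mass p sums 1"
proof -
  assume p: "p \<in> space \<nu>"
  interpret p: prob_space p using p by (simp add: space_nu)
  have "space p = UNIV" using p sets_eq_imp_space_eq[of p "count_space UNIV"] by (simp add: space_nu)
  moreover have "(\<lambda>c. p.prob {c}) sums p.prob (\<Union>c. {c})"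
    using p by (intro p.finite_measure_UNION) (auto simp: space_nu disjoint_family_on_def)
  ultimately show ?thesis using p.prob_space by simp
qed

lemma suminf_mass: "p \<in> space \<nu> \<Longrightarrow> (\<Sum>c. ennreal (mass p c)) = 1"
  using mass_sums by (subst suminf_ennreal_eq[of _ 1]) auto

lemma space_E: "e \<in> space E \<Longrightarrow> e i \<in> space \<nu>"
  by (auto simp: space_PiM)

lemma measurable_subtree: "subtree u \<in> measurable E E"
  by (rule measurable_PiM_inj)

lemma nn_integral_subtree: "F \<in> borel_measurable E \<Longrightarrow> (\<integral>\<^sup>+ e. F (subtree u e) \<partial>E) = (\<integral>\<^sup>+ e. F e \<partial>E)"
  by (rule nn_integral_PiM_inj) (auto intro: injI)

lemma bsize_le_1: "e \<in> space E \<Longrightarrow> bsize e i \<le> 1"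
  by (induction i) (auto intro!: mult_le_one mass_le_1 space_E)

lemma measurable_bsize [measurable]: "(\<lambda>e. bsize e i) \<in> borel_measurable E"
proof (induction i)
  case (Cons c i)
  have [measurable]: "(\<lambda>e. mass (e i) c) \<in> borel_measurable E"
    by measurable
  show ?case using Cons by simp
qed auto

lemma measurable_incs [measurable]: "(\<lambda>e. incs e i) \<in> measurable E (PiM UNIV (\<lambda>_. borel))"
proof (induction i)
  case Nil
  then show ?case by (simp add: space_PiM)
next
  case (Cons c i)
  have m: "(\<lambda>e. mass (e i) c) \<in> borel_measurable E" by measurable
  show ?case
  proof (rule measurable_PiM_single')
    fix n
    have "(\<lambda>e. incs e i n) \<in> borel_measurable E"
      using measurable_compose[OF Cons measurable_component_singleton[of n UNIV]] by simp
    then show "(\<lambda>e. incs e (c # i) n) \<in> borel_measurable E"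
      using m by (cases "n = length i") auto
  qed (auto simp: space_PiM)
qed

lemma gsum_bsize: "e \<in> space E \<Longrightarrow> gsum k (\<lambda>i. ennreal (bsize e i)) = 1"
proof (induction k)
  case (Suc k)
  have "gsum (Suc k) (\<lambda>i. ennreal (bsize e i)) = gsum k (\<lambda>i. ennreal (bsize e i) * (\<Sum>c. ennreal (mass (e i) c)))"
    by (simp add: gsum_Suc ennreal_mult)
  also have "\<dots> = gsum k (\<lambda>i. ennreal (bsize e i))"
    using Suc.prems by (intro gsum_cong) (simp only: suminf_mass space_E mult_1_right)
  finally show ?case using Suc by simp
qed simp

text \<open>Size-biased displacement law: a split \<open>p\<close> and a label \<open>c\<close> are
  weighted by \<open>mass p c powr \<theta>\<close>, normalised by \<open>L \<theta>\<close>, and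
  \<open>- ln (mass p c)\<close> is recorded. Labels of mass 0 have weight 0, so the value of
  \<open>ln 0\<close> is never charged.\<close>

definition tilt :: "real \<Rightarrow> real measure" where
  "tilt \<theta> = distr (density (\<nu> \<Otimes>\<^sub>M count_space UNIV) (\<lambda>(p, c). ennreal (mass p c powr \<theta>) / Lfun \<nu> \<theta>))
     borel (\<lambda>(p, c). - ln (mass p c))"

lemma sets_tilt [simp, measurable_cong]: "sets (tilt \<theta>) = sets borel"
  by (simp add: tilt_def)

lemma space_tilt [simp]: "space (tilt \<theta>) = UNIV"
  by (simp add: tilt_def)

lemma Lfun_1: "Lfun \<nu> 1 = 1"
proof -
  have "Lfun \<nu> 1 = (\<integral>\<^sup>+ p. 1 \<partial>\<nu>)"
    unfolding Lfun_def by (intro nn_integral_cong) (simp add: suminf_mass mass_sums[THEN sums_unique, symmetric])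
  then show ?thesis by (simp add: emeasure_space_1)
qed

lemma Lfun_le: "1 \<le> \<theta> \<Longrightarrow> Lfun \<nu> \<theta> \<le> 1"
proof -
  assume \<theta>: "1 \<le> \<theta>"
  have "mass p c powr \<theta> \<le> mass p c" if "p \<in> space \<nu>" for p c
    using powr_mono'[OF \<theta> measure_nonneg mass_le_1[OF that, of c]] by (cases "mass p c = 0") auto
  then have "Lfun \<nu> \<theta> \<le> (\<integral>\<^sup>+ p. (\<Sum>c. ennreal (mass p c)) \<partial>\<nu>)"
    unfolding Lfun_def by (intro nn_integral_mono suminf_le ennreal_leI) auto
  also have "\<dots> = Lfun \<nu> 1" by (simp add: Lfun_def)
  finally show ?thesis by (simp add: Lfun_1)
qed

lemma Lfun_pos: "Lfun \<nu> \<theta> \<noteq> 0"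
proof
  assume "Lfun \<nu> \<theta> = 0"
  then have "AE p in \<nu>. (\<Sum>c. ennreal (mass p c powr \<theta>)) = 0"
    unfolding Lfun_def by (subst (asm) nn_integral_0_iff_AE) auto
  moreover have "AE p in \<nu>. (\<Sum>c. ennreal (mass p c powr \<theta>)) \<noteq> 0"
  proof (rule AE_I2)
    fix p assume p: "p \<in> space \<nu>"
    have "\<exists>c. mass p c \<noteq> 0"
      using mass_sums[OF p] by (metis sums_0 sums_unique2 zero_neq_one)
    then obtain c where "mass p c > 0" using measure_nonneg[of p] by (metis order_le_less)
    then have "0 < ennreal (mass p c powr \<theta>)" by simp
    also have "\<dots> = sum (\<lambda>c. ennreal (mass p c powr \<theta>)) {c}" by simp
    also have "\<dots> \<le> (\<Sum>c. ennreal (mass p c powr \<theta>))" by (rule sum_le_suminf) auto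
    finally show "(\<Sum>c. ennreal (mass p c powr \<theta>)) \<noteq> 0" by simp
  qed
  ultimately have "AE p in \<nu>. False" by eventually_elim auto
  then show False by simp
qed

text \<open>Multiplied out by \<open>Lfun \<nu> \<theta>\<close> so that no \<open>ennreal\<close>
  quotient remains; the factor is neither 0 nor infinite for
  \<open>1 \<le> \<theta>\<close>.\<close>

lemma nn_integral_tilt:
  assumes "1 \<le> \<theta>" and [measurable]: "f \<in> borel_measurable borel"
  shows "(\<integral>\<^sup>+ y. f y \<partial>tilt \<theta>) * Lfun \<nu> \<theta> = (\<integral>\<^sup>+ p. (\<Sum>c. ennreal (mass p c powr \<theta>) * f (- ln (mass p c))) \<partial>\<nu>)"
proof -
  interpret C: sigma_finite_measure "count_space (UNIV :: nat set)"
    by (rule sigma_finite_measure_count_space)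
  have L: "Lfun \<nu> \<theta> \<noteq> 0" "Lfun \<nu> \<theta> \<noteq> top"
    using Lfun_pos Lfun_le[OF assms(1)] by (auto simp: top_unique)
  have "(\<integral>\<^sup>+ y. f y \<partial>tilt \<theta>) = (\<integral>\<^sup>+ z. (case z of (p, c) \<Rightarrow> ennreal (mass p c powr \<theta>) / Lfun \<nu> \<theta> * f (- ln (mass p c))) \<partial>(\<nu> \<Otimes>\<^sub>M count_space UNIV))"
    unfolding tilt_def
    by (subst nn_integral_distr, measurable) (subst nn_integral_density, auto simp: case_prod_beta intro!: nn_integral_cong)
  also have "\<dots> = (\<integral>\<^sup>+ p. (\<integral>\<^sup>+ c. ennreal (mass p c powr \<theta>) / Lfun \<nu> \<theta> * f (- ln (mass p c)) \<partial>count_space UNIV) \<partial>\<nu>)"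
    by (subst C.nn_integral_fst[symmetric]) (auto simp: case_prod_beta)
  also have "\<dots> = (\<integral>\<^sup>+ p. (\<Sum>c. ennreal (mass p c powr \<theta>) * f (- ln (mass p c))) / Lfun \<nu> \<theta> \<partial>\<nu>)"
    by (intro nn_integral_cong)
      (simp add: nn_integral_count_space_nat divide_ennreal_def mult_ac flip: ennreal_suminf_cmult)
  also have "\<dots> = (\<integral>\<^sup>+ p. (\<Sum>c. ennreal (mass p c powr \<theta>) * f (- ln (mass p c))) \<partial>\<nu>) / Lfun \<nu> \<theta>"
    by (intro nn_integral_divide) measurable
  finally show ?thesis
    using L by (simp add: ennreal_divide_times ennreal_times_divide mult_divide_eq_ennreal)
qed

lemma prob_space_tilt: assumes "1 \<le> \<theta>" shows "prob_space (tilt \<theta>)"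
proof (rule prob_spaceI)
  have L: "Lfun \<nu> \<theta> \<noteq> 0" "Lfun \<nu> \<theta> \<noteq> top"
    using Lfun_pos Lfun_le[OF assms(1)] by (auto simp: top_unique)
  have "(\<integral>\<^sup>+ y. 1 \<partial>tilt \<theta>) * Lfun \<nu> \<theta> = 1 * Lfun \<nu> \<theta>"
    using nn_integral_tilt[OF assms, of "\<lambda>_. 1"] unfolding Lfun_def by (simp only: mult_1_right mult_1_left borel_measurable_const)
  then show "emeasure (tilt \<theta>) (space (tilt \<theta>)) = 1"
    using L ennreal_mult_cancel_left[of "Lfun \<nu> \<theta>" "emeasure (tilt \<theta>) UNIV" 1]
    by (simp add: mult.commute)
qed

abbreviation RW :: "real \<Rightarrow> (nat \<Rightarrow> real) measure" where
  "RW \<theta> \<equiv> PiM UNIV (\<lambda>_. tilt \<theta>)"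

text \<open>Many-to-one formula. In the induction step the split \<open>e i\<close> of a box of
  generation \<open>k\<close> is independent of the size and increments of \<open>i\<close>, which
  look only at its ancestors; resampling it turns the sum over children into one more step with law
  \<open>tilt \<theta>\<close> and one more factor \<open>L \<theta>\<close>.\<close>

lemma many_to_one:
  assumes \<theta>: "1 \<le> \<theta>" and h: "h \<in> borel_measurable (PiM UNIV (\<lambda>_. borel))" and dep: "depends_on {..<k} h"
  shows "(\<integral>\<^sup>+ e. gsum k (\<lambda>i. ennreal (bsize e i powr \<theta>) * h (incs e i)) \<partial>E) =
    Lfun \<nu> \<theta> ^ k * (\<integral>\<^sup>+ \<omega>. h \<omega> \<partial>RW \<theta>)"
  using h dep
proof (induction k arbitrary: h)
  case 0
  interpret T: prob_space "tilt \<theta>" by (rule prob_space_tilt[OF \<theta>])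
  interpret R: product_prob_space "\<lambda>_ :: nat. tilt \<theta>" UNIV by unfold_locales
  have "h \<omega> = h (\<lambda>_. 0)" for \<omega>
    using 0(2) by (auto intro: depends_onD)
  then have "(\<integral>\<^sup>+ \<omega>. h \<omega> \<partial>RW \<theta>) = (\<integral>\<^sup>+ \<omega>. h (\<lambda>_. 0) \<partial>RW \<theta>)" by metis
  then show ?case using R.emeasure_space_1 E.emeasure_space_1 by simp
next
  case (Suc k)
  interpret T: prob_space "tilt \<theta>" by (rule prob_space_tilt[OF \<theta>])
  note h [measurable] = Suc.prems(1)
  \<comment> \<open>The last step averaged out: a functional of the first \<open>k\<close> steps, to
    which the induction hypothesis applies.\<close>
  define h' where "h' \<omega> = (\<integral>\<^sup>+ y. h (fun_upd \<omega> k y) \<partial>tilt \<theta>)" for \<omega>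
  have upd [measurable]: "(\<lambda>(\<omega>, y). fun_upd \<omega> k y) \<in> PiM UNIV (\<lambda>_. borel) \<Otimes>\<^sub>M borel \<rightarrow>\<^sub>M PiM UNIV (\<lambda>_ :: nat. borel :: real measure)"
  proof (rule measurable_PiM_single')
    fix n
    show "(\<lambda>z. (case z of (\<omega>, y) \<Rightarrow> fun_upd \<omega> k y) n) \<in> borel_measurable (PiM UNIV (\<lambda>_. borel) \<Otimes>\<^sub>M borel)"
      by (cases "n = k") (simp_all add: case_prod_beta)
  qed (auto simp: space_PiM)
  have hu [measurable]: "(\<lambda>(\<omega>, y). h (fun_upd \<omega> k y)) \<in> borel_measurable (PiM UNIV (\<lambda>_. borel) \<Otimes>\<^sub>M borel)"
    using measurable_compose[OF upd h] by (simp add: case_prod_beta)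
  have hu' [measurable]: "(\<lambda>(\<omega>, y). h (fun_upd \<omega> k y)) \<in> borel_measurable (PiM UNIV (\<lambda>_. borel) \<Otimes>\<^sub>M tilt \<theta>)"
    using hu by (simp cong: measurable_cong_sets)
  have h'm [measurable]: "h' \<in> borel_measurable (PiM UNIV (\<lambda>_. borel))"
    unfolding h'_def by measurable
  have h'd: "depends_on {..<k} h'"
    unfolding h'_def
    by (intro depends_onI nn_integral_cong depends_onD[OF Suc.prems(2)]) (auto simp: less_Suc_eq)
  have RWeq: "(\<integral>\<^sup>+ \<omega>. h \<omega> \<partial>RW \<theta>) = (\<integral>\<^sup>+ \<omega>. h' \<omega> \<partial>RW \<theta>)"
  proof -
    have "(\<integral>\<^sup>+ \<omega>. h (fun_upd \<omega> k (\<omega> k)) \<partial>RW \<theta>) = (\<integral>\<^sup>+ \<omega>. \<integral>\<^sup>+ y. h (fun_upd \<omega> k y) \<partial>tilt \<theta> \<partial>RW \<theta>)"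
    proof (rule T.nn_integral_PiM_coordinate)
      have "sets (PiM UNIV (\<lambda>_ :: nat. tilt \<theta>)) = sets (PiM UNIV (\<lambda>_. borel))"
        by (intro sets_PiM_cong) auto
      then show "(\<lambda>(\<omega>, y). h (fun_upd \<omega> k y)) \<in> borel_measurable (RW \<theta> \<Otimes>\<^sub>M tilt \<theta>)"
        using hu' by (simp cong: measurable_cong_sets)
      show "depends_on (- {k}) (\<lambda>\<omega>. h (fun_upd \<omega> k p))" for p
        by (intro depends_onI arg_cong[where f=h]) auto
    qed
    then show ?thesis by (simp add: h'_def)
  qed
  have step: "(\<integral>\<^sup>+ e. ennreal (bsize e i powr \<theta>) * (\<Sum>c. ennreal (mass (e i) c powr \<theta>) * h (fun_upd (incs e i) k (- ln (mass (e i) c)))) \<partial>E)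
      = (\<integral>\<^sup>+ e. Lfun \<nu> \<theta> * (ennreal (bsize e i powr \<theta>) * h' (incs e i)) \<partial>E)" if i: "length i = k" for i
  proof -
    have di: "depends_on (- {i}) (\<lambda>e. incs e i)" "depends_on (- {i}) (\<lambda>e. bsize e i)"
      using i by (auto intro!: depends_on_subset[OF depends_on_incs[of i k]] depends_on_subset[OF depends_on_bsize[of i k]])
    have "(\<lambda>(e, p). (incs e i, - ln (mass p c))) \<in> E \<Otimes>\<^sub>M \<nu> \<rightarrow>\<^sub>M PiM UNIV (\<lambda>_. borel) \<Otimes>\<^sub>M borel" for c
      by measurable
    from measurable_compose[OF this hu]
    have [measurable]: "(\<lambda>(e, p). h (fun_upd (incs e i) k (- ln (mass p c)))) \<in> borel_measurable (E \<Otimes>\<^sub>M \<nu>)" for c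
      by (simp add: case_prod_beta)
    have "(\<integral>\<^sup>+ e. ennreal (bsize e i powr \<theta>) * (\<Sum>c. ennreal (mass (e i) c powr \<theta>) * h (fun_upd (incs e i) k (- ln (mass (e i) c)))) \<partial>E)
      = (\<integral>\<^sup>+ e. \<integral>\<^sup>+ p. ennreal (bsize e i powr \<theta>) * (\<Sum>c. ennreal (mass p c powr \<theta>) * h (fun_upd (incs e i) k (- ln (mass p c)))) \<partial>\<nu> \<partial>E)"
    proof (rule nn_integral_PiM_coordinate)
      show "(\<lambda>(e, p). ennreal (bsize e i powr \<theta>) * (\<Sum>c. ennreal (mass p c powr \<theta>) * h (fun_upd (incs e i) k (- ln (mass p c)))))
        \<in> borel_measurable (E \<Otimes>\<^sub>M \<nu>)"
        by measurable
      show "depends_on (- {i}) (\<lambda>e. ennreal (bsize e i powr \<theta>) * (\<Sum>c. ennreal (mass p c powr \<theta>) * h (fun_upd (incs e i) k (- ln (mass p c)))))" for p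
        by (rule depends_on_comp2[OF di(2,1), of "\<lambda>b f. ennreal (b powr \<theta>) * (\<Sum>c. ennreal (mass p c powr \<theta>) * h (fun_upd f k (- ln (mass p c))))"])
    qed
    also have "\<dots> = (\<integral>\<^sup>+ e. Lfun \<nu> \<theta> * (ennreal (bsize e i powr \<theta>) * h' (incs e i)) \<partial>E)"
    proof (rule nn_integral_cong)
      fix e assume e: "e \<in> space E"
      have [measurable]: "(\<lambda>y. h (fun_upd (incs e i) k y)) \<in> borel_measurable borel"
        using measurable_compose[OF _ hu, of "\<lambda>y. (incs e i, y)" borel] by (simp add: space_PiM)
      have "(\<integral>\<^sup>+ p. ennreal (bsize e i powr \<theta>) * (\<Sum>c. ennreal (mass p c powr \<theta>) * h (fun_upd (incs e i) k (- ln (mass p c)))) \<partial>\<nu>)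
        = ennreal (bsize e i powr \<theta>) * (\<integral>\<^sup>+ p. (\<Sum>c. ennreal (mass p c powr \<theta>) * h (fun_upd (incs e i) k (- ln (mass p c)))) \<partial>\<nu>)"
        by (rule nn_integral_cmult) measurable
      also have "\<dots> = ennreal (bsize e i powr \<theta>) * (h' (incs e i) * Lfun \<nu> \<theta>)"
        unfolding h'_def by (subst nn_integral_tilt[OF \<theta>, symmetric]) auto
      finally show "(\<integral>\<^sup>+ p. ennreal (bsize e i powr \<theta>) * (\<Sum>c. ennreal (mass p c powr \<theta>) * h (fun_upd (incs e i) k (- ln (mass p c)))) \<partial>\<nu>)
        = Lfun \<nu> \<theta> * (ennreal (bsize e i powr \<theta>) * h' (incs e i))"
        by (simp add: mult_ac)
    qed
    finally show ?thesis .
  qed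
  have hm [measurable]: "(\<lambda>e. h (incs e i)) \<in> borel_measurable E" for i
    by measurable
  have hm' [measurable]: "(\<lambda>e. h' (incs e i)) \<in> borel_measurable E" for i
    by measurable
  have "(\<integral>\<^sup>+ e. gsum (Suc k) (\<lambda>i. ennreal (bsize e i powr \<theta>) * h (incs e i)) \<partial>E)
     = (\<integral>\<^sup>+ e. gsum k (\<lambda>i. \<Sum>c. ennreal (bsize e (c # i) powr \<theta>) * h (incs e (c # i))) \<partial>E)"
    unfolding gsum_Suc ..
  also have "\<dots> = gsum k (\<lambda>i. \<integral>\<^sup>+ e. (\<Sum>c. ennreal (bsize e (c # i) powr \<theta>) * h (incs e (c # i))) \<partial>E)"
    by (rule nn_integral_gsum) measurable
  also have "\<dots> = gsum k (\<lambda>i. \<integral>\<^sup>+ e. ennreal (bsize e i powr \<theta>) * (\<Sum>c. ennreal (mass (e i) c powr \<theta>) * h (fun_upd (incs e i) k (- ln (mass (e i) c)))) \<partial>E)"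
    by (intro gsum_cong nn_integral_cong) (simp add: powr_mult ennreal_mult mult.assoc)
  also have "\<dots> = gsum k (\<lambda>i. \<integral>\<^sup>+ e. Lfun \<nu> \<theta> * (ennreal (bsize e i powr \<theta>) * h' (incs e i)) \<partial>E)"
    by (intro gsum_cong step)
  also have "\<dots> = (\<integral>\<^sup>+ e. gsum k (\<lambda>i. Lfun \<nu> \<theta> * (ennreal (bsize e i powr \<theta>) * h' (incs e i))) \<partial>E)"
    by (rule nn_integral_gsum[symmetric]) measurable
  also have "\<dots> = Lfun \<nu> \<theta> * (\<integral>\<^sup>+ e. gsum k (\<lambda>i. ennreal (bsize e i powr \<theta>) * h' (incs e i)) \<partial>E)"
    unfolding gsum_cmult by (rule nn_integral_cmult) measurable
  also have "\<dots> = Lfun \<nu> \<theta> ^ Suc k * (\<integral>\<^sup>+ \<omega>. h \<omega> \<partial>RW \<theta>)"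
    by (simp add: Suc.IH[OF h'm h'd] RWeq mult.assoc)
  finally show ?case .
qed

end

section \<open>Random walks above a barrier\<close>

text \<open>Only the sign of the normal limit matters: its distribution function is continuous at 0
  with a value strictly between 0 and 1, so each of the two half-lines keeps positive mass in the
  limit.\<close>

lemma (in prob_space) central_limit_one_sided:
  fixes X :: "nat \<Rightarrow> 'a \<Rightarrow> real"
  assumes ind: "indep_vars (\<lambda>_. borel) X UNIV" and mean: "\<And>n. expectation (X n) = m"
    and sq: "\<And>n. integrable M (\<lambda>x. (X n x)\<^sup>2)" and \<sigma>: "\<sigma> > 0" and var: "\<And>n. variance (X n) = \<sigma>\<^sup>2"
    and dist: "\<And>n. distr M borel (X n) = \<mu>"
  shows "\<exists>c>0. eventually (\<lambda>n. prob {x \<in> space M. real n * m \<le> (\<Sum>i<n. X i x)} \<ge> c \<and>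
    prob {x \<in> space M. (\<Sum>i<n. X i x) \<le> real n * m} \<ge> c) sequentially"
proof -
  let ?N = "std_normal_distribution"
  interpret N: real_distribution ?N by (rule real_dist_normal_dist)
  have [measurable]: "X n \<in> borel_measurable M" for n
    using ind by (auto simp: indep_vars_def)
  let ?Z = "\<lambda>n x. (\<Sum>i<n. X i x - m) / sqrt (n * \<sigma>\<^sup>2)"
  have wc: "weak_conv_m (\<lambda>n. distr M borel (?Z n)) ?N"
    by (rule central_limit_theorem[OF ind mean \<sigma> sq var dist])
  \<comment> \<open>The normal density is positive everywhere, so a set that is not Lebesgue null is
    not null for the normal law.\<close>
  have pos: "N.prob A > 0" if "emeasure lborel A \<noteq> 0" "A \<in> sets borel" for A
  proof (rule ccontr)
    assume "\<not> N.prob A > 0"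
    then have "emeasure ?N A = 0"
      using measure_nonneg[of ?N A] by (simp add: N.emeasure_eq_measure)
    then have "(\<integral>\<^sup>+ x. ennreal (std_normal_density x) * indicator A x \<partial>lborel) = 0"
      using that(2) by (subst (asm) emeasure_density) auto
    then have "AE x in lborel. ennreal (std_normal_density x) * indicator A x = 0"
      using that(2) by (subst (asm) nn_integral_0_iff_AE) auto
    then have "AE x in lborel. x \<notin> A"
      by eventually_elim (auto simp: indicator_def less_imp_neq[OF normal_density_pos, symmetric] split: if_splits)
    then have "emeasure lborel A = 0"
      using that(2) by (subst (asm) AE_iff_measurable[of A]) auto
    then show False using that(1) by simp
  qed
  have "emeasure lborel {-1..0::real} \<le> emeasure lborel {..0::real}" by (intro emeasure_mono) auto
  then have c0: "cdf ?N 0 > 0"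
    unfolding cdf_def by (intro pos) auto
  have "emeasure lborel {0<..<1::real} \<le> emeasure lborel {0::real<..}" by (intro emeasure_mono) auto
  then have "N.prob {0::real<..} > 0"
    by (intro pos) auto
  moreover have "N.prob {0::real<..} = 1 - N.prob {..0}"
    using N.prob_compl[of "{..0}"] by (simp add: Compl_eq_Diff_UNIV[symmetric] not_le[symmetric] lessThan_def)
  ultimately have c1: "cdf ?N 0 < 1" by (simp add: cdf_def)
  have "emeasure ?N {0} = 0"
    by (subst emeasure_density) (auto intro!: nn_integral_null_set)
  then have "isCont (cdf ?N) 0"
    using N.isCont_cdf[of 0] by (simp add: measure_def)
  then have lim: "(\<lambda>n. cdf (distr M borel (?Z n)) 0) \<longlonglongrightarrow> cdf ?N 0"
    using wc by (auto simp: weak_conv_m_def weak_conv_def)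
  have Zle: "?Z n x \<le> 0 \<longleftrightarrow> (\<Sum>i<n. X i x) \<le> real n * m" if "n > 0" for n x
  proof -
    have "0 < real n * \<sigma>\<^sup>2" using \<sigma> that by simp
    then have "\<not> real n * \<sigma>\<^sup>2 \<le> 0" by linarith
    then show ?thesis by (simp add: divide_le_0_iff sum_subtractf)
  qed
  have cdf_eq: "cdf (distr M borel (?Z n)) 0 = prob {x \<in> space M. (\<Sum>i<n. X i x) \<le> real n * m}" if "n > 0" for n
  proof -
    have "cdf (distr M borel (?Z n)) 0 = prob (?Z n -` {..0} \<inter> space M)"
      unfolding cdf_def by (rule measure_distr) auto
    also have "?Z n -` {..0} \<inter> space M = {x \<in> space M. (\<Sum>i<n. X i x) \<le> real n * m}"
      using Zle[OF that] by auto
    finally show ?thesis .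
  qed
  have ge: "prob {x \<in> space M. real n * m \<le> (\<Sum>i<n. X i x)} \<ge> 1 - prob {x \<in> space M. (\<Sum>i<n. X i x) \<le> real n * m}" for n
  proof -
    have "1 - prob {x \<in> space M. (\<Sum>i<n. X i x) \<le> real n * m} = prob (space M - {x \<in> space M. (\<Sum>i<n. X i x) \<le> real n * m})"
      by (rule prob_compl[symmetric]) measurable
    also have "\<dots> \<le> prob {x \<in> space M. real n * m \<le> (\<Sum>i<n. X i x)}"
      by (intro finite_measure_mono) auto
    finally show ?thesis .
  qed
  \<comment> \<open>Halving leaves room on both sides, so the strict bounds hold for all large
    \<open>n\<close>.\<close>
  define c where "c = min (cdf ?N 0) (1 - cdf ?N 0) / 2"
  have c: "c > 0" "c < cdf ?N 0" "cdf ?N 0 < 1 - c" using c0 c1 by (auto simp: c_def min_def field_simps)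
  have "\<forall>\<^sub>F n in sequentially. c < cdf (distr M borel (?Z n)) 0"
    using lim c(2) by (rule order_tendstoD)
  moreover have "\<forall>\<^sub>F n in sequentially. cdf (distr M borel (?Z n)) 0 < 1 - c"
    using lim c(3) by (rule order_tendstoD)
  ultimately have "\<forall>\<^sub>F n in sequentially. prob {x \<in> space M. real n * m \<le> (\<Sum>i<n. X i x)} \<ge> c \<and>
    prob {x \<in> space M. (\<Sum>i<n. X i x) \<le> real n * m} \<ge> c"
    using eventually_gt_at_top[of 0]
  proof eventually_elim
    case (elim n)
    then show ?case using ge[of n] cdf_eq[of n] by simp
  qed
  then show ?thesis using c(1) by blast
qed

lemma sum_rotate:
  fixes x :: "nat \<Rightarrow> real"
  assumes "r < k" "m \<le> k"
  shows "(\<Sum>i<m. x ((i + r) mod k)) =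
    (if m + r \<le> k then (\<Sum>i<m + r. x i) - (\<Sum>i<r. x i)
     else (\<Sum>i<k. x i) - (\<Sum>i<r. x i) + (\<Sum>i<m + r - k. x i))"
  using assms(2)
proof (induction m)
  case 0
  then show ?case using assms by simp
next
  case (Suc m)
  consider "Suc m + r \<le> k" | "m + r = k" | "m + r > k" by linarith
  then show ?case
  proof cases
    case 1
    then have "(m + r) mod k = m + r" by simp
    then show ?thesis using Suc 1 by simp
  next
    case 2
    then show ?thesis using Suc by simp
  next
    case 3
    then have "(m + r) mod k = m + r - k" using Suc.prems assms(1) by (simp add: mod_if)
    moreover have "Suc m + r - k = Suc (m + r - k)" using 3 by simp
    ultimately show ?thesis using Suc 3 by simp
  qed
qed

text \<open>The rotation starts at the minimum of the partial sums.\<close>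

lemma ex_rotation_above:
  fixes x :: "nat \<Rightarrow> real"
  assumes k: "k > 0" and B: "B \<ge> 0" "(\<Sum>i<k. x i) \<ge> - B"
  shows "\<exists>r<k. \<forall>m\<le>k. (\<Sum>i<m. x ((i + r) mod k)) \<ge> - B"
proof -
  let ?S = "\<lambda>m. \<Sum>i<m. x i"
  obtain r where r: "r < k" "\<And>m. m < k \<Longrightarrow> ?S r \<le> ?S m"
    using ex_min_if_finite[of "?S ` {..<k}"] k by (auto simp: not_less lessThan_empty_iff)
  have r0: "?S r \<le> 0" using r(2)[of 0] k by simp
  have "(\<Sum>i<m. x ((i + r) mod k)) \<ge> - B" if m: "m \<le> k" for m
  proof -
    consider "m + r < k" | "m + r = k" | "m + r > k" by linarith
    then show ?thesis
    proof cases
      case 1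
      then show ?thesis using r(2)[of "m + r"] B m r(1) by (subst sum_rotate) auto
    next
      case 2
      then show ?thesis using r0 B m r(1) by (subst sum_rotate) auto
    next
      case 3
      then have "m + r - k < k" using m r(1) by simp
      then show ?thesis using r(2)[of "m + r - k"] B m r(1) 3 by (subst sum_rotate) auto
    qed
  qed
  then show ?thesis using r(1) by blast
qed

text \<open>Rotating the first \<open>k\<close> indices must be an injection of all of
  \<open>nat\<close> in order to preserve the product law; indices from \<open>k\<close> on are
  therefore left fixed.\<close>

lemma inj_rotation: "0 < k \<Longrightarrow> inj (\<lambda>m::nat. if m < k then (m + r) mod k else m)"
proof (rule injI)
  fix a b assume k: "0 < k" and eq: "(if a < k then (a + r) mod k else a) = (if b < k then (b + r) mod k else b)"
  have lt: "(n + r) mod k < k" for n using k by simp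
  consider "a < k" "b < k" | "a \<ge> k" "b \<ge> k" | "a < k" "b \<ge> k" | "a \<ge> k" "b < k" by linarith
  then show "a = b"
  proof cases
    case 1
    have inv: "((n + r) mod k + (k - r mod k)) mod k = n mod k" for n
    proof -
      have le: "r mod k \<le> k" using k by (simp add: less_imp_le)
      have "n + r + (k - r mod k) = n + (r div k * k + r mod k) + (k - r mod k)" by simp
      also have "\<dots> = n + r div k * k + k" using le by linarith
      finally have "n + r + (k - r mod k) = n + (r div k + 1) * k" by simp
      then have "((n + r) mod k + (k - r mod k)) mod k = (n + (r div k + 1) * k) mod k"
        using mod_add_left_eq[of "n + r" k "k - r mod k"] by presburger
      also have "\<dots> = n mod k" by (rule mod_mult_self1)
      finally show ?thesis .
    qed
    have e: "(a + r) mod k = (b + r) mod k" using eq 1 by simp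
    have "a mod k = ((b + r) mod k + (k - r mod k)) mod k"
      using inv[of a] unfolding e by (rule sym)
    also have "\<dots> = b mod k" by (rule inv)
    finally show ?thesis using 1 by (simp only: mod_less)
  qed (use eq lt[of a] lt[of b] in auto)
qed

text \<open>Only downward jumps need a bound: at the first \<open>r\<close> with
  \<open>T r \<le> 0\<close> the previous value, if there is one, is positive, so \<open>T r\<close>
  is at least \<open>- B\<close>.\<close>

lemma discrete_ivt:
  fixes T :: "nat \<Rightarrow> real"
  assumes "T 0 \<ge> 0" "T k \<le> 0" "\<And>r. r < k \<Longrightarrow> T r - T (Suc r) \<le> B" "B \<ge> 0"
  shows "\<exists>r\<le>k. \<bar>T r\<bar> \<le> B"
proof -
  define r where "r = (LEAST r. T r \<le> 0)"
  have r: "T r \<le> 0" "r \<le> k" unfolding r_def using assms(2) by (auto intro: LeastI Least_le)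
  have "\<bar>T r\<bar> \<le> B"
  proof (cases r)
    case 0
    then show ?thesis using assms r by simp
  next
    case (Suc q)
    then have "\<not> T q \<le> 0" unfolding r_def by (metis not_less_Least lessI)
    then show ?thesis using assms(3)[of q] r Suc by simp
  qed
  then show ?thesis using r by blast
qed

section \<open>Walks with i.i.d. steps\<close>

locale iid_walk = prob_space \<mu> for \<mu> :: "'a measure" +
  fixes f :: "'a \<Rightarrow> real"
  assumes f_measurable [measurable]: "f \<in> borel_measurable \<mu>"
begin

abbreviation \<Omega> :: "(nat \<Rightarrow> 'a) measure" where "\<Omega> \<equiv> PiM UNIV (\<lambda>_. \<mu>)"

sublocale W: product_prob_space "\<lambda>_ :: nat. \<mu>" UNIV by unfold_locales

definition walk :: "nat \<Rightarrow> (nat \<Rightarrow> 'a) \<Rightarrow> real" where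
  "walk k \<omega> = (\<Sum>m<k. f (\<omega> m))"

lemma measurable_walk [measurable]: "walk k \<in> borel_measurable \<Omega>"
  unfolding walk_def by measurable

text \<open>An injection of the indices preserves the product law. Rotations of the steps and
  mixtures of two blocks of steps are both of this kind.\<close>

lemma prob_inj:
  assumes "inj (g :: nat \<Rightarrow> nat)" and [measurable]: "Measurable.pred \<Omega> P"
  shows "W.prob {\<omega> \<in> space \<Omega>. P (\<lambda>m. \<omega> (g m))} = W.prob {\<omega> \<in> space \<Omega>. P \<omega>}"
proof -
  have m: "(\<lambda>\<omega> n. \<omega> (g n)) \<in> measurable \<Omega> \<Omega>" by (rule measurable_PiM_inj)
  have "W.prob {\<omega> \<in> space \<Omega>. P \<omega>} = measure (distr \<Omega> \<Omega> (\<lambda>\<omega> n. \<omega> (g n))) {\<omega> \<in> space \<Omega>. P \<omega>}"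
    by (simp add: distr_PiM_inj[OF assms(1)])
  also have "\<dots> = W.prob ((\<lambda>\<omega> n. \<omega> (g n)) -` {\<omega> \<in> space \<Omega>. P \<omega>} \<inter> space \<Omega>)"
    by (rule measure_distr[OF m]) measurable
  also have "(\<lambda>\<omega> n. \<omega> (g n)) -` {\<omega> \<in> space \<Omega>. P \<omega>} \<inter> space \<Omega> = {\<omega> \<in> space \<Omega>. P (\<lambda>m. \<omega> (g m))}"
    using measurable_space[OF m] by auto
  finally show ?thesis by simp
qed

text \<open>Cyclic rotations keep the endpoint and the law, and at least one of them satisfies the
  barrier; the union bound over the \<open>k\<close> rotations is the only loss. The bound
  \<open>D\<close> on the endpoint is carried along for the zero-drift case.\<close>

lemma prob_above_ge:
  assumes k: "k > 0" and B: "B \<ge> 0"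
  shows "W.prob {\<omega> \<in> space \<Omega>. - B \<le> walk k \<omega> \<and> walk k \<omega> \<le> D} \<le>
    real k * W.prob {\<omega> \<in> space \<Omega>. (\<forall>m\<le>k. - B \<le> walk m \<omega>) \<and> walk k \<omega> \<le> D}"
proof -
  define rot where "rot r m = (if m < k then (m + r) mod k else m)" for r m
  have walk_rot: "walk m (\<lambda>n. \<omega> (rot r n)) = (\<Sum>i<m. f (\<omega> ((i + r) mod k)))" if "m \<le> k" for r m \<omega>
    unfolding walk_def rot_def using that by (intro sum.cong) auto
  let ?Q = "\<lambda>\<omega>. (\<forall>m\<le>k. - B \<le> walk m \<omega>) \<and> walk k \<omega> \<le> D"
  have total: "walk k (\<lambda>n. \<omega> (rot r n)) = walk k \<omega>" if "r < k" for r \<omega>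
    unfolding walk_rot[OF order_refl] using that by (subst sum_rotate) (auto simp: walk_def)
  have Q [measurable]: "Measurable.pred \<Omega> ?Q" by measurable
  have "(\<lambda>\<omega> n. \<omega> (rot r n)) \<in> measurable \<Omega> \<Omega>" for r by (rule measurable_PiM_inj)
  from measurable_compose[OF this Q] have Qr: "Measurable.pred \<Omega> (\<lambda>\<omega>. ?Q (\<lambda>n. \<omega> (rot r n)))" for r .
  define Ev where "Ev r = {\<omega> \<in> space \<Omega>. ?Q (\<lambda>n. \<omega> (rot r n))}" for r
  have Ev [measurable]: "Ev r \<in> W.events" for r
    unfolding Ev_def using Qr[of r] by (rule predE)
  have "W.prob {\<omega> \<in> space \<Omega>. - B \<le> walk k \<omega> \<and> walk k \<omega> \<le> D} \<le> W.prob (\<Union>r\<in>{..<k}. Ev r)"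
  proof (rule W.finite_measure_mono)
    show "{\<omega> \<in> space \<Omega>. - B \<le> walk k \<omega> \<and> walk k \<omega> \<le> D} \<subseteq> (\<Union>r\<in>{..<k}. Ev r)"
    proof
      fix \<omega> assume w: "\<omega> \<in> {\<omega> \<in> space \<Omega>. - B \<le> walk k \<omega> \<and> walk k \<omega> \<le> D}"
      then obtain r where r: "r < k" "\<forall>m\<le>k. (\<Sum>i<m. f (\<omega> ((i + r) mod k))) \<ge> - B"
        using ex_rotation_above[OF k B, of "\<lambda>i. f (\<omega> i)"] by (auto simp: walk_def)
      have "\<forall>m\<le>k. - B \<le> walk m (\<lambda>n. \<omega> (rot r n))" using r(2) by (simp add: walk_rot)
      then have "\<omega> \<in> Ev r" using w total[OF r(1)] by (simp add: Ev_def)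
      then show "\<omega> \<in> (\<Union>r\<in>{..<k}. Ev r)" using r(1) by blast
    qed
  qed (rule sets.finite_UN, auto)
  also have "\<dots> \<le> (\<Sum>r<k. W.prob (Ev r))"
    by (rule W.finite_measure_subadditive_finite) auto
  also have "\<dots> = (\<Sum>r<k. W.prob {\<omega> \<in> space \<Omega>. ?Q \<omega>})"
  proof (rule sum.cong[OF refl])
    fix r assume "r \<in> {..<k}"
    have "inj (rot r)" unfolding rot_def by (rule inj_rotation[OF k])
    from prob_inj[OF this Q] show "W.prob (Ev r) = W.prob {\<omega> \<in> space \<Omega>. ?Q \<omega>}"
      unfolding Ev_def .
  qed
  finally show ?thesis by simp
qed

text \<open>Replacing the steps of a walk that ends above 0 one at a time by those of an independent
  walk that ends below 0 must produce a walk that ends close to 0, and all of these have the same law.\<close>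

lemma prob_near_zero_ge:
  assumes a: "\<And>x. x \<in> space \<mu> \<Longrightarrow> f x \<ge> - a" and B: "B \<ge> 0"
    and c: "W.prob {\<omega> \<in> space \<Omega>. 0 \<le> walk k \<omega>} \<ge> c" "W.prob {\<omega> \<in> space \<Omega>. walk k \<omega> \<le> 0} \<ge> c" "c \<ge> 0"
    and t: "prob {x \<in> space \<mu>. f x > B - a} \<le> t"
  shows "c\<^sup>2 - real k * t \<le> real (Suc k) * W.prob {\<omega> \<in> space \<Omega>. \<bar>walk k \<omega>\<bar> \<le> B}"
proof -
  \<comment> \<open>Steps \<open>m < r\<close> come from the second block of \<open>k\<close>
    indices, the remaining ones from the first. Indices from \<open>k\<close> on are moved past both
    blocks, which keeps the map injective.\<close>
  define g where "g r m = (if m < r then k + m else if m < k then m else k + m)" for r m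
  define T where "T r \<omega> = walk k (\<lambda>m. \<omega> (g r m))" for r \<omega>
  have g_inj: "inj (g r)" if "r \<le> k" for r
    using that by (intro injI) (auto simp: g_def split: if_splits)
  have Tm [measurable]: "T r \<in> borel_measurable \<Omega>" for r
    unfolding T_def walk_def by measurable
  have pT: "W.prob {\<omega> \<in> space \<Omega>. P (T r \<omega>)} = W.prob {\<omega> \<in> space \<Omega>. P (walk k \<omega>)}"
    if "r \<le> k" "Measurable.pred borel P" for r P
    unfolding T_def using measurable_compose[OF measurable_walk that(2)] by (intro prob_inj[OF g_inj[OF that(1)]])
  have T0: "T 0 \<omega> = (\<Sum>m<k. f (\<omega> m))" and Tk: "T k \<omega> = (\<Sum>m<k. f (\<omega> (k + m)))" for \<omega>
    by (simp_all add: T_def walk_def g_def)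
  have Tstep: "T r \<omega> - T (Suc r) \<omega> = f (\<omega> r) - f (\<omega> (k + r))" if "r < k" for r \<omega>
  proof -
    have "T r \<omega> - T (Suc r) \<omega> = (\<Sum>m<k. f (\<omega> (g r m)) - f (\<omega> (g (Suc r) m)))"
      by (simp add: T_def walk_def sum_subtractf)
    also have "\<dots> = (\<Sum>m<k. if m = r then f (\<omega> r) - f (\<omega> (k + r)) else 0)"
      by (intro sum.cong) (auto simp: g_def less_Suc_eq)
    finally show ?thesis using that by simp
  qed
  let ?A = "{\<omega> \<in> space \<Omega>. 0 \<le> T 0 \<omega>} \<inter> {\<omega> \<in> space \<Omega>. T k \<omega> \<le> 0}"
  let ?J = "\<lambda>m. {\<omega> \<in> space \<Omega>. f (\<omega> m) > B - a}"
  have [measurable]: "?J m \<in> W.events" for m by measurable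
  \<comment> \<open>\<open>T 0\<close> reads the first block of indices only and \<open>T k\<close>
    the second, so the two sign events are independent.\<close>
  have pA: "W.prob ?A = W.prob {\<omega> \<in> space \<Omega>. 0 \<le> T 0 \<omega>} * W.prob {\<omega> \<in> space \<Omega>. T k \<omega> \<le> 0}"
  proof -
    have "(\<integral>\<^sup>+ \<omega>. (if 0 \<le> T 0 \<omega> then 1 else 0) * (if T k \<omega> \<le> 0 then 1 else 0) \<partial>\<Omega>)
      = (\<integral>\<^sup>+ \<omega>. (if 0 \<le> T 0 \<omega> then 1 else 0) \<partial>\<Omega>) * (\<integral>\<^sup>+ \<omega>. (if T k \<omega> \<le> 0 then 1 else 0) \<partial>\<Omega>)"
    proof (rule nn_integral_PiM_mult[where K="{..<k}" and J="{k..}"])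
      show "depends_on {..<k} (\<lambda>\<omega>. if 0 \<le> T 0 \<omega> then 1 else 0 :: ennreal)"
        by (intro depends_onI) (simp add: T0)
      show "depends_on {k..} (\<lambda>\<omega>. if T k \<omega> \<le> 0 then 1 else 0 :: ennreal)"
        by (intro depends_onI) (simp add: Tk)
    qed auto
    also have "(\<integral>\<^sup>+ \<omega>. (if 0 \<le> T 0 \<omega> then 1 else 0) \<partial>\<Omega>) = (\<integral>\<^sup>+ \<omega>. indicator {\<omega> \<in> space \<Omega>. 0 \<le> T 0 \<omega>} \<omega> \<partial>\<Omega>)"
      by (intro nn_integral_cong) auto
    also have "\<dots> = emeasure \<Omega> {\<omega> \<in> space \<Omega>. 0 \<le> T 0 \<omega>}" by (rule nn_integral_indicator) measurable
    also have "(\<integral>\<^sup>+ \<omega>. (if T k \<omega> \<le> 0 then 1 else 0) \<partial>\<Omega>) = (\<integral>\<^sup>+ \<omega>. indicator {\<omega> \<in> space \<Omega>. T k \<omega> \<le> 0} \<omega> \<partial>\<Omega>)"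
      by (intro nn_integral_cong) auto
    also have "\<dots> = emeasure \<Omega> {\<omega> \<in> space \<Omega>. T k \<omega> \<le> 0}" by (rule nn_integral_indicator) measurable
    also have "(\<integral>\<^sup>+ \<omega>. (if 0 \<le> T 0 \<omega> then 1 else 0) * (if T k \<omega> \<le> 0 then 1 else 0) \<partial>\<Omega>) = (\<integral>\<^sup>+ \<omega>. indicator ?A \<omega> \<partial>\<Omega>)"
      by (intro nn_integral_cong) auto
    also have "\<dots> = emeasure \<Omega> ?A" by (rule nn_integral_indicator) measurable
    finally show ?thesis by (simp add: W.emeasure_eq_measure flip: ennreal_mult)
  qed
  have "W.prob {\<omega> \<in> space \<Omega>. 0 \<le> T 0 \<omega>} \<ge> c" "W.prob {\<omega> \<in> space \<Omega>. T k \<omega> \<le> 0} \<ge> c"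
    using c pT[of 0 "\<lambda>x. 0 \<le> x"] pT[of k "\<lambda>x. x \<le> 0"] by auto
  then have cA: "c\<^sup>2 \<le> W.prob ?A"
    unfolding pA power2_eq_square using c(3) by (intro mult_mono) auto
  have pJ: "W.prob (?J m) \<le> t" for m
  proof -
    have "W.prob (?J m) = measure (distr \<Omega> \<mu> (\<lambda>\<omega>. \<omega> m)) {x \<in> space \<mu>. f x > B - a}"
      by (subst measure_distr) (auto intro!: arg_cong[where f=W.prob] simp: space_PiM PiE_iff)
    then show ?thesis using t by (simp add: W.PiM_component)
  qed
  \<comment> \<open>A step of the second block is at least \<open>- a\<close>, so \<open>T\<close>
    drops by more than \<open>B\<close> only if a step of the first block exceeds
    \<open>B - a\<close>; the \<open>k\<close> possible exceptions cost
    \<open>k * t\<close>.\<close>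
  have sub: "?A \<subseteq> (\<Union>r\<in>{..k}. {\<omega> \<in> space \<Omega>. \<bar>T r \<omega>\<bar> \<le> B}) \<union> (\<Union>m\<in>{..<k}. ?J m)"
  proof
    fix \<omega> assume \<omega>: "\<omega> \<in> ?A"
    show "\<omega> \<in> (\<Union>r\<in>{..k}. {\<omega> \<in> space \<Omega>. \<bar>T r \<omega>\<bar> \<le> B}) \<union> (\<Union>m\<in>{..<k}. ?J m)"
    proof (cases "\<exists>m<k. f (\<omega> m) > B - a")
      case True
      then show ?thesis using \<omega> by auto
    next
      case False
      have "T r \<omega> - T (Suc r) \<omega> \<le> B" if "r < k" for r
      proof -
        have "\<omega> (k + r) \<in> space \<mu>" using \<omega> by (auto simp: space_PiM)
        then show ?thesis using a[of "\<omega> (k + r)"] False that Tstep[OF that, of \<omega>] by fastforce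
      qed
      then have "\<exists>r\<le>k. \<bar>T r \<omega>\<bar> \<le> B" using \<omega> B by (intro discrete_ivt) auto
      then show ?thesis using \<omega> by auto
    qed
  qed
  have "W.prob ?A \<le> W.prob ((\<Union>r\<in>{..k}. {\<omega> \<in> space \<Omega>. \<bar>T r \<omega>\<bar> \<le> B}) \<union> (\<Union>m\<in>{..<k}. ?J m))"
    by (rule W.finite_measure_mono[OF sub]) measurable
  also have "\<dots> \<le> W.prob (\<Union>r\<in>{..k}. {\<omega> \<in> space \<Omega>. \<bar>T r \<omega>\<bar> \<le> B}) + W.prob (\<Union>m\<in>{..<k}. ?J m)"
    by (rule measure_Un_le) measurable
  also have "W.prob (\<Union>r\<in>{..k}. {\<omega> \<in> space \<Omega>. \<bar>T r \<omega>\<bar> \<le> B}) \<le> (\<Sum>r\<le>k. W.prob {\<omega> \<in> space \<Omega>. \<bar>T r \<omega>\<bar> \<le> B})"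
    by (rule W.finite_measure_subadditive_finite) auto
  also have "\<dots> = (\<Sum>r\<le>k. W.prob {\<omega> \<in> space \<Omega>. \<bar>walk k \<omega>\<bar> \<le> B})"
    by (intro sum.cong refl pT) auto
  also have "W.prob (\<Union>m\<in>{..<k}. ?J m) \<le> (\<Sum>m<k. W.prob (?J m))"
    by (rule W.finite_measure_subadditive_finite) auto
  also have "\<dots> \<le> (\<Sum>m<k. t)" by (intro sum_mono pJ)
  finally show ?thesis using cA by simp
qed

lemma walk_one_sided:
  assumes sq: "integrable \<mu> (\<lambda>x. (f x)\<^sup>2)" and m: "expectation f = m" and var: "variance f > 0"
  shows "\<exists>c>0. eventually (\<lambda>n. W.prob {\<omega> \<in> space \<Omega>. real n * m \<le> walk n \<omega>} \<ge> c \<and>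
    W.prob {\<omega> \<in> space \<Omega>. walk n \<omega> \<le> real n * m} \<ge> c) sequentially"
  unfolding walk_def
proof (rule W.central_limit_one_sided[where \<mu>="distr \<mu> borel f" and \<sigma>="sqrt (variance f)"])
  show "W.indep_vars (\<lambda>_. borel) (\<lambda>i \<omega>. f (\<omega> i)) UNIV"
    by (rule W.indep_vars_compose2[OF indep_vars_coordinates]) auto
  have comp: "distr \<Omega> \<mu> (\<lambda>\<omega>. \<omega> n) = \<mu>" for n by (rule W.PiM_component) simp
  show "W.expectation (\<lambda>\<omega>. f (\<omega> n)) = m" for n
  proof -
    have "W.expectation (\<lambda>\<omega>. f (\<omega> n)) = integral\<^sup>L (distr \<Omega> \<mu> (\<lambda>\<omega>. \<omega> n)) f"
      by (rule integral_distr[symmetric]) measurable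
    then show ?thesis by (simp add: comp m)
  qed
  note mean = this
  show "integrable \<Omega> (\<lambda>\<omega>. (f (\<omega> n))\<^sup>2)" for n
  proof -
    have "integrable (distr \<Omega> \<mu> (\<lambda>\<omega>. \<omega> n)) (\<lambda>x. (f x)\<^sup>2)" by (simp add: comp sq)
    then show ?thesis by (subst (asm) integrable_distr_eq) auto
  qed
  show "sqrt (variance f) > 0" using var by simp
  show "W.variance (\<lambda>\<omega>. f (\<omega> n)) = (sqrt (variance f))\<^sup>2" for n
  proof -
    have "W.variance (\<lambda>\<omega>. f (\<omega> n)) = integral\<^sup>L (distr \<Omega> \<mu> (\<lambda>\<omega>. \<omega> n)) (\<lambda>x. (f x - m)\<^sup>2)"
      unfolding mean by (rule integral_distr[symmetric]) measurable
    then show ?thesis using var by (simp add: comp m)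
  qed
  show "distr \<Omega> borel (\<lambda>\<omega>. f (\<omega> n)) = distr \<mu> borel f" for n
  proof -
    have "distr \<Omega> borel (\<lambda>\<omega>. f (\<omega> n)) = distr (distr \<Omega> \<mu> (\<lambda>\<omega>. \<omega> n)) borel f"
      by (subst distr_distr) (auto simp: comp_def)
    then show ?thesis by (simp add: comp)
  qed
qed

text \<open>At time \<open>k\<close> the walk is at least its mean, hence nonnegative, with
  probability bounded below. Rotation divides this by \<open>k\<close>; the second factor
  \<open>k\<close> absorbs the constant.\<close>

lemma prob_barrier_nonneg_drift:
  assumes "integrable \<mu> (\<lambda>x. (f x)\<^sup>2)" "expectation f \<ge> 0" "variance f > 0"
  shows "eventually (\<lambda>k. W.prob {\<omega> \<in> space \<Omega>. \<forall>m\<le>k. 0 \<le> walk m \<omega>} \<ge> 1 / real k ^ 2) sequentially"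
proof -
  obtain c where c: "c > 0" "eventually (\<lambda>n. W.prob {\<omega> \<in> space \<Omega>. real n * expectation f \<le> walk n \<omega>} \<ge> c) sequentially"
    using walk_one_sided[OF assms(1) refl assms(3)] unfolding eventually_conj_iff by blast
  obtain k0 :: nat where k0: "1 / c < real k0" using reals_Archimedean2 by blast
  show ?thesis using c(2) eventually_ge_at_top[of "Suc k0"]
  proof eventually_elim
    case (elim k)
    have k: "k > 0" "1 / c < real k" using elim k0 by auto
    have nn: "0 \<le> real k * expectation f" using assms(2) by simp
    let ?D = "\<lambda>n::nat. {\<omega> \<in> space \<Omega>. - 0 \<le> walk k \<omega> \<and> walk k \<omega> \<le> real n}"
    let ?R = "{\<omega> \<in> space \<Omega>. \<forall>m\<le>k. 0 \<le> walk m \<omega>}"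
    have "c \<le> W.prob {\<omega> \<in> space \<Omega>. real k * expectation f \<le> walk k \<omega>}" using elim by simp
    also have "\<dots> \<le> W.prob {\<omega> \<in> space \<Omega>. 0 \<le> walk k \<omega>}"
      using nn by (intro W.finite_measure_mono) auto
    also have "\<dots> \<le> real k * W.prob ?R"
    proof (rule LIMSEQ_le_const2)
      \<comment> \<open>The rotation bound wants a cap on the endpoint; it is removed by a monotone
        limit.\<close>
      have "(\<lambda>n. W.prob (?D n)) \<longlonglongrightarrow> W.prob (\<Union>n. ?D n)"
        by (rule W.finite_Lim_measure_incseq) (auto simp: incseq_def)
      moreover have "(\<Union>n. ?D n) = {\<omega> \<in> space \<Omega>. 0 \<le> walk k \<omega>}"
        using real_arch_simple by auto
      ultimately show "(\<lambda>n. W.prob (?D n)) \<longlonglongrightarrow> W.prob {\<omega> \<in> space \<Omega>. 0 \<le> walk k \<omega>}" by simp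
      have "W.prob (?D n) \<le> real k * W.prob ?R" for n
      proof -
        have "W.prob (?D n) \<le> real k * W.prob {\<omega> \<in> space \<Omega>. (\<forall>m\<le>k. - 0 \<le> walk m \<omega>) \<and> walk k \<omega> \<le> real n}"
          by (rule prob_above_ge[OF k(1)]) simp
        also have "\<dots> \<le> real k * W.prob ?R"
          by (intro mult_left_mono W.finite_measure_mono) auto
        finally show ?thesis .
      qed
      then show "\<exists>N. \<forall>n\<ge>N. W.prob (?D n) \<le> real k * W.prob ?R" by blast
    qed
    finally have *: "c \<le> real k * W.prob ?R" .
    have "1 \<le> c * real k" using k(2) c(1) by (simp add: field_simps)
    also have "\<dots> \<le> (real k * W.prob ?R) * real k" using * by (intro mult_right_mono) auto
    finally show ?case using k(1) by (simp add: field_simps power2_eq_square)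
  qed
qed

text \<open>The probability of ending within \<open>B\<close> of 0 is at least of order
  \<open>1 / k\<close>, rotation costs another \<open>k\<close>, and a third factor absorbs the
  constants. The exponential tail makes a large step unlikely once \<open>B\<close> is a suitable
  multiple of \<open>ln k\<close>.\<close>

lemma prob_barrier_zero_drift:
  assumes "integrable \<mu> (\<lambda>x. (f x)\<^sup>2)" "expectation f = 0" "variance f > 0"
    and a: "\<And>x. x \<in> space \<mu> \<Longrightarrow> f x \<ge> - a"
    and tail: "\<And>b. prob {x \<in> space \<mu>. f x > b} \<le> C * exp (- \<epsilon> * b)" and \<epsilon>: "\<epsilon> > 0"
  shows "\<exists>K>0. eventually (\<lambda>k. W.prob {\<omega> \<in> space \<Omega>. (\<forall>m\<le>k. - (K * ln (real k)) \<le> walk m \<omega>) \<and> walk k \<omega> \<le> K * ln (real k)}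
     \<ge> 1 / real k ^ 3) sequentially"
proof -
  obtain c where c: "c > 0" and ev: "eventually (\<lambda>n. W.prob {\<omega> \<in> space \<Omega>. 0 \<le> walk n \<omega>} \<ge> c \<and>
    W.prob {\<omega> \<in> space \<Omega>. walk n \<omega> \<le> 0} \<ge> c) sequentially"
    using walk_one_sided[OF assms(1) assms(2) assms(3)] by auto
  \<comment> \<open>With \<open>B = K * ln k\<close> the tail bound at \<open>B - a\<close> is a
    constant times \<open>1 / k ^ 2\<close>, so all \<open>k\<close> steps together contribute only
    a constant over \<open>k\<close>.\<close>
  define K where "K = 2 / \<epsilon>"
  have K: "K > 0" using \<epsilon> by (simp add: K_def)
  define C' where "C' = \<bar>C\<bar> * exp (\<epsilon> * a)"
  have C': "C' \<ge> 0" by (simp add: C'_def)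
  \<comment> \<open>For \<open>k\<close> beyond \<open>k0\<close> the quantity
    \<open>c\<^sup>2 * k - C'\<close> exceeds 2; the 2 pays for replacing \<open>Suc k\<close> by
    \<open>2 * k\<close>.\<close>
  obtain k0 :: nat where k0: "(C' + 2) / c\<^sup>2 < real k0" using reals_Archimedean2 by blast
  have "eventually (\<lambda>k. W.prob {\<omega> \<in> space \<Omega>. (\<forall>m\<le>k. - (K * ln (real k)) \<le> walk m \<omega>) \<and> walk k \<omega> \<le> K * ln (real k)}
     \<ge> 1 / real k ^ 3) sequentially"
    using ev eventually_ge_at_top[of "Suc k0"]
  proof eventually_elim
    case (elim k)
    define B where "B = K * ln (real k)"
    define q where "q = W.prob {\<omega> \<in> space \<Omega>. (\<forall>m\<le>k. - B \<le> walk m \<omega>) \<and> walk k \<omega> \<le> B}"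
    have k: "k > 0" "(C' + 2) / c\<^sup>2 < real k" "real k \<ge> 1" using elim k0 by auto
    have B: "B \<ge> 0" using K k by (simp add: B_def)
    have eB: "exp (- \<epsilon> * (B - a)) = exp (\<epsilon> * a) / real k ^ 2"
    proof -
      have "exp (- \<epsilon> * (B - a)) = exp (\<epsilon> * a) * exp (- (2 * ln (real k)))"
        unfolding exp_add[symmetric] using \<epsilon> by (simp add: B_def K_def algebra_simps)
      also have "exp (- (2 * ln (real k))) = 1 / real k ^ 2"
        using k by (simp add: exp_minus exp_double inverse_eq_divide)
      finally show ?thesis by simp
    qed
    have "prob {x \<in> space \<mu>. f x > B - a} \<le> C * exp (- \<epsilon> * (B - a))" by (rule tail)
    also have "\<dots> \<le> \<bar>C\<bar> * exp (- \<epsilon> * (B - a))" by (intro mult_right_mono) auto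
    also have "\<dots> = C' / real k ^ 2" unfolding eB C'_def by simp
    finally have t: "prob {x \<in> space \<mu>. f x > B - a} \<le> C' / real k ^ 2" .
    have "c\<^sup>2 - real k * (C' / real k ^ 2) \<le> real (Suc k) * W.prob {\<omega> \<in> space \<Omega>. \<bar>walk k \<omega>\<bar> \<le> B}"
      using elim c by (intro prob_near_zero_ge[OF a B _ _ _ t]) auto
    also have "{\<omega> \<in> space \<Omega>. \<bar>walk k \<omega>\<bar> \<le> B} = {\<omega> \<in> space \<Omega>. - B \<le> walk k \<omega> \<and> walk k \<omega> \<le> B}"
      by auto
    also have "real (Suc k) * W.prob \<dots> \<le> real (Suc k) * (real k * q)"
      unfolding q_def by (intro mult_left_mono prob_above_ge k B) auto
    finally have 1: "c\<^sup>2 - C' / real k \<le> real (Suc k) * real k * q"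
      using k by (simp add: power2_eq_square field_simps)
    have q: "q \<ge> 0" by (simp add: q_def)
    have "C' + 2 < c\<^sup>2 * real k" using k(2) c by (simp add: field_simps)
    moreover have "(c\<^sup>2 - C' / real k) * real k = c\<^sup>2 * real k - C'"
      using k by (simp add: left_diff_distrib)
    ultimately have "2 \<le> (c\<^sup>2 - C' / real k) * real k" by simp
    also have "\<dots> \<le> (real (Suc k) * real k * q) * real k"
      using 1 by (intro mult_right_mono) auto
    also have "\<dots> \<le> ((2 * real k) * real k * q) * real k"
      using k q by (intro mult_right_mono) auto
    finally have "1 \<le> q * real k ^ 3" by (simp add: power3_eq_cube field_simps)
    then have "1 / real k ^ 3 \<le> q" using k by (simp add: field_simps)
    then show ?case by (simp add: q_def B_def)
  qed
  then show ?thesis using K by blast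
qed

end

section \<open>The Laplace transform of the size-biased law\<close>

text \<open>Dominated convergence along a real parameter, reduced to sequences. The bound is
  required only off the limit point, where difference quotients make sense.\<close>

lemma tendsto_integral_dominated_at:
  fixes F :: "real \<Rightarrow> 'a \<Rightarrow> real"
  assumes S: "open S" "s \<in> S"
    and meas: "f \<in> borel_measurable M" "\<And>t. t \<in> S \<Longrightarrow> F t \<in> borel_measurable M" and w: "integrable M w"
    and bound: "\<And>t. t \<in> S - {s} \<Longrightarrow> AE y in M. \<bar>F t y\<bar> \<le> w y"
    and lim: "AE y in M. ((\<lambda>t. F t y) \<longlongrightarrow> f y) (at s)"
  shows "((\<lambda>t. integral\<^sup>L M (F t)) \<longlongrightarrow> integral\<^sup>L M f) (at s)"
proof -
  have "((\<lambda>t. integral\<^sup>L M (F t)) \<longlongrightarrow> integral\<^sup>L M f) (at s within S)"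
    unfolding tendsto_at_iff_sequentially
  proof (intro allI impI)
    fix X :: "nat \<Rightarrow> real" assume X: "\<forall>i. X i \<in> S - {s}" "X \<longlonglongrightarrow> s"
    show "((\<lambda>t. integral\<^sup>L M (F t)) \<circ> X) \<longlonglongrightarrow> integral\<^sup>L M f"
      unfolding comp_def
    proof (rule integral_dominated_convergence[where w=w])
      show "AE y in M. (\<lambda>i. F (X i) y) \<longlonglongrightarrow> f y"
        using lim
      proof eventually_elim
        case (elim y)
        have "filterlim X (at s) sequentially"
          unfolding filterlim_at using X by auto
        then show ?case by (rule filterlim_compose[OF elim])
      qed
      fix i
      have Xi: "X i \<in> S - {s}" using X(1) by (rule spec)
      from Xi have "X i \<in> S" by simp
      then show "F (X i) \<in> borel_measurable M" by (rule meas(2))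
      show "AE y in M. norm (F (X i) y) \<le> w y" unfolding real_norm_def by (rule bound[OF Xi])
    qed (rule meas(1), rule w)
  qed
  then show ?thesis unfolding at_within_open[OF S(2,1)] .
qed

locale laplace = prob_space m for m :: "real measure" +
  assumes sets_m [measurable_cong]: "sets m = sets borel" and nonneg: "AE y in m. 0 \<le> y"
begin

text \<open>\<open>G\<close> is the Laplace transform and \<open>G1\<close> is minus its derivative
  on the positive axis; \<open>G1 s / G s\<close> is the mean of the law tilted by
  \<open>exp (- s * y)\<close>.\<close>

definition G :: "real \<Rightarrow> real" where "G s = (\<integral>y. exp (- s * y) \<partial>m)"
definition G1 :: "real \<Rightarrow> real" where "G1 s = (\<integral>y. y * exp (- s * y) \<partial>m)"

text \<open>Both follow from \<open>x \<le> exp x\<close>, at \<open>u * y\<close> and at half of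
  it. They make the first and second moments of the tilted laws finite for every
  \<open>s > 0\<close>.\<close>

lemma exp_bounds:
  fixes y u :: real
  assumes "0 \<le> y" "u > 0"
  shows "y * exp (- u * y) \<le> 1 / u" "y\<^sup>2 * exp (- u * y) \<le> 4 / u\<^sup>2"
proof -
  have "u * y \<le> exp (u * y)" using exp_ge_add_one_self[of "u * y"] by linarith
  then show "y * exp (- u * y) \<le> 1 / u"
    using assms by (simp add: exp_minus field_simps)
  have "u * y / 2 \<le> exp (u * y / 2)" using exp_ge_add_one_self[of "u * y / 2"] by linarith
  then have "(u * y / 2)\<^sup>2 \<le> (exp (u * y / 2))\<^sup>2"
    by (rule power_mono) (use assms in simp)
  also have "\<dots> = exp (u * y)" by (simp add: power2_eq_square exp_add[symmetric])
  finally show "y\<^sup>2 * exp (- u * y) \<le> 4 / u\<^sup>2"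
    using assms by (simp add: exp_minus field_simps power2_eq_square)
qed

lemma integrable_bounded:
  fixes g :: "real \<Rightarrow> real" and C :: real
  shows "g \<in> borel_measurable borel \<Longrightarrow> (\<And>y. 0 \<le> y \<Longrightarrow> \<bar>g y\<bar> \<le> C) \<Longrightarrow> integrable m g"
  by (rule integrable_const_bound[where B=C]) (use nonneg in auto)

lemma integrable_exp: "s \<ge> 0 \<Longrightarrow> integrable m (\<lambda>y. exp (- s * y))"
  by (rule integrable_bounded[where C=1]) auto

lemma integrable_y_exp: "s > 0 \<Longrightarrow> integrable m (\<lambda>y. y * exp (- s * y))"
  by (rule integrable_bounded[where C="1 / s"]) (use exp_bounds in \<open>auto simp: abs_mult\<close>)

lemma integrable_y2_exp: "s > 0 \<Longrightarrow> integrable m (\<lambda>y. y\<^sup>2 * exp (- s * y))"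
  by (rule integrable_bounded[where C="4 / s\<^sup>2"]) (use exp_bounds in \<open>auto simp: abs_mult\<close>)

lemma G_pos: "s \<ge> 0 \<Longrightarrow> G s > 0"
proof -
  assume s: "s \<ge> 0"
  have "0 \<le> G s" unfolding G_def by (rule Bochner_Integration.integral_nonneg) auto
  moreover have "G s \<noteq> 0"
  proof
    assume "G s = 0"
    then have "AE y in m. exp (- s * y) = 0"
      unfolding G_def by (subst (asm) integral_nonneg_eq_0_iff_AE[OF integrable_exp[OF s]]) auto
    then have "AE y in m. False" by eventually_elim auto
    then show False by simp
  qed
  ultimately show ?thesis by simp
qed

lemma G_le_1: "s \<ge> 0 \<Longrightarrow> G s \<le> 1"
proof -
  assume s: "s \<ge> 0"
  have "G s \<le> (\<integral>y. 1 \<partial>m)"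
    unfolding G_def by (rule integral_mono_AE) (use integrable_exp[OF s] nonneg s in auto)
  then show ?thesis by (simp add: prob_space)
qed

text \<open>A mean value bound for the exponential, with the smaller exponent \<open>u\<close> kept
  so that a single function dominates all difference quotients.\<close>

lemma abs_exp_diff_le:
  fixes s t y u :: real
  assumes "0 \<le> y" "u \<le> s" "u \<le> t"
  shows "\<bar>exp (- t * y) - exp (- s * y)\<bar> \<le> \<bar>t - s\<bar> * (y * exp (- u * y))"
proof -
  have *: "exp (- a * y) - exp (- b * y) \<le> \<bar>a - b\<bar> * (y * exp (- u * y))" if "u \<le> a" for a b
  proof -
    have "exp (- a * y) - exp (- b * y) = exp (- a * y) * (1 - exp ((a - b) * y))"
      by (simp add: algebra_simps exp_add[symmetric])
    also have "\<dots> \<le> exp (- a * y) * (\<bar>a - b\<bar> * y)"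
    proof (rule mult_left_mono)
      have "1 - exp ((a - b) * y) \<le> - ((a - b) * y)" using exp_ge_add_one_self[of "(a - b) * y"] by linarith
      also have "\<dots> \<le> \<bar>(a - b) * y\<bar>" by linarith
      finally show "1 - exp ((a - b) * y) \<le> \<bar>a - b\<bar> * y" using assms by (simp add: abs_mult)
    qed simp
    also have "\<dots> \<le> exp (- u * y) * (\<bar>a - b\<bar> * y)"
      using assms that by (intro mult_right_mono) (auto intro: mult_right_mono)
    finally show ?thesis by (simp add: mult_ac)
  qed
  from *[OF assms(3), of s] *[OF assms(2), of t] show ?thesis by (simp add: abs_le_iff abs_minus_commute)
qed

lemma has_derivative_G:
  assumes s: "s > 0"
  shows "(G has_real_derivative - G1 s) (at s)"
  unfolding has_field_derivative_iff
proof -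
  have "((\<lambda>t. \<integral>y. (exp (- t * y) - exp (- s * y)) / (t - s) \<partial>m) \<longlongrightarrow> (\<integral>y. - (y * exp (- s * y)) \<partial>m)) (at s)"
  \<comment> \<open>Restricting to \<open>t > s / 2\<close> keeps a fixed exponential in the
    dominating function.\<close>
  proof (rule tendsto_integral_dominated_at[where S="{s / 2<..}" and w="\<lambda>y. y * exp (- (s / 2) * y)"])
    show "integrable m (\<lambda>y. y * exp (- (s / 2) * y))" using s by (intro integrable_y_exp) auto
    fix t assume t: "t \<in> {s / 2<..} - {s}"
    show "AE y in m. \<bar>(exp (- t * y) - exp (- s * y)) / (t - s)\<bar> \<le> y * exp (- (s / 2) * y)"
      using nonneg
    proof eventually_elim
      case (elim y)
      have "\<bar>exp (- t * y) - exp (- s * y)\<bar> \<le> \<bar>t - s\<bar> * (y * exp (- (s / 2) * y))"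
        by (rule abs_exp_diff_le) (use elim t s in auto)
      then show ?case using t by (simp add: field_simps)
    qed
  next
    show "AE y in m. ((\<lambda>t. (exp (- t * y) - exp (- s * y)) / (t - s)) \<longlongrightarrow> - (y * exp (- s * y))) (at s)"
    proof (rule AE_I2)
      fix y
      have "((\<lambda>t. exp (- t * y)) has_real_derivative - (y * exp (- s * y))) (at s)"
        by (auto intro!: derivative_eq_intros)
      then show "((\<lambda>t. (exp (- t * y) - exp (- s * y)) / (t - s)) \<longlongrightarrow> - (y * exp (- s * y))) (at s)"
        by (simp add: has_field_derivative_iff)
    qed
  qed (use s in auto)
  moreover have "\<forall>\<^sub>F t in at s. (\<integral>y. (exp (- t * y) - exp (- s * y)) / (t - s) \<partial>m) = (G t - G s) / (t - s)"
  proof -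
    have "\<forall>\<^sub>F t in at s. t \<in> {0<..}" using s by (intro eventually_at_in_open') auto
    then show ?thesis
    proof eventually_elim
      case (elim t)
      have "(\<integral>y. exp (- t * y) - exp (- s * y) \<partial>m) = G t - G s"
        unfolding G_def by (rule Bochner_Integration.integral_diff) (use elim s in \<open>auto intro!: integrable_exp[simplified]\<close>)
      then show ?case by (subst integral_divide_zero) (rule arg_cong[where f="\<lambda>x. x / (t - s)"])
    qed
  qed
  ultimately show "((\<lambda>t. (G t - G s) / (t - s)) \<longlongrightarrow> - G1 s) (at s)"
    unfolding G1_def by (subst (asm) tendsto_cong) auto
qed

lemma isCont_G1: "s > 0 \<Longrightarrow> isCont G1 s"
  unfolding isCont_def G1_def
proof (rule tendsto_integral_dominated_at[where S="{s / 2<..}" and w="\<lambda>y. y * exp (- (s / 2) * y)"])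
  assume s: "s > 0"
  show "integrable m (\<lambda>y. y * exp (- (s / 2) * y))" using s by (intro integrable_y_exp) auto
  show "AE y in m. \<bar>y * exp (- t * y)\<bar> \<le> y * exp (- (s / 2) * y)" if "t \<in> {s / 2<..} - {s}" for t
    using nonneg
  proof eventually_elim
    case (elim y)
    have "s / 2 * y \<le> t * y" using that elim by (intro mult_right_mono) auto
    then show ?case using elim by (auto simp: abs_mult intro!: mult_left_mono)
  qed
  show "AE y in m. ((\<lambda>t. y * exp (- t * y)) \<longlongrightarrow> y * exp (- s * y)) (at s)"
    by (intro AE_I2 tendsto_intros)
qed auto

lemma isCont_G: "s > 0 \<Longrightarrow> isCont G s"
  using has_derivative_G by (rule DERIV_isCont)

text \<open>Convexity of \<open>ln G\<close> in the form of its tangent at \<open>s\<close>,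
  obtained like Jensen's inequality: \<open>exp x \<ge> 1 + x\<close>, centred at the tilted mean
  \<open>b\<close>, is integrated against \<open>exp (- s * y)\<close>.\<close>

lemma ln_G_tangent:
  assumes s: "s > 0" and t: "t > 0"
  shows "ln (G t) \<ge> ln (G s) - (t - s) * (G1 s / G s)"
proof -
  define b where "b = G1 s / G s"
  have "0 \<le> (\<integral>y. exp (- s * y) * (exp (- (t - s) * (y - b)) - 1 + (t - s) * (y - b)) \<partial>m)"
  proof (intro integral_nonneg_AE AE_I2 mult_nonneg_nonneg)
    fix y
    show "0 \<le> exp (- (t - s) * (y - b)) - 1 + (t - s) * (y - b)"
      using exp_ge_add_one_self[of "- (t - s) * (y - b)"] minus_mult_left[of "t - s" "y - b"] by linarith
  qed simp
  also have "(\<lambda>y. exp (- s * y) * (exp (- (t - s) * (y - b)) - 1 + (t - s) * (y - b))) =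
    (\<lambda>y. exp ((t - s) * b) * exp (- t * y) - (1 + (t - s) * b) * exp (- s * y) + (t - s) * (y * exp (- s * y)))"
  proof
    fix y
    have "exp (- s * y) * exp (- (t - s) * (y - b)) = exp ((t - s) * b) * exp (- t * y)"
      by (simp add: exp_add[symmetric] algebra_simps)
    then show "exp (- s * y) * (exp (- (t - s) * (y - b)) - 1 + (t - s) * (y - b)) =
      exp ((t - s) * b) * exp (- t * y) - (1 + (t - s) * b) * exp (- s * y) + (t - s) * (y * exp (- s * y))"
      by (simp add: algebra_simps)
  qed
  also have "(\<integral>y. exp ((t - s) * b) * exp (- t * y) - (1 + (t - s) * b) * exp (- s * y) + (t - s) * (y * exp (- s * y)) \<partial>m)
    = exp ((t - s) * b) * G t - (1 + (t - s) * b) * G s + (t - s) * G1 s"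
    unfolding G_def G1_def using integrable_exp[of s] integrable_exp[of t] integrable_y_exp[of s] s t by simp
  also have "\<dots> = exp ((t - s) * b) * G t - G s"
    using G_pos[of s] s by (simp add: b_def field_simps)
  finally have "G s \<le> exp ((t - s) * b) * G t" by simp
  then have "ln (G s) \<le> ln (exp ((t - s) * b) * G t)"
    using G_pos[of s] s by (subst ln_le_cancel_iff) (use G_pos[of t] t in auto)
  also have "\<dots> = (t - s) * b + ln (G t)" using G_pos[of t] t by (subst ln_mult) auto
  finally show ?thesis by (simp add: b_def)
qed

text \<open>The tangent inequalities at \<open>s\<close> and at \<open>t\<close> are added.\<close>

lemma mean_antimono:
  assumes "0 < s" "s \<le> t"
  shows "G1 t / G t \<le> G1 s / G s"
proof (cases "s = t")
  case False
  define A B where "A = G1 t / G t" and "B = G1 s / G s"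
  have "ln (G s) - (t - s) * B \<le> ln (G t)" "ln (G t) - (s - t) * A \<le> ln (G s)"
    using ln_G_tangent[of s t] ln_G_tangent[of t s] assms by (simp_all add: A_def B_def)
  then have "(t - s) * A \<le> (t - s) * B" by (simp add: left_diff_distrib)
  then have "A \<le> B" using False assms by (simp add: mult_le_cancel_left)
  then show ?thesis by (simp add: A_def B_def)
qed simp

lemma G_tendsto_1: "(\<lambda>n. G (1 / real (Suc n))) \<longlonglongrightarrow> 1"
proof -
  have "(\<lambda>n. G (1 / real (Suc n))) \<longlonglongrightarrow> (\<integral>y. 1 \<partial>m)"
    unfolding G_def
  proof (rule integral_dominated_convergence[where w="\<lambda>_. 1"])
    show "AE y in m. (\<lambda>n. exp (- (1 / real (Suc n)) * y)) \<longlonglongrightarrow> 1"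
    proof (rule AE_I2)
      fix y
      have "(\<lambda>n. 1 / real (Suc n)) \<longlonglongrightarrow> 0" by (rule LIMSEQ_Suc) (rule lim_1_over_n)
      then have "(\<lambda>n. exp (- (1 / real (Suc n)) * y)) \<longlonglongrightarrow> exp (- 0 * y)" by (intro tendsto_intros)
      then show "(\<lambda>n. exp (- (1 / real (Suc n)) * y)) \<longlonglongrightarrow> 1" by simp
    qed
    show "AE y in m. norm (exp (- (1 / real (Suc n)) * y)) \<le> 1" for n
      using nonneg by eventually_elim simp
  qed auto
  then show ?thesis by (simp add: prob_space)
qed

end

section \<open>\<open>L\<close> as a Laplace transform at \<theta> - 1\<close>

context splitting
begin

lemma tilt_1_laplace: "laplace (tilt 1)"
proof -
  interpret T: prob_space "tilt 1" by (rule prob_space_tilt) simp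
  have "(\<integral>\<^sup>+ y. indicator {..<0} y \<partial>tilt 1) * Lfun \<nu> 1 =
    (\<integral>\<^sup>+ p. (\<Sum>c. ennreal (mass p c powr 1) * indicator {..<0} (- ln (mass p c))) \<partial>\<nu>)"
    by (rule nn_integral_tilt) auto
  also have "\<dots> = (\<integral>\<^sup>+ p. (\<Sum>c. 0) \<partial>\<nu>)"
  proof (intro nn_integral_cong suminf_cong)
    fix p c assume "p \<in> space \<nu>"
    then have "mass p c = 0 \<or> ln (mass p c) \<le> 0"
      using mass_le_1[of p c] measure_nonneg[of p "{c}"] by (auto simp: le_less)
    then show "ennreal (mass p c powr 1) * indicator {..<0} (- ln (mass p c)) = 0" by auto
  qed
  finally have "emeasure (tilt 1) {..<0} = 0" by (simp add: Lfun_1)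
  then have "AE y in tilt 1. 0 \<le> y"
    by (subst AE_iff_measurable[of "{..<0}"]) auto
  then show ?thesis
    by unfold_locales auto
qed

sublocale Lap: laplace "tilt 1" by (rule tilt_1_laplace)

text \<open>On atoms of positive mass,
  \<open>p powr \<theta> = p * exp (- (\<theta> - 1) * (- ln p))\<close>; thus every tilt is an
  exponential tilt of the one at 1, whose normalisation is \<open>L 1 = 1\<close> by conservation of
  mass.\<close>

lemma nn_integral_tilt_1:
  assumes \<theta>: "1 \<le> \<theta>" and [measurable]: "f \<in> borel_measurable borel"
  shows "(\<integral>\<^sup>+ y. f y \<partial>tilt \<theta>) * Lfun \<nu> \<theta> = (\<integral>\<^sup>+ y. ennreal (exp (- (\<theta> - 1) * y)) * f y \<partial>tilt 1)"
proof -
  have "(\<integral>\<^sup>+ y. f y \<partial>tilt \<theta>) * Lfun \<nu> \<theta> = (\<integral>\<^sup>+ p. (\<Sum>c. ennreal (mass p c powr \<theta>) * f (- ln (mass p c))) \<partial>\<nu>)"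
    by (rule nn_integral_tilt[OF \<theta>]) auto
  also have "\<dots> = (\<integral>\<^sup>+ p. (\<Sum>c. ennreal (mass p c powr 1) * (ennreal (exp (- (\<theta> - 1) * (- ln (mass p c)))) * f (- ln (mass p c)))) \<partial>\<nu>)"
  proof (intro nn_integral_cong suminf_cong)
    fix p c
    have "mass p c powr \<theta> = mass p c powr 1 * exp (- (\<theta> - 1) * (- ln (mass p c)))"
    proof (cases "mass p c = 0")
      case False
      then have "mass p c powr \<theta> = mass p c powr 1 * mass p c powr (\<theta> - 1)"
        by (simp only: powr_add[symmetric]) simp
      moreover have "mass p c powr (\<theta> - 1) = exp (- (\<theta> - 1) * (- ln (mass p c)))"
        using False by (simp add: powr_def algebra_simps)
      ultimately show ?thesis by simp
    qed simp
    then show "ennreal (mass p c powr \<theta>) * f (- ln (mass p c)) =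
      ennreal (mass p c powr 1) * (ennreal (exp (- (\<theta> - 1) * (- ln (mass p c)))) * f (- ln (mass p c)))"
      by (simp only: ennreal_mult powr_ge_zero exp_ge_zero mult.assoc)
  qed
  also have "\<dots> = (\<integral>\<^sup>+ y. ennreal (exp (- (\<theta> - 1) * y)) * f y \<partial>tilt 1) * Lfun \<nu> 1"
    by (rule nn_integral_tilt[symmetric]) auto
  finally show ?thesis by (simp add: Lfun_1)
qed

lemma Lfun_eq_G: "1 \<le> \<theta> \<Longrightarrow> Lfun \<nu> \<theta> = ennreal (Lap.G (\<theta> - 1))"
proof -
  assume \<theta>: "1 \<le> \<theta>"
  interpret T: prob_space "tilt \<theta>" by (rule prob_space_tilt[OF \<theta>])
  have "Lfun \<nu> \<theta> = (\<integral>\<^sup>+ y. ennreal (exp (- (\<theta> - 1) * y)) \<partial>tilt 1)"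
    using nn_integral_tilt_1[OF \<theta>, of "\<lambda>_. 1"] T.emeasure_space_1 by simp
  also have "\<dots> = ennreal (Lap.G (\<theta> - 1))"
    unfolding Lap.G_def by (rule nn_integral_eq_integral) (use Lap.integrable_exp[of "\<theta> - 1"] \<theta> in auto)
  finally show ?thesis .
qed

lemma Lreal_eq_G: "1 \<le> \<theta> \<Longrightarrow> Lreal \<nu> \<theta> = Lap.G (\<theta> - 1)"
  using Lap.G_pos[of "\<theta> - 1"] by (simp add: Lreal_def Lfun_eq_G)

lemma Lreal_pos: "1 \<le> \<theta> \<Longrightarrow> Lreal \<nu> \<theta> > 0"
  using Lap.G_pos[of "\<theta> - 1"] by (simp add: Lreal_eq_G)

lemma Lfun_eq_Lreal: "1 \<le> \<theta> \<Longrightarrow> Lfun \<nu> \<theta> = ennreal (Lreal \<nu> \<theta>)"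
  by (simp add: Lreal_eq_G Lfun_eq_G)

lemma deriv_Lreal: assumes "1 < \<theta>" shows "deriv (Lreal \<nu>) \<theta> = - Lap.G1 (\<theta> - 1)"
proof (rule DERIV_imp_deriv)
  have "((\<lambda>\<theta>. Lap.G (\<theta> - 1)) has_real_derivative - Lap.G1 (\<theta> - 1) * 1) (at \<theta>)"
    using assms by (intro DERIV_chain2[OF Lap.has_derivative_G]) (auto intro!: derivative_eq_intros)
  then have "((\<lambda>\<theta>. Lap.G (\<theta> - 1)) has_real_derivative - Lap.G1 (\<theta> - 1)) (at \<theta>)" by simp
  then show "(Lreal \<nu> has_real_derivative - Lap.G1 (\<theta> - 1)) (at \<theta>)"
  proof (rule has_field_derivative_transform_within_open[where S="{1<..}"])
  qed (use assms in \<open>auto simp: Lreal_eq_G\<close>)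
qed

lemma phi_eq: "1 < \<theta> \<Longrightarrow> phi \<nu> \<theta> = ln (Lap.G (\<theta> - 1)) + \<theta> * (Lap.G1 (\<theta> - 1) / Lap.G (\<theta> - 1))"
  by (simp add: phi_def Lreal_eq_G deriv_Lreal)

text \<open>Monotonicity without a second derivative: the tangent of \<open>ln G\<close> at
  \<open>b - 1\<close> is evaluated at \<open>a - 1\<close>, and the tilted mean at
  \<open>a - 1\<close> is at least the one at \<open>b - 1\<close>.\<close>

lemma phi_antimono: assumes "1 < a" "a \<le> b" shows "phi \<nu> b \<le> phi \<nu> a"
proof -
  define A B where "A = Lap.G1 (a - 1) / Lap.G (a - 1)" and "B = Lap.G1 (b - 1) / Lap.G (b - 1)"
  have "ln (Lap.G (a - 1)) \<ge> ln (Lap.G (b - 1)) - (a - b) * B"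
    using Lap.ln_G_tangent[of "b - 1" "a - 1"] assms by (simp add: B_def)
  moreover have "a * B \<le> a * A"
    using Lap.mean_antimono[of "a - 1" "b - 1"] assms unfolding A_def B_def by (intro mult_left_mono) auto
  moreover have "phi \<nu> a = ln (Lap.G (a - 1)) + a * A" "phi \<nu> b = ln (Lap.G (b - 1)) + b * B"
    using assms unfolding A_def B_def by (simp_all only: phi_eq)
  ultimately show ?thesis by (simp add: left_diff_distrib)
qed

lemma isCont_phi: assumes "1 < \<theta>" shows "isCont (phi \<nu>) \<theta>"
proof -
  have c: "isCont (\<lambda>x. Lap.G (x - 1)) \<theta>" "isCont (\<lambda>x. Lap.G1 (x - 1)) \<theta>"
    using assms by (auto intro!: isCont_o2[where g="Lap.G"] isCont_o2[where g="Lap.G1"] Lap.isCont_G Lap.isCont_G1 continuous_intros)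
  have "Lap.G (\<theta> - 1) > 0" using assms by (intro Lap.G_pos) auto
  then have "isCont (\<lambda>x. ln (Lap.G (x - 1)) + x * (Lap.G1 (x - 1) / Lap.G (x - 1))) \<theta>"
    using c by (intro continuous_intros) auto
  moreover have "\<forall>\<^sub>F x in nhds \<theta>. ln (Lap.G (x - 1)) + x * (Lap.G1 (x - 1) / Lap.G (x - 1)) = phi \<nu> x"
    using eventually_nhds_in_open[of "{1<..}" \<theta>] assms by (auto elim!: eventually_mono simp: phi_eq)
  ultimately show ?thesis by (simp add: isCont_cong)
qed

lemma theta_low_less: "1 < \<theta> \<Longrightarrow> theta_low \<nu> < ereal \<theta>"
proof -
  assume "1 < \<theta>"
  have "theta_low \<nu> \<le> ereal 1" unfolding theta_low_def by (intro Inf_lower) (auto simp: Lfun_1)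
  also have "\<dots> < ereal \<theta>" using \<open>1 < \<theta>\<close> by simp
  finally show ?thesis .
qed

end

section \<open>Consequences of a non-geometric law and the exponent behind
  \<open>C_const\<close>\<close>

locale nongeometric_splitting = splitting +
  assumes nongeometric: "\<not> geometric_law \<nu>"
begin

text \<open>A constant displacement \<open>a\<close> forces all positive masses to equal
  \<open>exp (- a)\<close>. For \<open>a > 0\<close> this is geometric with ratio
  \<open>exp (- a)\<close>; otherwise the masses are 1, the power 0 of any ratio.\<close>

lemma tilt_not_const: assumes \<theta>: "1 \<le> \<theta>" shows "\<not> (AE y in tilt \<theta>. y = a)"
proof
  assume "AE y in tilt \<theta>. y = a"
  then have "(\<integral>\<^sup>+ y. indicator (- {a}) y \<partial>tilt \<theta>) = 0"
    by (subst nn_integral_0_iff_AE) (auto elim: eventually_mono)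
  then have "(\<integral>\<^sup>+ p. (\<Sum>c. ennreal (mass p c powr \<theta>) * indicator (- {a}) (- ln (mass p c))) \<partial>\<nu>) = 0"
    using nn_integral_tilt[OF \<theta>, of "indicator (- {a})"] by simp
  then have "AE p in \<nu>. (\<Sum>c. ennreal (mass p c powr \<theta>) * indicator (- {a}) (- ln (mass p c))) = 0"
    by (subst (asm) nn_integral_0_iff_AE) auto
  then have ae: "AE p in \<nu>. \<forall>c. mass p c > 0 \<longrightarrow> mass p c = exp (- a)"
  proof eventually_elim
    case (elim p)
    show ?case
    proof (intro allI impI)
      fix c assume c: "mass p c > 0"
      define F :: "nat \<Rightarrow> ennreal" where "F c = ennreal (mass p c powr \<theta>) * indicator (- {a}) (- ln (mass p c))" for c
      have "sum F {c} \<le> (\<Sum>c. F c)" by (rule sum_le_suminf) auto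
      moreover have "(\<Sum>c. F c) = 0" using elim by (simp only: F_def)
      ultimately have "F c = 0" by simp
      then have "- ln (mass p c) = a"
        unfolding F_def using c by (auto simp: indicator_def split: if_splits)
      then show "mass p c = exp (- a)" using c by auto
    qed
  qed
  show False
  proof (cases "a > 0")
    case True
    then have "geometric_law \<nu>"
      unfolding geometric_law_def using ae
      by (intro exI[of _ "exp (- a)"]) (auto elim!: eventually_mono intro: exI[of _ "1::nat"])
    then show False using nongeometric by simp
  next
    case False
    have "AE p in \<nu>. \<forall>c. mass p c > 0 \<longrightarrow> (\<exists>n::nat. mass p c = (1 / 2) ^ n)"
      using ae AE_space
    proof eventually_elim
      case (elim p)
      show ?case
      proof (intro allI impI)
        fix c assume "mass p c > 0"
        then have "mass p c = exp (- a)" using elim by simp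
        then have "mass p c \<ge> 1" using False by simp
        then have "mass p c = (1 / 2) ^ 0" using mass_le_1[OF elim(2), of c] by simp
        then show "\<exists>n::nat. mass p c = (1 / 2) ^ n" by blast
      qed
    qed
    then have "geometric_law \<nu>"
      unfolding geometric_law_def by (intro exI[of _ "1 / 2"]) auto
    then show False using nongeometric by simp
  qed
qed

lemma mean_pos: assumes s: "s > 0" shows "Lap.G1 s / Lap.G s > 0"
proof -
  have "0 \<le> Lap.G1 s"
    unfolding Lap.G1_def by (rule integral_nonneg_AE) (use Lap.nonneg in auto)
  moreover have "Lap.G1 s \<noteq> 0"
  proof
    assume "Lap.G1 s = 0"
    then have "AE y in tilt 1. y * exp (- s * y) = 0"
      unfolding Lap.G1_def
      by (subst (asm) integral_nonneg_eq_0_iff_AE[OF Lap.integrable_y_exp[OF s]]) (use Lap.nonneg in auto)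
    then have "AE y in tilt 1. y = 0" by eventually_elim auto
    then show False using tilt_not_const[of 1 0] by simp
  qed
  ultimately show ?thesis using Lap.G_pos[of s] s by simp
qed

text \<open>The tangent at \<open>s = \<theta> - 1\<close> has negative slope, so
  \<open>ln (G s)\<close> lies strictly below \<open>ln (G (s / 2))\<close>, which is at most
  0.\<close>

lemma Lreal_less_1: assumes "1 < \<theta>" shows "Lreal \<nu> \<theta> < 1"
proof -
  define s where "s = \<theta> - 1"
  have s: "s > 0" using assms by (simp add: s_def)
  define r where "r = Lap.G1 s / Lap.G s"
  have r0: "0 < r" unfolding r_def by (rule mean_pos[OF s])
  have "ln (Lap.G s) < ln (Lap.G s) + s / 2 * r"
    using r0 s by simp
  also have "\<dots> = ln (Lap.G s) - (s / 2 - s) * r" by (simp add: algebra_simps)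
  also have "\<dots> \<le> ln (Lap.G (s / 2))"
    unfolding r_def using s by (intro Lap.ln_G_tangent) auto
  also have "\<dots> \<le> 0" using Lap.G_le_1[of "s / 2"] Lap.G_pos[of "s / 2"] s by simp
  finally show ?thesis using Lap.G_pos[of s] s assms by (simp add: Lreal_eq_G s_def)
qed

text \<open>As \<theta> decreases to 1 the logarithm tends to 0, while the tilted mean stays above
  its positive value at \<open>s = 1\<close> by monotonicity.\<close>

lemma ex_phi_pos: "\<exists>\<theta>>1. phi \<nu> \<theta> > 0"
proof -
  have "(\<lambda>n. ln (Lap.G (1 / real (Suc n)))) \<longlonglongrightarrow> ln 1"
    by (intro tendsto_ln Lap.G_tendsto_1) auto
  then have "\<forall>\<^sub>F n in sequentially. - (Lap.G1 1 / Lap.G 1) < ln (Lap.G (1 / real (Suc n)))"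
    using mean_pos[of 1] by (intro order_tendstoD(1)[where y="ln 1"]) auto
  then obtain n where n: "- (Lap.G1 1 / Lap.G 1) < ln (Lap.G (1 / real (Suc n)))"
    by (auto simp: eventually_sequentially)
  define s where "s = 1 / real (Suc n)"
  have s: "0 < s" "s \<le> 1" by (auto simp: s_def)
  have "Lap.G1 1 / Lap.G 1 \<le> Lap.G1 s / Lap.G s" using s by (intro Lap.mean_antimono) auto
  also have "\<dots> \<le> (1 + s) * (Lap.G1 s / Lap.G s)"
    using mult_right_mono[of 1 "1 + s" "Lap.G1 s / Lap.G s"] mean_pos[OF s(1)] s by simp
  finally have "Lap.G1 1 / Lap.G 1 \<le> (1 + s) * (Lap.G1 s / Lap.G s)" .
  moreover have "- (Lap.G1 1 / Lap.G 1) < ln (Lap.G s)" using n by (simp only: s_def)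
  moreover have "phi \<nu> (1 + s) = ln (Lap.G s) + (1 + s) * (Lap.G1 s / Lap.G s)"
    using s by (subst phi_eq) auto
  ultimately have "phi \<nu> (1 + s) > 0" by linarith
  then show ?thesis using s by (intro exI[of _ "1 + s"]) auto
qed

text \<open>One exponent \<theta> serves both branches of \<open>C_const\<close>: \<open>j\<close>
  itself, or the critical exponent, which is then finite and at which \<open>phi\<close> vanishes by
  continuity. The alternative \<open>\<theta> = j\<close> or \<open>phi \<nu> \<theta> = 0\<close>
  is what the later change of exponent from \<theta> to \<open>j\<close> relies on.\<close>

lemma C_const_cases:
  assumes j: "j \<ge> 2"
  shows "\<exists>\<theta>. 1 < \<theta> \<and> \<theta> \<le> real j \<and> phi \<nu> \<theta> \<ge> 0 \<and> (\<theta> = real j \<or> phi \<nu> \<theta> = 0) \<and>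
    C_const \<nu> j = - \<theta> / ln (Lreal \<nu> \<theta>)"
proof (cases "ereal (real j) < theta_star \<nu>")
  case True
  then obtain t where "ereal (real j) < ereal t" "phi \<nu> t > 0"
    unfolding theta_star_def less_Sup_iff by auto
  then have "phi \<nu> (real j) \<ge> 0"
    using phi_antimono[of "real j" t] j by auto
  then show ?thesis using True j by (intro exI[of _ "real j"]) (auto simp: C_const_def)
next
  case False
  \<comment> \<open>Places \<open>theta_star \<nu>\<close> above 1, where \<open>phi\<close> is
    known to be continuous.\<close>
  obtain \<theta>0 where \<theta>0: "\<theta>0 > 1" "phi \<nu> \<theta>0 > 0" using ex_phi_pos by blast
  have "ereal \<theta>0 \<le> theta_star \<nu>"
    unfolding theta_star_def using \<theta>0 by (intro Sup_upper) (auto simp: theta_low_less)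
  with False obtain t where t: "theta_star \<nu> = ereal t" "\<theta>0 \<le> t" "t \<le> real j"
    by (cases "theta_star \<nu>") (auto simp: not_less)
  have t1: "1 < t" using t \<theta>0 by simp
  have above: "phi \<nu> x \<le> 0" if "x > t" for x
  proof (rule ccontr)
    assume "\<not> phi \<nu> x \<le> 0"
    then have "ereal x \<le> theta_star \<nu>"
      unfolding theta_star_def using that t1 by (intro Sup_upper) (auto simp: theta_low_less)
    then show False using that t(1) by simp
  qed
  have below: "phi \<nu> x \<ge> 0" if "1 < x" "x < t" for x
  proof -
    have "ereal x < theta_star \<nu>" using that t(1) by simp
    then obtain x' where "ereal x < ereal x'" "phi \<nu> x' > 0"
      unfolding theta_star_def less_Sup_iff by auto
    then show ?thesis using phi_antimono[of x x'] that by auto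
  qed
  have lim: "(phi \<nu> \<longlongrightarrow> phi \<nu> t) (at t)" using isCont_phi[OF t1] by (simp add: isCont_def)
  have "phi \<nu> t \<le> 0"
  proof (rule tendsto_upperbound)
    show "(phi \<nu> \<longlongrightarrow> phi \<nu> t) (at_right t)" using lim by (rule tendsto_within_subset) simp
    show "\<forall>\<^sub>F x in at_right t. phi \<nu> x \<le> 0"
      using eventually_at_right_less[of t] by eventually_elim (rule above)
  qed simp
  moreover have "phi \<nu> t \<ge> 0"
  proof (rule tendsto_lowerbound)
    show "(phi \<nu> \<longlongrightarrow> phi \<nu> t) (at_left t)" using lim by (rule tendsto_within_subset) simp
    show "\<forall>\<^sub>F x in at_left t. 0 \<le> phi \<nu> x"
      using eventually_at_left_real[OF t1] by eventually_elim (rule below; simp)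
  qed simp
  ultimately have phi0: "phi \<nu> t = 0" by simp
  let ?f = "\<lambda>x. - Lreal \<nu> x / deriv (Lreal \<nu>) x"
  have "isCont ?f t"
  proof -
    have c: "isCont (\<lambda>x. Lap.G (x - 1)) t" "isCont (\<lambda>x. Lap.G1 (x - 1)) t"
      using t1 by (auto intro!: isCont_o2[where g="Lap.G"] isCont_o2[where g="Lap.G1"] Lap.isCont_G Lap.isCont_G1 continuous_intros)
    have "Lap.G1 (t - 1) \<noteq> 0" using mean_pos[of "t - 1"] t1 by auto
    then have "isCont (\<lambda>x. Lap.G (x - 1) / Lap.G1 (x - 1)) t"
      using c by (intro continuous_intros) auto
    moreover have "\<forall>\<^sub>F x in nhds t. Lap.G (x - 1) / Lap.G1 (x - 1) = ?f x"
      using eventually_nhds_in_open[of "{1<..}" t] t1 by (auto elim!: eventually_mono simp: Lreal_eq_G deriv_Lreal)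
    ultimately show ?thesis by (simp add: isCont_cong)
  qed
  then have "(?f \<longlongrightarrow> ?f t) (at t)" by (simp add: isCont_def)
  then have "(?f \<longlongrightarrow> ?f t) (at_left t)" by (rule tendsto_within_subset) simp
  then have "((\<lambda>x. ereal (?f (real_of_ereal x))) \<longlongrightarrow> ereal (?f t)) (at_left (ereal t))"
    unfolding at_left_ereal filterlim_filtermap by simp
  moreover have "at_left (ereal t) \<noteq> bot"
    unfolding at_left_ereal by (simp add: filtermap_bot_iff trivial_limit_at_left_real)
  ultimately have "C_star \<nu> = ereal (?f t)"
    unfolding C_star_def t(1) by (intro tendsto_Lim)
  \<comment> \<open>\<open>phi \<nu> t = 0\<close> says \<open>ln L = t * L' / L\<close>, so
    \<open>- L / L'\<close> and \<open>- t / ln L\<close> agree at \<open>t\<close>.\<close>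
  moreover have "?f t = - t / ln (Lreal \<nu> t)"
  proof -
    have "ln (Lreal \<nu> t) = t * deriv (Lreal \<nu>) t / Lreal \<nu> t" using phi0 by (simp add: phi_def)
    then show ?thesis using t1 by simp
  qed
  ultimately have "C_const \<nu> j = - t / ln (Lreal \<nu> t)"
    using False by (simp add: C_const_def)
  then show ?thesis using t t1 phi0 by (intro exI[of _ t]) auto
qed

end

section \<open>Second moment of the barrier sums\<close>

text \<open>A pointwise quadratic bound is integrated: on the event,
  \<open>z \<le> t / 2 * z\<^sup>2 + 1 / (2 * t)\<close>, and off it \<open>z \<le> p / 2\<close>.
  This works directly with \<open>ennreal\<close> values, infinity included.\<close>

lemma (in prob_space) paley_zygmund:
  fixes Z :: "'a \<Rightarrow> ennreal" and p m :: real
  assumes [measurable]: "Z \<in> borel_measurable M"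
    and p: "0 < p" "ennreal p \<le> (\<integral>\<^sup>+ x. Z x \<partial>M)" and m: "0 < m" "(\<integral>\<^sup>+ x. (Z x)\<^sup>2 \<partial>M) \<le> ennreal m"
  shows "prob {x \<in> space M. ennreal (p / 2) \<le> Z x} \<ge> p\<^sup>2 / (4 * m)"
proof -
  let ?A = "{x \<in> space M. ennreal (p / 2) \<le> Z x}"
  \<comment> \<open>With this \<open>t\<close> the second-moment term is \<open>p / 4\<close> and
    the coefficient of the probability is \<open>m / p\<close>.\<close>
  define t where "t = p / (2 * m)"
  have t: "t > 0" using p m by (simp add: t_def)
  have "Z x \<le> ennreal (p / 2) + (ennreal (t / 2) * (Z x)\<^sup>2 + ennreal (1 / (2 * t)) * indicator ?A x)" if "x \<in> space M" for x
  proof (cases "Z x")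
    case (real z)
    show ?thesis
    proof (cases "x \<in> ?A")
      case True
      have "0 \<le> (t * z - 1)\<^sup>2 / (2 * t)" using t by simp
      also have "\<dots> = t / 2 * z\<^sup>2 + 1 / (2 * t) - z"
        using t by (simp add: power2_eq_square field_simps)
      finally have "z \<le> t / 2 * z\<^sup>2 + 1 / (2 * t)" by simp
      then have "ennreal z \<le> ennreal (t / 2 * z\<^sup>2 + 1 / (2 * t))" by (rule ennreal_leI)
      also have "\<dots> = ennreal (t / 2 * z\<^sup>2) + ennreal (1 / (2 * t))"
        using t by (intro ennreal_plus) auto
      also have "ennreal (t / 2 * z\<^sup>2) = ennreal (t / 2) * (Z x)\<^sup>2"
        using real t ennreal_mult[of "t / 2" "z\<^sup>2"] by (simp add: ennreal_power)
      finally have "Z x \<le> ennreal (t / 2) * (Z x)\<^sup>2 + ennreal (1 / (2 * t)) * indicator ?A x"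
        using True real by simp
      then show ?thesis by (rule add_increasing[OF zero_le])
    next
      case False
      then have "Z x \<le> ennreal (p / 2)" using that by auto
      then show ?thesis by (rule order_trans) simp
    qed
  next
    case top
    then have "(Z x)\<^sup>2 = top" by (simp add: power2_eq_square)
    then show ?thesis using t by (simp add: ennreal_mult_top)
  qed
  then have "(\<integral>\<^sup>+ x. Z x \<partial>M) \<le> (\<integral>\<^sup>+ x. ennreal (p / 2) + (ennreal (t / 2) * (Z x)\<^sup>2 + ennreal (1 / (2 * t)) * indicator ?A x) \<partial>M)"
    by (intro nn_integral_mono) auto
  also have "\<dots> = ennreal (p / 2) + (ennreal (t / 2) * (\<integral>\<^sup>+ x. (Z x)\<^sup>2 \<partial>M) + ennreal (1 / (2 * t)) * emeasure M ?A)"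
    by (simp add: nn_integral_add nn_integral_cmult emeasure_space_1)
  also have "\<dots> \<le> ennreal (p / 2) + (ennreal (t / 2) * ennreal m + ennreal (1 / (2 * t)) * ennreal (prob ?A))"
    by (intro add_mono mult_left_mono m order_refl) (auto simp: emeasure_eq_measure)
  also have "\<dots> = ennreal (p / 2 + (t / 2 * m + 1 / (2 * t) * prob ?A))"
    using t p m by (simp add: ennreal_mult[symmetric] ennreal_plus[symmetric] del: ennreal_plus)
  finally have "ennreal p \<le> ennreal (p / 2 + (t / 2 * m + 1 / (2 * t) * prob ?A))"
    using p(2) by simp
  moreover have "0 \<le> p / 2 + (t / 2 * m + 1 / (2 * t) * prob ?A)"
    using t p m by (intro add_nonneg_nonneg mult_nonneg_nonneg) auto
  ultimately have "p \<le> p / 2 + (t / 2 * m + 1 / (2 * t) * prob ?A)"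
    by (simp add: ennreal_le_iff)
  moreover have "t / 2 * m = p / 4" using m by (simp add: t_def)
  moreover have "1 / (2 * t) * prob ?A = m / p * prob ?A" using m p by (simp add: t_def)
  ultimately have "p / 4 \<le> m / p * prob ?A" by linarith
  then show ?thesis using p m by (simp add: field_simps power2_eq_square)
qed

section \<open>Power sums over a generation\<close>

context splitting
begin

lemma nn_integral_coordinate:
  assumes [measurable]: "g \<in> borel_measurable \<nu>"
  shows "(\<integral>\<^sup>+ e. g (e i) \<partial>E) = (\<integral>\<^sup>+ p. g p \<partial>\<nu>)"
proof -
  have "(\<integral>\<^sup>+ p. g p \<partial>distr E \<nu> (\<lambda>e. e i)) = (\<integral>\<^sup>+ e. g (e i) \<partial>E)"
    by (rule nn_integral_distr) measurable
  then show ?thesis by (simp add: E.PiM_component)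
qed

definition S :: "real \<Rightarrow> nat \<Rightarrow> (nat list \<Rightarrow> nat measure) \<Rightarrow> ennreal" where
  "S \<theta> k e = gsum k (\<lambda>i. ennreal (bsize e i powr \<theta>))"

lemma measurable_S [measurable]: "S \<theta> k \<in> borel_measurable E"
  unfolding S_def by measurable

lemma suminf_powr_le_1:
  assumes "p \<in> space \<nu>" "1 \<le> \<theta>" shows "(\<Sum>c. ennreal (mass p c powr \<theta>)) \<le> 1"
proof -
  have "mass p c powr \<theta> \<le> mass p c" for c
    using powr_mono'[OF assms(2) measure_nonneg mass_le_1[OF assms(1), of c]] by (cases "mass p c = 0") auto
  then have "(\<Sum>c. ennreal (mass p c powr \<theta>)) \<le> (\<Sum>c. ennreal (mass p c))"
    by (intro suminf_le ennreal_leI) auto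
  then show ?thesis by (simp only: suminf_mass[OF assms(1)])
qed

lemma nn_integral_S:
  assumes "1 \<le> \<theta>" shows "(\<integral>\<^sup>+ e. S \<theta> k e \<partial>E) = Lfun \<nu> \<theta> ^ k"
proof -
  interpret T: prob_space "tilt \<theta>" by (rule prob_space_tilt[OF assms])
  interpret R: product_prob_space "\<lambda>_ :: nat. tilt \<theta>" UNIV by unfold_locales
  show ?thesis
    using many_to_one[OF assms, of "\<lambda>_. 1" k] R.emeasure_space_1
    by (simp add: S_def depends_on_def)
qed

lemma S_Suc_le: "e \<in> space E \<Longrightarrow> 1 \<le> \<theta> \<Longrightarrow> S \<theta> (Suc k) e \<le> S \<theta> k e"
proof -
  assume e: "e \<in> space E" and \<theta>: "1 \<le> \<theta>"
  have "S \<theta> (Suc k) e = gsum k (\<lambda>i. ennreal (bsize e i powr \<theta>) * (\<Sum>c. ennreal (mass (e i) c powr \<theta>)))"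
    by (simp only: S_def gsum_Suc box_size.simps powr_mult ennreal_mult powr_ge_zero ennreal_suminf_cmult)
  also have "\<dots> \<le> gsum k (\<lambda>i. ennreal (bsize e i powr \<theta>) * 1)"
    by (intro gsum_mono mult_left_mono suminf_powr_le_1 space_E e \<theta>) auto
  finally show ?thesis by (simp add: S_def)
qed

text \<open>Each split has power sum at most 1 for exponents from 1 on. A lower bound found some
  generations deeper therefore also holds at generation \<open>k\<close>.\<close>

lemma S_antimono: "e \<in> space E \<Longrightarrow> 1 \<le> \<theta> \<Longrightarrow> k \<le> l \<Longrightarrow> S \<theta> l e \<le> S \<theta> k e"
  by (rule lift_Suc_antimono_le[of "\<lambda>k. S \<theta> k e"]) (auto intro: S_Suc_le)

lemma incs_nonneg: "e \<in> space E \<Longrightarrow> 0 \<le> incs e i m"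
proof (induction i)
  case (Cons c i)
  have "mass (e i) c = 0 \<or> ln (mass (e i) c) \<le> 0"
    using mass_le_1[OF space_E[OF Cons.prems], of i c] measure_nonneg[of "e i" "{c}"]
    by (auto simp: le_less)
  then show ?case using Cons by auto
qed simp

end

section \<open>The walk tilted at \<theta> and its truncated weights\<close>

locale tilted = nongeometric_splitting +
  fixes \<theta> :: real
  assumes \<theta>: "1 < \<theta>"
begin

abbreviation \<Lambda> :: real where "\<Lambda> \<equiv> Lreal \<nu> \<theta>"

lemma \<Lambda>: "0 < \<Lambda>" "\<Lambda> < 1" "Lfun \<nu> \<theta> = ennreal \<Lambda>"
  using \<theta> Lreal_pos[of \<theta>] Lreal_less_1[of \<theta>] Lfun_eq_Lreal[of \<theta>] by auto

text \<open>Normalised so that \<open>exp (- walk)\<close> is the box size to the power \<theta>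
  divided by \<open>\<Lambda> ^ k\<close>. Displacements are nonnegative almost surely;
  \<open>max 0\<close> serves to bound every step below by \<open>ln \<Lambda>\<close>
  everywhere.\<close>

definition step :: "real \<Rightarrow> real" where
  "step y = \<theta> * max 0 y + ln \<Lambda>"

lemma measurable_step [measurable]: "step \<in> borel_measurable borel"
  unfolding step_def by measurable

sublocale T: prob_space "tilt \<theta>" by (rule prob_space_tilt) (use \<theta> in simp)

sublocale W: iid_walk "tilt \<theta>" step
  by unfold_locales (simp cong: measurable_cong_sets)

text \<open>Moments under \<open>tilt \<theta>\<close> become integrals against
  \<open>exp (- (\<theta> - 1) * y)\<close> under \<open>tilt 1\<close>, where the bounds for
  Laplace transforms apply.\<close>

lemma tilt_density: "tilt \<theta> = density (tilt 1) (\<lambda>y. ennreal (exp (- (\<theta> - 1) * y) / \<Lambda>))"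
proof (rule measure_eqI)
  fix A assume "A \<in> sets (tilt \<theta>)"
  then have A: "A \<in> sets borel" by simp
  then have A1 [measurable]: "A \<in> sets (tilt 1)" by simp
  have "emeasure (tilt \<theta>) A * ennreal \<Lambda> = (\<integral>\<^sup>+ y. ennreal (exp (- (\<theta> - 1) * y)) * indicator A y \<partial>tilt 1)"
    using nn_integral_tilt_1[of \<theta> "indicator A"] \<theta> A \<Lambda>(3) by simp
  also have "\<dots> = (\<integral>\<^sup>+ y. ennreal (exp (- (\<theta> - 1) * y) / \<Lambda>) * indicator A y * ennreal \<Lambda> \<partial>tilt 1)"
    using \<Lambda> by (intro nn_integral_cong) (auto simp: indicator_def ennreal_mult[symmetric])
  also have "\<dots> = (\<integral>\<^sup>+ y. ennreal (exp (- (\<theta> - 1) * y) / \<Lambda>) * indicator A y \<partial>tilt 1) * ennreal \<Lambda>"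
    by (rule nn_integral_multc) measurable
  also have "(\<integral>\<^sup>+ y. ennreal (exp (- (\<theta> - 1) * y) / \<Lambda>) * indicator A y \<partial>tilt 1) =
      emeasure (density (tilt 1) (\<lambda>y. ennreal (exp (- (\<theta> - 1) * y) / \<Lambda>))) A"
    by (rule emeasure_density[symmetric]) measurable
  finally show "emeasure (tilt \<theta>) A = emeasure (density (tilt 1) (\<lambda>y. ennreal (exp (- (\<theta> - 1) * y) / \<Lambda>))) A"
    using \<Lambda> by (simp add: mult_right_ennreal_cancel)
qed simp

lemma AE_tilt_nonneg: "AE y in tilt \<theta>. 0 \<le> y"
  unfolding tilt_density by (subst AE_density) (use Lap.nonneg in auto)

lemma integral_tilt:
  fixes g :: "real \<Rightarrow> real"
  assumes [measurable]: "g \<in> borel_measurable borel"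
  shows "integrable (tilt \<theta>) g \<longleftrightarrow> integrable (tilt 1) (\<lambda>y. exp (- (\<theta> - 1) * y) / \<Lambda> * g y)"
    and "integral\<^sup>L (tilt \<theta>) g = (\<integral>y. exp (- (\<theta> - 1) * y) / \<Lambda> * g y \<partial>tilt 1)"
proof -
  have m: "g \<in> borel_measurable (tilt 1)" by (simp cong: measurable_cong_sets)
  show "integrable (tilt \<theta>) g \<longleftrightarrow> integrable (tilt 1) (\<lambda>y. exp (- (\<theta> - 1) * y) / \<Lambda> * g y)"
    unfolding tilt_density using \<Lambda>(1) m by (subst integrable_density) auto
  show "integral\<^sup>L (tilt \<theta>) g = (\<integral>y. exp (- (\<theta> - 1) * y) / \<Lambda> * g y \<partial>tilt 1)"
    unfolding tilt_density using \<Lambda>(1) m by (subst integral_density) auto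
qed

lemma integrable_tilt_y: "integrable (tilt \<theta>) (\<lambda>y. y)"
  using Lap.integrable_y_exp[of "\<theta> - 1"] \<theta> \<Lambda>(1)
  by (simp add: integral_tilt mult.commute)

lemma integrable_tilt_y2: "integrable (tilt \<theta>) (\<lambda>y. y\<^sup>2)"
  using Lap.integrable_y2_exp[of "\<theta> - 1"] \<theta> \<Lambda>(1)
  by (simp add: integral_tilt mult.commute)

lemma step_AE: "AE y in tilt \<theta>. step y = \<theta> * y + ln \<Lambda>"
  using AE_tilt_nonneg by eventually_elim (simp add: step_def)

lemma integrable_step_square: "integrable (tilt \<theta>) (\<lambda>y. (step y)\<^sup>2)"
proof -
  have "integrable (tilt \<theta>) (\<lambda>y. \<theta>\<^sup>2 * y\<^sup>2 + (2 * \<theta> * ln \<Lambda>) * y + (ln \<Lambda>)\<^sup>2)"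
    using integrable_tilt_y integrable_tilt_y2 by (intro Bochner_Integration.integrable_add integrable_mult_right) auto
  then show ?thesis
  proof (rule integrable_cong_AE_imp)
    show "AE y in tilt \<theta>. \<theta>\<^sup>2 * y\<^sup>2 + (2 * \<theta> * ln \<Lambda>) * y + (ln \<Lambda>)\<^sup>2 = (step y)\<^sup>2"
      using step_AE by eventually_elim (simp add: power2_eq_square algebra_simps)
  qed measurable
qed

text \<open>This is why \<open>phi\<close> governs the problem: the drift of the walk is \<theta>
  times the tilted mean plus \<open>ln \<Lambda>\<close>.\<close>

lemma expectation_step: "T.expectation step = phi \<nu> \<theta>"
proof -
  have "T.expectation step = T.expectation (\<lambda>y. \<theta> * y + ln \<Lambda>)"
    by (intro integral_cong_AE step_AE) measurable
  also have "\<dots> = \<theta> * T.expectation (\<lambda>y. y) + ln \<Lambda>"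
    using integrable_tilt_y by (simp add: T.prob_space[simplified])
  also have "T.expectation (\<lambda>y. y) = Lap.G1 (\<theta> - 1) / \<Lambda>"
    by (simp add: integral_tilt Lap.G1_def mult.commute)
  also have "\<theta> * (Lap.G1 (\<theta> - 1) / \<Lambda>) + ln \<Lambda> = phi \<nu> \<theta>"
    using \<theta> by (simp add: phi_eq Lreal_eq_G)
  finally show ?thesis .
qed

lemma variance_step_pos: "T.variance step > 0"
proof -
  let ?m = "T.expectation step"
  have i: "integrable (tilt \<theta>) (\<lambda>y. (step y - ?m)\<^sup>2)"
    using T.square_integrable_imp_integrable[OF _ integrable_step_square] integrable_step_square
    by (simp add: power2_diff)
  have "T.variance step \<noteq> 0"
  proof
    assume "T.variance step = 0"
    then have "AE y in tilt \<theta>. (step y - ?m)\<^sup>2 = 0"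
      by (subst (asm) integral_nonneg_eq_0_iff_AE[OF i]) auto
    then have "AE y in tilt \<theta>. y = (?m - ln \<Lambda>) / \<theta>"
      using step_AE by eventually_elim (use \<theta> in \<open>simp add: field_simps\<close>)
    then show False using tilt_not_const[of \<theta>] \<theta> by simp
  qed
  moreover have "T.variance step \<ge> 0" by (intro Bochner_Integration.integral_nonneg) auto
  ultimately show ?thesis by linarith
qed

text \<open>Exponential Markov inequality at the rate \<open>(\<theta> - 1) / \<theta>\<close>: in
  terms of the displacement this is \<open>exp ((\<theta> - 1) * y)\<close>, which cancels the
  density of \<open>tilt \<theta>\<close> with respect to \<open>tilt 1\<close> up to the constant
  \<open>1 / \<Lambda>\<close>.\<close>

lemma step_tail:
  "T.prob {y \<in> space (tilt \<theta>). step y > b} \<le> (exp ((\<theta> - 1) / \<theta> * ln \<Lambda>) / \<Lambda>) * exp (- ((\<theta> - 1) / \<theta>) * b)"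
proof -
  define \<epsilon> where "\<epsilon> = (\<theta> - 1) / \<theta>"
  have \<epsilon>: "\<epsilon> > 0" "\<epsilon> * \<theta> = \<theta> - 1" using \<theta> by (auto simp: \<epsilon>_def)
  have "emeasure (tilt \<theta>) {y \<in> space (tilt \<theta>). step y > b} = (\<integral>\<^sup>+ y. indicator {y. step y > b} y \<partial>tilt \<theta>)"
    by simp
  also have "\<dots> \<le> (\<integral>\<^sup>+ y. ennreal (exp (\<epsilon> * (ln \<Lambda> - b)) * exp ((\<theta> - 1) * y)) \<partial>tilt \<theta>)"
  proof (rule nn_integral_mono_AE)
    show "AE y in tilt \<theta>. indicator {y. step y > b} y \<le> ennreal (exp (\<epsilon> * (ln \<Lambda> - b)) * exp ((\<theta> - 1) * y))"
      using step_AE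
    proof eventually_elim
      case (elim y)
      have "\<epsilon> * (ln \<Lambda> - b) + (\<theta> - 1) * y = \<epsilon> * (step y - b)"
        unfolding elim \<epsilon>(2)[symmetric] by (simp add: algebra_simps)
      then have "exp (\<epsilon> * (ln \<Lambda> - b)) * exp ((\<theta> - 1) * y) = exp (\<epsilon> * (step y - b))"
        by (simp only: exp_add[symmetric])
      then show ?case using \<epsilon>(1) by (auto simp: indicator_def)
    qed
  qed
  also have "\<dots> = ennreal (exp (\<epsilon> * (ln \<Lambda> - b))) * (\<integral>\<^sup>+ y. ennreal (exp ((\<theta> - 1) * y)) \<partial>tilt \<theta>)"
    by (subst nn_integral_cmult[symmetric]) (auto simp: ennreal_mult cong: measurable_cong_sets)
  also have "(\<integral>\<^sup>+ y. ennreal (exp ((\<theta> - 1) * y)) \<partial>tilt \<theta>) = (\<integral>\<^sup>+ y. ennreal (exp (- (\<theta> - 1) * y) / \<Lambda>) * ennreal (exp ((\<theta> - 1) * y)) \<partial>tilt 1)"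
    unfolding tilt_density by (subst nn_integral_density) (auto cong: measurable_cong_sets)
  also have "\<dots> = (\<integral>\<^sup>+ y. ennreal (1 / \<Lambda>) \<partial>tilt 1)"
  proof (rule nn_integral_cong)
    fix y
    have "exp (- (\<theta> - 1) * y) / \<Lambda> * exp ((\<theta> - 1) * y) = exp (- (\<theta> - 1) * y + (\<theta> - 1) * y) / \<Lambda>"
      by (simp only: exp_add times_divide_eq_left)
    also have "- (\<theta> - 1) * y + (\<theta> - 1) * y = 0" by (simp only: minus_mult_left[symmetric] left_minus)
    finally show "ennreal (exp (- (\<theta> - 1) * y) / \<Lambda>) * ennreal (exp ((\<theta> - 1) * y)) = ennreal (1 / \<Lambda>)"
      using \<Lambda>(1) by (simp add: ennreal_mult[symmetric])
  qed
  also have "\<dots> = ennreal (1 / \<Lambda>)" using Lap.emeasure_space_1 by simp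
  finally have "emeasure (tilt \<theta>) {y \<in> space (tilt \<theta>). step y > b} \<le> ennreal (exp (\<epsilon> * (ln \<Lambda> - b)) * (1 / \<Lambda>))"
    using \<Lambda>(1) by (simp add: ennreal_mult[symmetric])
  then have "T.prob {y \<in> space (tilt \<theta>). step y > b} \<le> exp (\<epsilon> * (ln \<Lambda> - b)) * (1 / \<Lambda>)"
    using \<Lambda>(1) by (simp add: T.emeasure_eq_measure)
  also have "\<dots> = (exp (\<epsilon> * ln \<Lambda>) / \<Lambda>) * exp (- \<epsilon> * b)"
    by (simp add: exp_add[symmetric] algebra_simps)
  finally show ?thesis by (simp only: \<epsilon>_def)
qed

text \<open>\<open>R\<close> is a switch for the upper bound on the endpoint, available only without
  drift. If it is on, the zero-drift estimate is used; otherwise the barrier at 0, which is stronger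
  than the one at \<open>- ln k\<close>.\<close>

lemma prob_barrier:
  assumes phi: "phi \<nu> \<theta> \<ge> 0" and R: "R \<Longrightarrow> phi \<nu> \<theta> = 0"
  shows "\<exists>K>0. eventually (\<lambda>k. W.W.prob {\<omega> \<in> space W.\<Omega>. (\<forall>m\<le>k. - (K * ln (real k)) \<le> W.walk m \<omega>) \<and>
    (R \<longrightarrow> W.walk k \<omega> \<le> K * ln (real k))} \<ge> 1 / real k ^ 3) sequentially"
proof (cases R)
  case True
  have "\<exists>K>0. eventually (\<lambda>k. W.W.prob {\<omega> \<in> space W.\<Omega>. (\<forall>m\<le>k. - (K * ln (real k)) \<le> W.walk m \<omega>) \<and>
    W.walk k \<omega> \<le> K * ln (real k)} \<ge> 1 / real k ^ 3) sequentially"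
  proof (rule W.prob_barrier_zero_drift[OF integrable_step_square _ variance_step_pos _ step_tail])
    show "T.expectation step = 0" using R True expectation_step by simp
    show "step y \<ge> - (- ln \<Lambda>)" for y using \<theta> by (simp add: step_def)
    show "(\<theta> - 1) / \<theta> > 0" using \<theta> by simp
  qed
  then show ?thesis using True by simp
next
  case False
  have "eventually (\<lambda>k. W.W.prob {\<omega> \<in> space W.\<Omega>. \<forall>m\<le>k. 0 \<le> W.walk m \<omega>} \<ge> 1 / real k ^ 2) sequentially"
    using phi by (intro W.prob_barrier_nonneg_drift integrable_step_square variance_step_pos) (simp add: expectation_step)
  then have "eventually (\<lambda>k. W.W.prob {\<omega> \<in> space W.\<Omega>. \<forall>m\<le>k. - (1 * ln (real k)) \<le> W.walk m \<omega>} \<ge> 1 / real k ^ 3) sequentially"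
    using eventually_ge_at_top[of 1]
  proof eventually_elim
    case (elim k)
    have "real k ^ 2 * 1 \<le> real k ^ 2 * real k" using elim by (intro mult_left_mono) auto
    then have "1 / real k ^ 3 \<le> 1 / real k ^ 2"
      using elim by (intro divide_left_mono) (auto simp: power3_eq_cube power2_eq_square)
    also have "\<dots> \<le> W.W.prob {\<omega> \<in> space W.\<Omega>. \<forall>m\<le>k. 0 \<le> W.walk m \<omega>}" by (rule elim)
    also have "\<dots> \<le> W.W.prob {\<omega> \<in> space W.\<Omega>. \<forall>m\<le>k. - (1 * ln (real k)) \<le> W.walk m \<omega>}"
    proof (rule W.W.finite_measure_mono)
      have "0 \<le> ln (real k)" using elim by simp
      then show "{\<omega> \<in> space W.\<Omega>. \<forall>m\<le>k. 0 \<le> W.walk m \<omega>} \<subseteq> {\<omega> \<in> space W.\<Omega>. \<forall>m\<le>k. - (1 * ln (real k)) \<le> W.walk m \<omega>}"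
        by force
    qed measurable
    finally show ?case .
  qed
  then show ?thesis using False by (intro exI[of _ 1]) simp
qed

text \<open>Terms of the additive martingale: their sum over a generation has mean 1, and for a box
  of positive size the weight is \<open>exp (- walk)\<close>.\<close>

definition weight :: "(nat list \<Rightarrow> nat measure) \<Rightarrow> nat list \<Rightarrow> real" where
  "weight e i = bsize e i powr \<theta> / \<Lambda> ^ length i"

lemma weight_nonneg: "0 \<le> weight e i"
  using \<Lambda>(1) by (simp add: weight_def)

lemma measurable_weight [measurable]: "(\<lambda>e. weight e i) \<in> borel_measurable E"
  unfolding weight_def by measurable

lemma weight_eq:
  assumes e: "e \<in> space E" and pos: "bsize e i > 0"
  shows "weight e i = exp (- W.walk (length i) (incs e i))"
proof -
  have "W.walk (length i) (incs e i) = \<theta> * (\<Sum>m<length i. incs e i m) + real (length i) * ln \<Lambda>"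
    unfolding W.walk_def step_def using incs_nonneg[OF e, of i]
    by (simp add: max_absorb2 sum.distrib sum_distrib_left)
  also have "\<dots> = - \<theta> * ln (bsize e i) + real (length i) * ln \<Lambda>"
    unfolding ln_bsize[OF pos, symmetric] by simp
  finally have "exp (- W.walk (length i) (incs e i)) = exp (\<theta> * ln (bsize e i)) * exp (- (real (length i) * ln \<Lambda>))"
    unfolding exp_add[symmetric] by simp
  also have "exp (- (real (length i) * ln \<Lambda>)) = 1 / \<Lambda> ^ length i"
    using \<Lambda>(1) by (simp add: exp_minus exp_of_nat_mult inverse_eq_divide)
  finally show ?thesis using pos by (simp add: weight_def powr_def)
qed

definition barrier :: "real \<Rightarrow> (nat list \<Rightarrow> nat measure) \<Rightarrow> nat list \<Rightarrow> bool" where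
  "barrier B e i \<longleftrightarrow> (\<forall>m\<le>length i. - B \<le> W.walk m (incs e i))"

lemma measurable_walk_borel [measurable]: "W.walk m \<in> borel_measurable (PiM UNIV (\<lambda>_. borel))"
  unfolding W.walk_def by measurable

lemma measurable_walk_incs [measurable]: "(\<lambda>e. W.walk m (incs e i)) \<in> borel_measurable E"
  by (rule measurable_compose[OF measurable_incs measurable_walk_borel])

lemma measurable_barrier [measurable]: "Measurable.pred E (\<lambda>e. barrier B e i)"
  unfolding barrier_def by measurable

lemma barrier_Cons: "barrier B e (c # i) \<Longrightarrow> barrier B e i"
  unfolding barrier_def W.walk_def
proof (intro allI impI)
  fix m assume *: "\<forall>m\<le>length (c # i). - B \<le> (\<Sum>m<m. step (incs e (c # i) m))" and m: "m \<le> length i"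
  have "(\<Sum>m<m. step (incs e (c # i) m)) = (\<Sum>m<m. step (incs e i m))"
    using m by (intro sum.cong) auto
  then show "- B \<le> (\<Sum>m<m. step (incs e i m))" using * m by (metis le_SucI length_Cons)
qed

text \<open>The barrier is imposed on the whole ancestral line, but the upper bound on the endpoint
  is not: only the barrier from below is inherited by ancestors, as the recursion over generations
  needs.\<close>

definition bweight :: "real \<Rightarrow> (nat list \<Rightarrow> nat measure) \<Rightarrow> nat list \<Rightarrow> ennreal" where
  "bweight B e i = (if barrier B e i then ennreal (weight e i) else 0)"

lemma measurable_bweight [measurable]: "(\<lambda>e. bweight B e i) \<in> borel_measurable E"
  unfolding bweight_def by measurable

lemma depends_on_bweight: "depends_on {u. length u < length i} (\<lambda>e. bweight B e i)"
proof -
  have "bweight B e i = (\<lambda>b f. if \<forall>m\<le>length i. - B \<le> W.walk m f then ennreal (b powr \<theta> / \<Lambda> ^ length i) else 0) (bsize e i) (incs e i)" for e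
    by (simp only: bweight_def barrier_def weight_def)
  then show ?thesis
    using depends_on_comp2[OF depends_on_bsize[of i "length i"] depends_on_incs[of i "length i"],
        of "\<lambda>b f. if \<forall>m\<le>length i. - B \<le> W.walk m f then ennreal (b powr \<theta> / \<Lambda> ^ length i) else 0"]
    by simp
qed

text \<open>The reason for the barrier: a weight is \<open>exp (- walk)\<close> and the walk ends
  above \<open>- B\<close>. Boxes of size 0 have weight 0.\<close>

lemma bweight_le: "e \<in> space E \<Longrightarrow> bweight B e i \<le> ennreal (exp B)"
proof (cases "barrier B e i \<and> bsize e i > 0")
  case True
  assume e: "e \<in> space E"
  have "- B \<le> W.walk (length i) (incs e i)" using True by (simp add: barrier_def)
  then show ?thesis using True weight_eq[OF e] by (simp add: bweight_def)
next
  case False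
  then have "bweight B e i = 0"
    using bsize_nonneg[of e i] by (auto simp: bweight_def weight_def)
  then show ?thesis by simp
qed

text \<open>Ratio of the total weight of the children of a box to its own weight; it has mean 1 and
  is at most \<open>1 / \<Lambda>\<close>.\<close>

definition ysum :: "nat measure \<Rightarrow> ennreal" where
  "ysum p = (\<Sum>c. ennreal (mass p c powr \<theta> / \<Lambda>))"

lemma measurable_ysum [measurable]: "ysum \<in> borel_measurable \<nu>"
  unfolding ysum_def by measurable

lemma ysum_eq: "ysum p = ennreal (1 / \<Lambda>) * (\<Sum>c. ennreal (mass p c powr \<theta>))"
  unfolding ysum_def using \<Lambda>(1)
  by (simp only: ennreal_suminf_cmult[symmetric]) (simp add: ennreal_mult[symmetric])

lemma ysum_le: "p \<in> space \<nu> \<Longrightarrow> ysum p \<le> ennreal (1 / \<Lambda>)"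
  unfolding ysum_eq using suminf_powr_le_1[of p \<theta>] \<theta>
  by (metis less_imp_le mult.right_neutral mult_left_mono zero_le)

lemma nn_integral_ysum: "(\<integral>\<^sup>+ p. ysum p \<partial>\<nu>) = 1"
proof -
  have "(\<integral>\<^sup>+ p. ysum p \<partial>\<nu>) = ennreal (1 / \<Lambda>) * Lfun \<nu> \<theta>"
    unfolding ysum_eq Lfun_def by (rule nn_integral_cmult) measurable
  also have "\<dots> = 1" using \<Lambda> by (simp add: ennreal_mult[symmetric])
  finally show ?thesis .
qed

text \<open>The barrier condition at the newest generation is dropped, which only increases the sum
  and leaves a factor that is independent of the past.\<close>

lemma gsum_bweight_Suc: "gsum (Suc k) (bweight B e) \<le> gsum k (\<lambda>i. bweight B e i * ysum (e i))"
  unfolding gsum_Suc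
proof (rule gsum_mono)
  fix i :: "nat list"
  have "bweight B e (c # i) \<le> bweight B e i * ennreal (mass (e i) c powr \<theta> / \<Lambda>)" for c
  proof (cases "barrier B e (c # i)")
    case True
    then have "bweight B e (c # i) = ennreal (weight e i * (mass (e i) c powr \<theta> / \<Lambda>))"
      by (simp add: bweight_def weight_def powr_mult mult.commute)
    also have "\<dots> = ennreal (weight e i) * ennreal (mass (e i) c powr \<theta> / \<Lambda>)"
      using \<Lambda>(1) by (intro ennreal_mult weight_nonneg) auto
    finally show ?thesis using barrier_Cons[OF True] by (simp add: bweight_def)
  qed (simp add: bweight_def)
  then have "(\<Sum>c. bweight B e (c # i)) \<le> (\<Sum>c. bweight B e i * ennreal (mass (e i) c powr \<theta> / \<Lambda>))"
    by (intro suminf_le) auto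
  also have "\<dots> = bweight B e i * ysum (e i)"
    unfolding ysum_def by (rule ennreal_suminf_cmult)
  finally show "(\<Sum>c. bweight B e (c # i)) \<le> bweight B e i * ysum (e i)" .
qed

lemma nn_integral_gsum_bweight_le: "(\<integral>\<^sup>+ e. gsum k (bweight B e) \<partial>E) \<le> 1"
proof -
  have "(\<integral>\<^sup>+ e. gsum k (bweight B e) \<partial>E) \<le> (\<integral>\<^sup>+ e. ennreal (1 / \<Lambda> ^ k) * S \<theta> k e \<partial>E)"
  proof (rule nn_integral_mono)
    fix e
    have "gsum k (bweight B e) \<le> gsum k (\<lambda>i. ennreal (1 / \<Lambda> ^ k) * ennreal (bsize e i powr \<theta>))"
      using \<Lambda>(1) by (intro gsum_mono) (auto simp: bweight_def weight_def ennreal_mult[symmetric])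
    then show "gsum k (bweight B e) \<le> ennreal (1 / \<Lambda> ^ k) * S \<theta> k e"
      by (simp only: gsum_cmult S_def)
  qed
  also have "\<dots> = ennreal (1 / \<Lambda> ^ k) * Lfun \<nu> \<theta> ^ k"
    using \<theta> by (subst nn_integral_cmult) (auto simp: nn_integral_S)
  also have "\<dots> = 1" using \<Lambda> by (simp add: ennreal_power ennreal_mult[symmetric])
  finally show ?thesis by simp
qed

text \<open>Distinct boxes of a generation have independent splits of mean factor 1, so off the
  diagonal nothing is lost. On the diagonal one of the two equal weights is bounded by
  \<open>exp B\<close> and both factors by \<open>1 / \<Lambda>\<close>.\<close>

lemma cross_term_le:
  assumes "length i = k" "length i' = k"
  shows "(\<integral>\<^sup>+ e. (bweight B e i * ysum (e i)) * (bweight B e i' * ysum (e i')) \<partial>E) \<le>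
    (\<integral>\<^sup>+ e. bweight B e i * bweight B e i' \<partial>E) +
    (if i = i' then ennreal (exp B / \<Lambda>\<^sup>2) * (\<integral>\<^sup>+ e. bweight B e i \<partial>E) else 0)"
proof (cases "i = i'")
  case True
  have "(\<integral>\<^sup>+ e. (bweight B e i * ysum (e i)) * (bweight B e i * ysum (e i)) \<partial>E)
    \<le> (\<integral>\<^sup>+ e. ennreal (exp B / \<Lambda>\<^sup>2) * bweight B e i \<partial>E)"
  proof (rule nn_integral_mono)
    fix e assume e: "e \<in> space E"
    have "(bweight B e i * ysum (e i)) * (bweight B e i * ysum (e i)) \<le>
      (bweight B e i * ennreal (1 / \<Lambda>)) * (ennreal (exp B) * ennreal (1 / \<Lambda>))"
      by (intro mult_mono order_refl bweight_le ysum_le space_E e) auto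
    also have "\<dots> = ennreal (exp B / \<Lambda>\<^sup>2) * bweight B e i"
    proof -
      have "ennreal (1 / \<Lambda>) * (ennreal (exp B) * ennreal (1 / \<Lambda>)) = ennreal (exp B / \<Lambda>\<^sup>2)"
        using \<Lambda>(1) by (simp add: ennreal_mult[symmetric] power2_eq_square)
      moreover have "(bweight B e i * ennreal (1 / \<Lambda>)) * (ennreal (exp B) * ennreal (1 / \<Lambda>)) =
          (ennreal (1 / \<Lambda>) * (ennreal (exp B) * ennreal (1 / \<Lambda>))) * bweight B e i"
        by (simp only: mult_ac)
      ultimately show ?thesis by (simp only:)
    qed
    finally show "(bweight B e i * ysum (e i)) * (bweight B e i * ysum (e i)) \<le> ennreal (exp B / \<Lambda>\<^sup>2) * bweight B e i" .
  qed
  also have "\<dots> = ennreal (exp B / \<Lambda>\<^sup>2) * (\<integral>\<^sup>+ e. bweight B e i \<partial>E)"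
    by (rule nn_integral_cmult) measurable
  finally show ?thesis using True by (simp add: add_increasing)
next
  case False
  let ?a = "\<lambda>e. bweight B e i * bweight B e i'"
  have da: "depends_on {u. length u < k} ?a"
    by (rule depends_on_comp2[where h="(*)", OF depends_on_bweight[of i B, unfolded assms(1)] depends_on_bweight[of i' B, unfolded assms(2)]])
  have dy: "depends_on {i} (\<lambda>e. ysum (e i))" for i by (intro depends_onI) auto
  have [measurable]: "(\<lambda>e. ysum (e i)) \<in> borel_measurable E" for i by measurable
  have "(\<integral>\<^sup>+ e. (bweight B e i * ysum (e i)) * (bweight B e i' * ysum (e i')) \<partial>E)
    = (\<integral>\<^sup>+ e. (?a e * ysum (e i)) * ysum (e i') \<partial>E)"
    by (intro nn_integral_cong) (simp only: mult_ac)
  also have "\<dots> = (\<integral>\<^sup>+ e. ?a e * ysum (e i) \<partial>E) * (\<integral>\<^sup>+ e. ysum (e i') \<partial>E)"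
  proof (rule nn_integral_PiM_mult[where K="{u. length u < k} \<union> {i}" and J="{i'}"])
    show "depends_on ({u. length u < k} \<union> {i}) (\<lambda>e. ?a e * ysum (e i))"
      by (rule depends_on_comp2[where h="(*)", OF depends_on_subset[OF da] depends_on_subset[OF dy[of i]]]) auto
    show "({u. length u < k} \<union> {i}) \<inter> {i'} = {}" using assms False by auto
  qed (use dy in auto)
  also have "(\<integral>\<^sup>+ e. ?a e * ysum (e i) \<partial>E) = (\<integral>\<^sup>+ e. ?a e \<partial>E) * (\<integral>\<^sup>+ e. ysum (e i) \<partial>E)"
    by (rule nn_integral_PiM_mult[where K="{u. length u < k}" and J="{i}"]) (use da dy assms in auto)
  finally show ?thesis by (simp add: nn_integral_coordinate nn_integral_ysum)
qed

lemma gsum_square: "(gsum k f)\<^sup>2 = gsum k (\<lambda>i. gsum k (\<lambda>i'. f i * f i'))"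
  by (simp add: gsum_cmult gsum_multc power2_eq_square)

lemma gsum_diag: "gsum k (\<lambda>i'. if i = i' then f i' else 0) \<le> f i"
proof -
  have "gsum k (\<lambda>i'. if i = i' then f i' else 0) \<le> (\<integral>\<^sup>+ i'. f i' * indicator {i} i' \<partial>count_space UNIV)"
    unfolding gsum_def
    by (subst nn_integral_count_space_indicator) (auto intro!: nn_integral_mono simp: indicator_def)
  also have "\<dots> = f i" by (subst nn_integral_indicator_finite) auto
  finally show ?thesis .
qed

text \<open>The cross terms reproduce the previous second moment, and the diagonal adds at most
  \<open>exp B / \<Lambda>\<^sup>2\<close> times a first moment at most 1: growth is linear in
  \<open>k\<close>. The term \<open>exp (2 * B)\<close> covers generation 0.\<close>

lemma second_moment:
  "(\<integral>\<^sup>+ e. (gsum k (bweight B e))\<^sup>2 \<partial>E) \<le> ennreal (exp (2 * B) + real k * (exp B / \<Lambda>\<^sup>2))"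
proof (induction k)
  case 0
  have "(\<integral>\<^sup>+ e. (gsum 0 (bweight B e))\<^sup>2 \<partial>E) \<le> (\<integral>\<^sup>+ e. (ennreal (exp B))\<^sup>2 \<partial>E)"
    by (intro nn_integral_mono) (simp add: power_mono bweight_le)
  also have "\<dots> = ennreal (exp (2 * B))"
    using E.emeasure_space_1 by (simp add: ennreal_power exp_double)
  finally show ?case by simp
next
  case (Suc k)
  have [measurable]: "(\<lambda>e. ysum (e i)) \<in> borel_measurable E" for i by measurable
  have "(\<integral>\<^sup>+ e. (gsum (Suc k) (bweight B e))\<^sup>2 \<partial>E) \<le> (\<integral>\<^sup>+ e. (gsum k (\<lambda>i. bweight B e i * ysum (e i)))\<^sup>2 \<partial>E)"
    by (intro nn_integral_mono power_mono gsum_bweight_Suc) auto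
  also have "\<dots> = gsum k (\<lambda>i. gsum k (\<lambda>i'. \<integral>\<^sup>+ e. (bweight B e i * ysum (e i)) * (bweight B e i' * ysum (e i')) \<partial>E))"
    unfolding gsum_square by (subst nn_integral_gsum, measurable) (intro gsum_cong nn_integral_gsum, measurable)
  also have "\<dots> \<le> gsum k (\<lambda>i. gsum k (\<lambda>i'. (\<integral>\<^sup>+ e. bweight B e i * bweight B e i' \<partial>E) +
     (if i = i' then ennreal (exp B / \<Lambda>\<^sup>2) * (\<integral>\<^sup>+ e. bweight B e i' \<partial>E) else 0)))"
  proof (intro gsum_mono)
    fix i i' :: "nat list" assume "length i = k" "length i' = k"
    from cross_term_le[OF this, of B]
    show "(\<integral>\<^sup>+ e. (bweight B e i * ysum (e i)) * (bweight B e i' * ysum (e i')) \<partial>E) \<le>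
      (\<integral>\<^sup>+ e. bweight B e i * bweight B e i' \<partial>E) +
      (if i = i' then ennreal (exp B / \<Lambda>\<^sup>2) * (\<integral>\<^sup>+ e. bweight B e i' \<partial>E) else 0)"
      by (cases "i = i'") auto
  qed
  also have "\<dots> \<le> gsum k (\<lambda>i. gsum k (\<lambda>i'. \<integral>\<^sup>+ e. bweight B e i * bweight B e i' \<partial>E) +
     ennreal (exp B / \<Lambda>\<^sup>2) * (\<integral>\<^sup>+ e. bweight B e i \<partial>E))"
    unfolding gsum_plus[of k "\<lambda>i'. \<integral>\<^sup>+ e. bweight B e _ * bweight B e i' \<partial>E"]
    by (intro gsum_mono add_mono order_refl gsum_diag)
  also have "\<dots> = gsum k (\<lambda>i. gsum k (\<lambda>i'. \<integral>\<^sup>+ e. bweight B e i * bweight B e i' \<partial>E)) +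
     ennreal (exp B / \<Lambda>\<^sup>2) * gsum k (\<lambda>i. \<integral>\<^sup>+ e. bweight B e i \<partial>E)"
    by (simp only: gsum_plus gsum_cmult)
  also have "gsum k (\<lambda>i. gsum k (\<lambda>i'. \<integral>\<^sup>+ e. bweight B e i * bweight B e i' \<partial>E)) = (\<integral>\<^sup>+ e. (gsum k (bweight B e))\<^sup>2 \<partial>E)"
    unfolding gsum_square by (subst nn_integral_gsum, measurable) (intro gsum_cong nn_integral_gsum[symmetric], measurable)
  also have "gsum k (\<lambda>i. \<integral>\<^sup>+ e. bweight B e i \<partial>E) = (\<integral>\<^sup>+ e. gsum k (bweight B e) \<partial>E)"
    by (rule nn_integral_gsum[symmetric]) measurable
  also have "(\<integral>\<^sup>+ e. (gsum k (bweight B e))\<^sup>2 \<partial>E) + ennreal (exp B / \<Lambda>\<^sup>2) * (\<integral>\<^sup>+ e. gsum k (bweight B e) \<partial>E)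
     \<le> ennreal (exp (2 * B) + real k * (exp B / \<Lambda>\<^sup>2)) + ennreal (exp B / \<Lambda>\<^sup>2) * 1"
    by (intro add_mono mult_left_mono Suc nn_integral_gsum_bweight_le) auto
  also have "\<dots> = ennreal (exp (2 * B) + real (Suc k) * (exp B / \<Lambda>\<^sup>2))"
    by (simp add: ennreal_plus[symmetric] algebra_simps add_divide_distrib del: ennreal_plus)
  finally show ?case .
qed

text \<open>From \<theta> to \<open>J\<close>: with \<open>V\<close> the walk at time
  \<open>k\<close>, a box of size \<open>p\<close> satisfies
  \<open>p powr J = (\<Lambda> ^ k * exp (- V)) powr (J / \<theta>)\<close>, that is, its weight
  times \<open>exp (- V * (J / \<theta> - 1))\<close> and a deterministic factor. For
  \<open>J > \<theta>\<close> the upper bound on \<open>V\<close> keeps this from being too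
  small.\<close>

lemma S_ge_weighted:
  assumes e: "e \<in> space E" and J: "\<theta> \<le> J" and B: "0 \<le> B" and R: "\<theta> \<noteq> J \<Longrightarrow> R"
  shows "ennreal (\<Lambda> powr (J * real k / \<theta>) * exp (- (B * (J / \<theta> - 1)))) *
      gsum k (\<lambda>i. ennreal (weight e i) * (if (\<forall>m\<le>k. - B \<le> W.walk m (incs e i)) \<and> (R \<longrightarrow> W.walk k (incs e i) \<le> B) then 1 else 0))
    \<le> S J k e"
  unfolding S_def gsum_cmult[symmetric]
proof (rule gsum_mono)
  fix i :: "nat list" assume i: "length i = k"
  let ?V = "W.walk k (incs e i)" and ?c = "\<Lambda> powr (J * real k / \<theta>) * exp (- (B * (J / \<theta> - 1)))"
  have c0: "0 \<le> ?c" by simp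
  show "ennreal ?c * (ennreal (weight e i) * (if (\<forall>m\<le>k. - B \<le> W.walk m (incs e i)) \<and> (R \<longrightarrow> ?V \<le> B) then 1 else 0))
    \<le> ennreal (bsize e i powr J)"
  proof (cases "bsize e i > 0 \<and> (R \<longrightarrow> ?V \<le> B)")
    case True
    then have w: "weight e i = exp (- ?V)" using weight_eq[OF e] i by simp
    have "bsize e i powr \<theta> = \<Lambda> ^ k * exp (- ?V)"
      using w \<Lambda>(1) i by (simp add: weight_def field_simps)
    then have "bsize e i powr J = (\<Lambda> ^ k * exp (- ?V)) powr (J / \<theta>)"
      using powr_powr[of "bsize e i" \<theta> "J / \<theta>"] \<theta> by simp
    also have "\<dots> = \<Lambda> powr (J * real k / \<theta>) * exp (- ?V * (J / \<theta>))"
      using \<Lambda>(1) by (simp add: powr_mult powr_powr exp_powr_real mult.commute flip: powr_realpow)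
    also have "exp (- ?V * (J / \<theta>)) = exp (- (?V * (J / \<theta> - 1))) * exp (- ?V)"
      by (simp add: exp_add[symmetric] algebra_simps)
    finally have b: "bsize e i powr J = \<Lambda> powr (J * real k / \<theta>) * (exp (- (?V * (J / \<theta> - 1))) * exp (- ?V))" .
    have "?V * (J / \<theta> - 1) \<le> B * (J / \<theta> - 1)"
    proof (cases "\<theta> = J")
      case False
      then show ?thesis using R True J \<theta> by (intro mult_right_mono) auto
    qed (use \<theta> in auto)
    then have "?c * weight e i \<le> bsize e i powr J"
      unfolding b w mult.assoc by (intro mult_left_mono mult_right_mono) auto
    then have "ennreal ?c * ennreal (weight e i) \<le> ennreal (bsize e i powr J)"
      using weight_nonneg c0 by (simp add: ennreal_mult[symmetric] ennreal_leI)
    then show ?thesis by auto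
  next
    case False
    then have "weight e i = 0 \<or> \<not> (R \<longrightarrow> ?V \<le> B)"
      using bsize_nonneg[of e i] by (auto simp: weight_def)
    then show ?thesis by auto
  qed
qed

text \<open>Paley--Zygmund for the weights on the barrier event: the first moment is at least
  \<open>1 / k ^ 3\<close> by the many-to-one formula, and the second is bounded by a power of
  \<open>k\<close> because \<open>exp B\<close> is one.\<close>

lemma prob_S_lower:
  assumes phi: "phi \<nu> \<theta> \<ge> 0" and J: "\<theta> \<le> J" and \<theta>J: "\<theta> = J \<or> phi \<nu> \<theta> = 0"
  shows "\<exists>K>0. eventually (\<lambda>k. E.prob {e \<in> space E. ennreal (real k powr - K * \<Lambda> powr (J * real k / \<theta>)) \<le> S J k e}
    \<ge> real k powr - K) sequentially"
proof -
  define R where "R \<longleftrightarrow> \<theta> \<noteq> J"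
  obtain K where K: "K > 0" and ev: "eventually (\<lambda>k. W.W.prob {\<omega> \<in> space W.\<Omega>. (\<forall>m\<le>k. - (K * ln (real k)) \<le> W.walk m \<omega>) \<and>
    (R \<longrightarrow> W.walk k \<omega> \<le> K * ln (real k))} \<ge> 1 / real k ^ 3) sequentially"
    using prob_barrier[OF phi, of R] \<theta>J by (auto simp: R_def)
  \<comment> \<open>\<open>2 * K\<close> comes from the second moment and
    \<open>K * (J / \<theta> - 1)\<close> from the change of exponent. The 8 is 6 for the squared
    first moment, 1 for the number of generations in the second moment and 1 for constants.\<close>
  define K' where "K' = 2 * K + K * (J / \<theta> - 1) + 8"
  have J1: "J / \<theta> - 1 \<ge> 0" using J \<theta> by simp
  have KJ: "K * (J / \<theta> - 1) \<ge> 0" using J1 K by simp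
  have K': "K' > 0" using KJ K by (simp add: K'_def)
  obtain k1 :: nat where k1: "4 * (1 + 1 / \<Lambda>\<^sup>2) \<le> real k1" using real_arch_simple by blast
  have "eventually (\<lambda>k. E.prob {e \<in> space E. ennreal (real k powr - K' * \<Lambda> powr (J * real k / \<theta>)) \<le> S J k e}
    \<ge> real k powr - K') sequentially"
    using ev eventually_ge_at_top[of "max 2 k1"]
  proof eventually_elim
    case (elim k)
    have k: "real k \<ge> 2" "real k \<ge> 1" "4 * (1 + 1 / \<Lambda>\<^sup>2) \<le> real k" using elim k1 by auto
    define B where "B = K * ln (real k)"
    have B: "B \<ge> 0" using K k by (simp add: B_def)
    have eB: "exp (x * B) = real k powr (K * x)" for x
      using k by (simp add: B_def powr_def mult_ac)
    let ?Q = "\<lambda>\<omega>. (\<forall>m\<le>k. - B \<le> W.walk m \<omega>) \<and> (R \<longrightarrow> W.walk k \<omega> \<le> B)"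
    define h :: "(nat \<Rightarrow> real) \<Rightarrow> ennreal" where "h \<omega> = (if ?Q \<omega> then 1 else 0)" for \<omega>
    have hm [measurable]: "h \<in> borel_measurable (PiM UNIV (\<lambda>_. borel))"
      unfolding h_def by measurable
    have hd: "depends_on {..<k} h"
    proof (rule depends_onI)
      fix x y :: "nat \<Rightarrow> real" assume "\<And>i. i \<in> {..<k} \<Longrightarrow> x i = y i"
      then have "W.walk m x = W.walk m y" if "m \<le> k" for m
        using that by (auto simp: W.walk_def intro!: sum.cong)
      then show "h x = h y" by (simp add: h_def)
    qed
    define Z where "Z e = gsum k (\<lambda>i. ennreal (weight e i) * h (incs e i))" for e
    have [measurable]: "(\<lambda>e. h (incs e i)) \<in> borel_measurable E" for i by measurable
    have Zm [measurable]: "Z \<in> borel_measurable E" unfolding Z_def by measurable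
    define p where "p = 1 / real k ^ 3"
    define m where "m = exp (2 * B) + real k * (exp B / \<Lambda>\<^sup>2)"
    have p: "p > 0" using k by (simp add: p_def)
    have m: "m > 0" using k \<Lambda>(1) by (simp add: m_def add_pos_nonneg)
    have "(\<integral>\<^sup>+ e. Z e \<partial>E) = (\<integral>\<^sup>+ e. ennreal (1 / \<Lambda> ^ k) * gsum k (\<lambda>i. ennreal (bsize e i powr \<theta>) * h (incs e i)) \<partial>E)"
      unfolding Z_def gsum_cmult[symmetric]
    proof (intro nn_integral_cong gsum_cong)
      fix e and i :: "nat list" assume "length i = k"
      then have "ennreal (weight e i) = ennreal (1 / \<Lambda> ^ k) * ennreal (bsize e i powr \<theta>)"
        using \<Lambda>(1) by (simp add: weight_def ennreal_mult[symmetric])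
      then show "ennreal (weight e i) * h (incs e i) = ennreal (1 / \<Lambda> ^ k) * (ennreal (bsize e i powr \<theta>) * h (incs e i))"
        by (simp only: mult.assoc)
    qed
    also have "\<dots> = ennreal (1 / \<Lambda> ^ k) * (\<integral>\<^sup>+ e. gsum k (\<lambda>i. ennreal (bsize e i powr \<theta>) * h (incs e i)) \<partial>E)"
      by (rule nn_integral_cmult) measurable
    also have "\<dots> = ennreal (1 / \<Lambda> ^ k) * (ennreal \<Lambda> ^ k * (\<integral>\<^sup>+ \<omega>. h \<omega> \<partial>RW \<theta>))"
      using \<theta> by (subst many_to_one[OF _ hm hd]) (auto simp: \<Lambda>(3))
    also have "\<dots> = (\<integral>\<^sup>+ \<omega>. h \<omega> \<partial>RW \<theta>)"
      using \<Lambda>(1) by (simp add: mult.assoc[symmetric] ennreal_power ennreal_mult[symmetric])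
    also have "\<dots> = (\<integral>\<^sup>+ \<omega>. indicator {\<omega> \<in> space W.\<Omega>. ?Q \<omega>} \<omega> \<partial>RW \<theta>)"
      by (intro nn_integral_cong) (auto simp: h_def)
    also have "\<dots> = emeasure W.\<Omega> {\<omega> \<in> space W.\<Omega>. ?Q \<omega>}"
      by (rule nn_integral_indicator) measurable
    finally have "ennreal p \<le> (\<integral>\<^sup>+ e. Z e \<partial>E)"
      using elim by (simp add: p_def B_def W.W.emeasure_eq_measure ennreal_leI)
    moreover have "(\<integral>\<^sup>+ e. (Z e)\<^sup>2 \<partial>E) \<le> ennreal m"
    proof -
      have "Z e \<le> gsum k (bweight B e)" for e
        unfolding Z_def by (intro gsum_mono) (auto simp: bweight_def barrier_def h_def)
      then have "(\<integral>\<^sup>+ e. (Z e)\<^sup>2 \<partial>E) \<le> (\<integral>\<^sup>+ e. (gsum k (bweight B e))\<^sup>2 \<partial>E)"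
        by (intro nn_integral_mono power_mono) auto
      then show ?thesis using second_moment[of k B] by (simp add: m_def)
    qed
    ultimately have PZ: "E.prob {e \<in> space E. ennreal (p / 2) \<le> Z e} \<ge> p\<^sup>2 / (4 * m)"
      using p m by (intro E.paley_zygmund) auto
    have kp: "real k powr x \<le> real k powr y" if "x \<le> y" for x y
      using k that by (intro powr_mono) auto
    have "m \<le> (1 + 1 / \<Lambda>\<^sup>2) * real k powr (2 * K + 1)"
    proof -
      have "exp (2 * B) = real k powr (2 * K)" using eB[of 2] by (simp add: mult.commute)
      also have "\<dots> \<le> real k powr (2 * K + 1)" by (rule kp) simp
      finally have 1: "exp (2 * B) \<le> real k powr (2 * K + 1)" .
      have "real k * exp B = real k powr (K + 1)" using eB[of 1] k by (simp add: powr_add)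
      also have "\<dots> \<le> real k powr (2 * K + 1)" using K by (intro kp) simp
      finally have "real k * exp B / \<Lambda>\<^sup>2 \<le> real k powr (2 * K + 1) / \<Lambda>\<^sup>2" by (rule divide_right_mono) simp
      with 1 show ?thesis by (simp add: m_def distrib_right)
    qed
    then have "4 * m \<le> (4 * (1 + 1 / \<Lambda>\<^sup>2)) * real k powr (2 * K + 1)" by (simp only: mult.assoc)
    also have "\<dots> \<le> real k * real k powr (2 * K + 1)" using k by (intro mult_right_mono) auto
    also have "\<dots> = real k powr (2 * K + 2)" using k by (simp add: powr_add powr_numeral power2_eq_square)
    finally have m4: "4 * m \<le> real k powr (2 * K + 2)" .
    have pk: "p = real k powr - 3" using k by (simp add: p_def powr_minus powr_numeral inverse_eq_divide)
    have "real k powr - K' \<le> real k powr (- 6 - (2 * K + 2))" using KJ by (intro kp) (simp add: K'_def)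
    also have "\<dots> = p\<^sup>2 / real k powr (2 * K + 2)"
    proof -
      have "p\<^sup>2 = real k powr - 6" using k by (simp add: pk powr_power)
      moreover have "real k powr (- 6 - (2 * K + 2)) = real k powr - 6 / real k powr (2 * K + 2)"
        by (rule powr_diff)
      ultimately show ?thesis by (simp only:)
    qed
    also have "\<dots> \<le> p\<^sup>2 / (4 * m)" using m m4 k by (intro divide_left_mono) auto
    also have "\<dots> \<le> E.prob {e \<in> space E. ennreal (p / 2) \<le> Z e}" by (rule PZ)
    also have "\<dots> \<le> E.prob {e \<in> space E. ennreal (real k powr - K' * \<Lambda> powr (J * real k / \<theta>)) \<le> S J k e}"
    proof (rule E.finite_measure_mono)
      show "{e \<in> space E. ennreal (p / 2) \<le> Z e} \<subseteq> {e \<in> space E. ennreal (real k powr - K' * \<Lambda> powr (J * real k / \<theta>)) \<le> S J k e}"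
      proof safe
        fix e assume e: "e \<in> space E" and Ze: "ennreal (p / 2) \<le> Z e"
        have "real k powr - K' \<le> real k powr (- 4 - K * (J / \<theta> - 1))" using K by (intro kp) (simp add: K'_def)
        also have "\<dots> = real k powr - 4 * exp (- (B * (J / \<theta> - 1)))"
          using eB[of "- (J / \<theta> - 1)"] by (simp add: powr_add[symmetric] algebra_simps)
        also have "real k powr - 4 \<le> p / 2"
        proof -
          have "real k powr - 4 = p / real k" unfolding pk using powr_diff[of "real k" "- 3" 1] k by simp
          also have "\<dots> \<le> p / 2" using k p by (intro divide_left_mono) auto
          finally show ?thesis .
        qed
        finally have "real k powr - K' \<le> p / 2 * exp (- (B * (J / \<theta> - 1)))" by simp
        then have "real k powr - K' * \<Lambda> powr (J * real k / \<theta>) \<le>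
          (p / 2 * exp (- (B * (J / \<theta> - 1)))) * \<Lambda> powr (J * real k / \<theta>)"
          by (rule mult_right_mono) simp
        then have "real k powr - K' * \<Lambda> powr (J * real k / \<theta>) \<le>
          (\<Lambda> powr (J * real k / \<theta>) * exp (- (B * (J / \<theta> - 1)))) * (p / 2)"
          by (simp only: mult_ac)
        then have "ennreal (real k powr - K' * \<Lambda> powr (J * real k / \<theta>)) \<le>
          ennreal (\<Lambda> powr (J * real k / \<theta>) * exp (- (B * (J / \<theta> - 1)))) * ennreal (p / 2)"
          using p by (subst ennreal_mult[symmetric]) (auto intro!: ennreal_leI)
        also have "\<dots> \<le> ennreal (\<Lambda> powr (J * real k / \<theta>) * exp (- (B * (J / \<theta> - 1)))) * Z e"
          by (intro mult_left_mono Ze) auto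
        also have "\<dots> \<le> S J k e"
          unfolding Z_def h_def by (rule S_ge_weighted[OF e J B]) (simp add: R_def)
        finally show "ennreal (real k powr - K' * \<Lambda> powr (J * real k / \<theta>)) \<le> S J k e" .
      qed
    qed measurable
    finally show ?case .
  qed
  then show ?thesis using K' by blast
qed

end

section \<open>Binary trees of large boxes\<close>

context splitting
begin

text \<open>Branching property: the subtrees below distinct nodes of generation \<open>g\<close>
  read pairwise disjoint sets of coordinates, none of them in the generations before
  \<open>g\<close>.\<close>

lemma nn_integral_subtrees:
  assumes F: "F \<in> borel_measurable E" "depends_on {u. length u < g} F"
    and U: "finite U" "\<And>u. u \<in> U \<Longrightarrow> length u = g"
    and H: "\<And>u. u \<in> U \<Longrightarrow> H u \<in> borel_measurable E"
  shows "(\<integral>\<^sup>+ e. F e * (\<Prod>u\<in>U. H u (subtree u e)) \<partial>E) = (\<integral>\<^sup>+ e. F e \<partial>E) * (\<Prod>u\<in>U. \<integral>\<^sup>+ e. H u e \<partial>E)"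
proof -
  let ?K = "\<lambda>u. range (\<lambda>i. i @ u)"
  have m: "(\<lambda>e. H u (subtree u e)) \<in> borel_measurable E" if "u \<in> U" for u
    by (rule measurable_compose[OF measurable_subtree H[OF that]])
  have d: "depends_on (?K u) (\<lambda>e. H u (subtree u e))" for u
    by (intro depends_onI arg_cong[where f="H u"] ext) auto
  have "(\<integral>\<^sup>+ e. F e * (\<Prod>u\<in>U. H u (subtree u e)) \<partial>E) = (\<integral>\<^sup>+ e. F e \<partial>E) * (\<integral>\<^sup>+ e. (\<Prod>u\<in>U. H u (subtree u e)) \<partial>E)"
  proof (rule nn_integral_PiM_mult[OF F])
    show "(\<lambda>e. \<Prod>u\<in>U. H u (subtree u e)) \<in> borel_measurable E"
      by (rule borel_measurable_prod_ennreal) (rule m)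
    show "depends_on (\<Union>u\<in>U. ?K u) (\<lambda>e. \<Prod>u\<in>U. H u (subtree u e))"
    proof (rule depends_onI)
      fix x y :: "nat list \<Rightarrow> nat measure"
      assume xy: "\<And>i. i \<in> (\<Union>u\<in>U. ?K u) \<Longrightarrow> x i = y i"
      show "(\<Prod>u\<in>U. H u (subtree u x)) = (\<Prod>u\<in>U. H u (subtree u y))"
        using xy by (intro prod.cong refl depends_onD[OF d]) auto
    qed
    show "{u. length u < g} \<inter> (\<Union>u\<in>U. ?K u) = {}"
      using U(2) by fastforce
  qed
  also have "(\<integral>\<^sup>+ e. (\<Prod>u\<in>U. H u (subtree u e)) \<partial>E) = (\<Prod>u\<in>U. \<integral>\<^sup>+ e. H u (subtree u e) \<partial>E)"
  proof (rule nn_integral_PiM_prod[where K="?K"])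
    show "disjoint_family_on ?K U"
      using U(2) by (auto simp: disjoint_family_on_def)
  qed (use U m d in auto)
  also have "\<dots> = (\<Prod>u\<in>U. \<integral>\<^sup>+ e. H u e \<partial>E)"
    using H by (intro prod.cong refl nn_integral_subtree) auto
  finally show ?thesis .
qed

text \<open>If a random list of nodes of generation \<open>g\<close> is chosen by looking only at the first \<open>g\<close>
  generations, the subtrees below it are still fresh.\<close>

lemma emeasure_selected_le:
  fixes P :: "'l :: countable \<Rightarrow> (nat list \<Rightarrow> nat measure) \<Rightarrow> bool"
  assumes P: "\<And>l. Measurable.pred E (P l)" "\<And>l. depends_on {u. length u < g} (P l)"
    and B: "\<And>l. Measurable.pred E (Bad l)"
    and le: "\<And>l F. F \<in> borel_measurable E \<Longrightarrow> depends_on {u. length u < g} F \<Longrightarrow> \<exists>e. P l e \<Longrightarrow>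
      (\<integral>\<^sup>+ e. F e * indicator {e. Bad l e} e \<partial>E) \<le> (\<integral>\<^sup>+ e. F e \<partial>E) * c"
  shows "emeasure E {e \<in> space E. (\<exists>l. P l e) \<and> (\<forall>l. P l e \<longrightarrow> Bad l e)} \<le> c"
proof -
  \<comment> \<open>The least admissible index with respect to \<open>to_nat\<close>; the events
    \<open>Q l\<close> are disjoint and depend on the first \<open>g\<close> generations
    only.\<close>
  define Q where "Q l e \<longleftrightarrow> P l e \<and> (\<forall>l'. to_nat l' < to_nat l \<longrightarrow> \<not> P l' e)" for l e
  note P(1)[measurable] B[measurable]
  have Qm [measurable]: "Measurable.pred E (Q l)" for l unfolding Q_def by measurable
  have Qd: "depends_on {u. length u < g} (\<lambda>e. indicator {e. Q l e} e :: ennreal)" for l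
  proof (rule depends_onI)
    fix x y :: "nat list \<Rightarrow> nat measure" assume "\<And>i. i \<in> {u. length u < g} \<Longrightarrow> x i = y i"
    then have "P l x = P l y" for l by (intro depends_onD[OF P(2)])
    then show "indicator {e. Q l e} x = (indicator {e. Q l e} y :: ennreal)" by (simp add: Q_def indicator_def)
  qed
  have Qex: "\<exists>l. Q l e" if "\<exists>l. P l e" for e
    using ex_has_least_nat[of "\<lambda>l. P l e" _ to_nat] that unfolding Q_def by (metis not_less)
  have Quniq: "l = l'" if "Q l e" "Q l' e" for l l' e
    using that unfolding Q_def by (metis linorder_neqE_nat to_nat_split)
  let ?A = "{e \<in> space E. (\<exists>l. P l e) \<and> (\<forall>l. P l e \<longrightarrow> Bad l e)}"
  have "emeasure E ?A = (\<integral>\<^sup>+ e. indicator ?A e \<partial>E)"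
    by (rule nn_integral_indicator[symmetric]) measurable
  also have "\<dots> \<le> (\<integral>\<^sup>+ e. (\<integral>\<^sup>+ l. indicator {e. Q l e} e * indicator {e. Bad l e} e \<partial>count_space UNIV) \<partial>E)"
  proof (rule nn_integral_mono)
    fix e
    show "indicator ?A e \<le> (\<integral>\<^sup>+ l. indicator {e. Q l e} e * indicator {e. Bad l e} e \<partial>count_space UNIV :: ennreal)"
    proof (cases "e \<in> ?A")
      case True
      then obtain l where l: "Q l e" using Qex by blast
      then have "Bad l e" using True by (auto simp: Q_def)
      then have "indicator ?A e \<le> (indicator {e. Q l e} e * indicator {e. Bad l e} e :: ennreal)"
        using l by (simp add: indicator_def)
      also have "\<dots> \<le> (\<integral>\<^sup>+ l. indicator {e. Q l e} e * indicator {e. Bad l e} e \<partial>count_space UNIV)"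
        by (rule nn_integral_ge_point) auto
      finally show ?thesis .
    qed simp
  qed
  also have "\<dots> = (\<integral>\<^sup>+ l. (\<integral>\<^sup>+ e. indicator {e. Q l e} e * indicator {e. Bad l e} e \<partial>E) \<partial>count_space UNIV)"
    by (rule nn_integral_count_space_nn_integral) auto
  also have "\<dots> \<le> (\<integral>\<^sup>+ l. (\<integral>\<^sup>+ e. indicator {e. Q l e} e \<partial>E) * c \<partial>count_space UNIV)"
  proof (rule nn_integral_mono)
    fix l
    show "(\<integral>\<^sup>+ e. indicator {e. Q l e} e * indicator {e. Bad l e} e \<partial>E) \<le> (\<integral>\<^sup>+ e. indicator {e. Q l e} e \<partial>E) * c"
    proof (cases "\<exists>e. P l e")
      case True
      show ?thesis by (rule le[OF _ Qd True]) measurable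
    next
      case False
      then show ?thesis by (simp add: Q_def)
    qed
  qed
  also have "\<dots> = (\<integral>\<^sup>+ l. (\<integral>\<^sup>+ e. indicator {e. Q l e} e \<partial>E) \<partial>count_space UNIV) * c"
    by (rule nn_integral_multc) simp
  also have "(\<integral>\<^sup>+ l. (\<integral>\<^sup>+ e. indicator {e. Q l e} e \<partial>E) \<partial>count_space UNIV) =
      (\<integral>\<^sup>+ e. (\<integral>\<^sup>+ l. indicator {e. Q l e} e \<partial>count_space UNIV) \<partial>E)"
    by (rule nn_integral_count_space_nn_integral[symmetric]) auto
  also have "(\<integral>\<^sup>+ e. (\<integral>\<^sup>+ l. indicator {e. Q l e} e \<partial>count_space UNIV) \<partial>E) * c \<le> (\<integral>\<^sup>+ e. 1 \<partial>E) * c"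
  proof (intro mult_right_mono nn_integral_mono)
    fix e
    show "(\<integral>\<^sup>+ l. indicator {e. Q l e} e \<partial>count_space UNIV) \<le> (1 :: ennreal)"
    proof (cases "\<exists>l. Q l e")
      case True
      then obtain l where l: "Q l e" by blast
      have "(\<integral>\<^sup>+ l. indicator {e. Q l e} e \<partial>count_space UNIV) = (\<integral>\<^sup>+ l'. indicator {l} l' \<partial>count_space UNIV :: ennreal)"
      proof (rule nn_integral_cong)
        fix l'
        show "indicator {e. Q l' e} e = (indicator {l} l' :: ennreal)"
        proof (cases "l' = l")
          case False
          then have "\<not> Q l' e" using Quniq[OF l, of l'] by blast
          then show ?thesis using False by simp
        qed (use l in simp)
      qed
      then show ?thesis by simp
    qed simp
  qed simp
  finally show ?thesis using E.emeasure_space_1 by simp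
qed

text \<open>A distinct list rather than a set, so that the possible choices form a countable
  type.\<close>

definition large_boxes :: "nat \<Rightarrow> nat \<Rightarrow> real \<Rightarrow> nat list list \<Rightarrow> (nat list \<Rightarrow> nat measure) \<Rightarrow> bool" where
  "large_boxes m g \<eta> l e \<longleftrightarrow> distinct l \<and> length l = m \<and> (\<forall>u\<in>set l. length u = g \<and> \<eta> \<le> bsize e u)"

lemma measurable_large_boxes [measurable]: "Measurable.pred E (large_boxes m g \<eta> l)"
  unfolding large_boxes_def by measurable

lemma depends_on_large_boxes: "depends_on {u. length u < g} (large_boxes m g \<eta> l)"
proof (rule depends_onI)
  fix x y :: "nat list \<Rightarrow> nat measure" assume xy: "\<And>i. i \<in> {u. length u < g} \<Longrightarrow> x i = y i"
  have "bsize x u = bsize y u" if "length u = g" for u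
    by (rule depends_onD[OF depends_on_bsize[of u g]]) (use that xy in auto)
  then show "large_boxes m g \<eta> l x = large_boxes m g \<eta> l y"
    by (auto simp: large_boxes_def)
qed

text \<open>One level of the tree spans \<open>g\<close> generations, and \<eta> bounds the size of
  a node relative to its parent node.\<close>

primrec binary_tree :: "nat \<Rightarrow> real \<Rightarrow> nat \<Rightarrow> (nat list \<Rightarrow> nat measure) \<Rightarrow> bool" where
  "binary_tree g \<eta> 0 = (\<lambda>e. True)"
| "binary_tree g \<eta> (Suc n) = (\<lambda>e. \<exists>a b. a \<noteq> b \<and> length a = g \<and> length b = g \<and> \<eta> \<le> bsize e a \<and> \<eta> \<le> bsize e b \<and>
     binary_tree g \<eta> n (subtree a e) \<and> binary_tree g \<eta> n (subtree b e))"

lemma pred_subtree: "Measurable.pred E P \<Longrightarrow> Measurable.pred E (\<lambda>e. P (subtree u e))"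
  by (rule measurable_compose[OF measurable_subtree])

lemma measurable_binary_tree [measurable]: "Measurable.pred E (binary_tree g \<eta> n)"
proof (induction n)
  case (Suc n)
  note pred_subtree[OF Suc, measurable]
  show ?case unfolding binary_tree.simps by measurable
qed simp

lemma binary_tree_antimono: "binary_tree g \<eta> (Suc n) e \<Longrightarrow> binary_tree g \<eta> n e"
proof (induction n arbitrary: e)
  case (Suc n)
  then show ?case unfolding binary_tree.simps(2)[of g \<eta> "Suc n"] binary_tree.simps(2)[of g \<eta> n] by blast
qed simp

lemma binary_tree_large_boxes:
  assumes "0 \<le> \<eta>" "binary_tree g \<eta> n e"
  shows "\<exists>l. large_boxes (2 ^ n) (n * g) (\<eta> ^ n) l e"
  using assms(2)
proof (induction n arbitrary: e)
  case 0
  show ?case by (intro exI[of _ "[[]]"]) (simp add: large_boxes_def)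
next
  case (Suc n)
  then obtain a b where ab: "a \<noteq> b" "length a = g" "length b = g" "\<eta> \<le> bsize e a" "\<eta> \<le> bsize e b"
    and t: "binary_tree g \<eta> n (subtree a e)" "binary_tree g \<eta> n (subtree b e)"
    unfolding binary_tree.simps by blast
  obtain la lb where l: "large_boxes (2 ^ n) (n * g) (\<eta> ^ n) la (subtree a e)"
      "large_boxes (2 ^ n) (n * g) (\<eta> ^ n) lb (subtree b e)"
    using Suc.IH[OF t(1)] Suc.IH[OF t(2)] by blast
  let ?l = "map (\<lambda>i. i @ a) la @ map (\<lambda>i. i @ b) lb"
  have "distinct ?l"
    using l ab(1-3) by (auto simp: large_boxes_def distinct_map inj_on_def)
  moreover have "length u = Suc n * g \<and> \<eta> ^ Suc n \<le> bsize e u" if "u \<in> set ?l" for u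
  proof -
    have *: "length (i @ x) = Suc n * g \<and> \<eta> ^ Suc n \<le> bsize e (i @ x)"
      if "length i = n * g" "\<eta> ^ n \<le> bsize (subtree x e) i" "length x = g" "\<eta> \<le> bsize e x" for i x
      using assms(1) that by (auto simp: bsize_append intro!: mult_mono)
    from that consider i where "u = i @ a" "i \<in> set la" | i where "u = i @ b" "i \<in> set lb" by auto
    then show ?thesis
    proof cases
      case (1 i)
      then show ?thesis using *[of i a] l(1) ab by (simp add: large_boxes_def)
    next
      case (2 i)
      then show ?thesis using *[of i b] l(2) ab by (simp add: large_boxes_def)
    qed
  qed
  ultimately show ?case
    using l by (intro exI[of _ ?l]) (simp add: large_boxes_def)
qed

text \<open>With three large boxes at hand, a tree of depth \<open>Suc n\<close> is missing only if
  two of the three subtrees fail, which makes the recursion quadratic in \<open>r\<close>. Two boxes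
  would give a linear recursion with factor 2, which does not close. The 9 bounds the number of
  ordered pairs.\<close>

lemma prob_binary_tree_Suc:
  assumes r: "E.prob {e \<in> space E. \<not> binary_tree g \<eta> n e} \<le> r"
    and many: "E.prob {e \<in> space E. \<not> (\<exists>l. large_boxes 3 g \<eta> l e)} \<le> \<epsilon>"
  shows "E.prob {e \<in> space E. \<not> binary_tree g \<eta> (Suc n) e} \<le> \<epsilon> + 9 * r\<^sup>2"
proof -
  let ?N = "\<lambda>e. \<not> binary_tree g \<eta> n e"
  define Bad where "Bad l e \<longleftrightarrow> (\<exists>x\<in>set l. \<exists>y\<in>set l. x \<noteq> y \<and> ?N (subtree x e) \<and> ?N (subtree y e))" for l :: "nat list list" and e
  have r0: "0 \<le> r" using r measure_nonneg[of E] by (rule order_trans[rotated])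
  have N [measurable]: "Measurable.pred E ?N" by measurable
  note pred_subtree[OF N, measurable]
  have Bm: "Measurable.pred E (Bad l)" for l unfolding Bad_def by measurable
  have "emeasure E {e \<in> space E. (\<exists>l. large_boxes 3 g \<eta> l e) \<and> (\<forall>l. large_boxes 3 g \<eta> l e \<longrightarrow> Bad l e)} \<le> ennreal (9 * r\<^sup>2)"
  proof (rule emeasure_selected_le[OF measurable_large_boxes depends_on_large_boxes Bm])
    fix l and F :: "(nat list \<Rightarrow> nat measure) \<Rightarrow> ennreal"
    assume F: "F \<in> borel_measurable E" "depends_on {u. length u < g} F" and ex: "\<exists>e. large_boxes 3 g \<eta> l e"
    have l: "length l = 3" "\<And>u. u \<in> set l \<Longrightarrow> length u = g" using ex by (auto simp: large_boxes_def)
    let ?H = "\<lambda>e. indicator {e. ?N e} e :: ennreal"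
    let ?P = "{z \<in> set l \<times> set l. fst z \<noteq> snd z}"
    note F(1)[measurable]
    have Hm [measurable]: "?H \<in> borel_measurable E" by measurable
    have Hint: "(\<integral>\<^sup>+ e. ?H e \<partial>E) \<le> ennreal r"
    proof -
      have "(\<integral>\<^sup>+ e. ?H e \<partial>E) = (\<integral>\<^sup>+ e. indicator {e \<in> space E. ?N e} e \<partial>E)"
        by (intro nn_integral_cong) (auto simp: indicator_def)
      also have "\<dots> = emeasure E {e \<in> space E. ?N e}" by (rule nn_integral_indicator) measurable
      finally show ?thesis using r by (simp add: E.emeasure_eq_measure ennreal_leI)
    qed
    have Hs [measurable]: "(\<lambda>e. ?H (subtree u e)) \<in> borel_measurable E" for u
      by (rule measurable_compose[OF measurable_subtree Hm])
    have "(\<integral>\<^sup>+ e. F e * indicator {e. Bad l e} e \<partial>E) \<le> (\<integral>\<^sup>+ e. (\<Sum>z\<in>?P. F e * (\<Prod>u\<in>{fst z, snd z}. ?H (subtree u e))) \<partial>E)"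
    proof (rule nn_integral_mono)
      fix e
      show "F e * indicator {e. Bad l e} e \<le> (\<Sum>z\<in>?P. F e * (\<Prod>u\<in>{fst z, snd z}. ?H (subtree u e)))"
      proof (cases "Bad l e")
        case True
        then obtain x y where xy: "x \<in> set l" "y \<in> set l" "x \<noteq> y" "?N (subtree x e)" "?N (subtree y e)"
          unfolding Bad_def by blast
        have "F e * indicator {e. Bad l e} e = F e * (\<Prod>u\<in>{fst (x, y), snd (x, y)}. ?H (subtree u e))"
          using xy True by simp
        also have "\<dots> \<le> (\<Sum>z\<in>?P. F e * (\<Prod>u\<in>{fst z, snd z}. ?H (subtree u e)))"
          using xy by (intro member_le_sum[of "(x, y)" ?P]) auto
        finally show ?thesis .
      qed simp
    qed
    also have "\<dots> = (\<Sum>z\<in>?P. \<integral>\<^sup>+ e. F e * (\<Prod>u\<in>{fst z, snd z}. ?H (subtree u e)) \<partial>E)"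
      by (rule nn_integral_sum) (intro borel_measurable_times_ennreal F borel_measurable_prod_ennreal Hs)
    also have "\<dots> = (\<Sum>z\<in>?P. (\<integral>\<^sup>+ e. F e \<partial>E) * (\<Prod>u\<in>{fst z, snd z}. \<integral>\<^sup>+ e. ?H e \<partial>E))"
      using l by (intro sum.cong refl nn_integral_subtrees F Hm) (auto simp: F(2))
    also have "\<dots> \<le> (\<Sum>z\<in>?P. (\<integral>\<^sup>+ e. F e \<partial>E) * ennreal (r\<^sup>2))"
    proof (intro sum_mono mult_left_mono)
      fix z assume "z \<in> ?P"
      then have "(\<Prod>u\<in>{fst z, snd z}. \<integral>\<^sup>+ e. ?H e \<partial>E) = (\<integral>\<^sup>+ e. ?H e \<partial>E) * (\<integral>\<^sup>+ e. ?H e \<partial>E)" by simp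
      also have "\<dots> \<le> ennreal r * ennreal r" by (intro mult_mono Hint) auto
      finally show "(\<Prod>u\<in>{fst z, snd z}. \<integral>\<^sup>+ e. ?H e \<partial>E) \<le> ennreal (r\<^sup>2)"
        using r0 by (simp add: ennreal_mult power2_eq_square)
    qed simp
    also have "\<dots> = of_nat (card ?P) * ((\<integral>\<^sup>+ e. F e \<partial>E) * ennreal (r\<^sup>2))" by simp
    also have "\<dots> \<le> of_nat 9 * ((\<integral>\<^sup>+ e. F e \<partial>E) * ennreal (r\<^sup>2))"
    proof (intro mult_right_mono of_nat_mono)
      have "card ?P \<le> card (set l \<times> set l)" by (intro card_mono) auto
      also have "\<dots> = card (set l) * card (set l)" by (simp add: card_cartesian_product)
      also have "\<dots> \<le> length l * length l" by (intro mult_le_mono card_length)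
      finally show "card ?P \<le> 9" using l(1) by simp
    qed simp
    also have "\<dots> = (\<integral>\<^sup>+ e. F e \<partial>E) * ennreal (9 * r\<^sup>2)"
      by (simp add: ennreal_mult mult_ac)
    finally show "(\<integral>\<^sup>+ e. F e * indicator {e. Bad l e} e \<partial>E) \<le> (\<integral>\<^sup>+ e. F e \<partial>E) * ennreal (9 * r\<^sup>2)" .
  qed
  then have sel: "E.prob {e \<in> space E. (\<exists>l. large_boxes 3 g \<eta> l e) \<and> (\<forall>l. large_boxes 3 g \<eta> l e \<longrightarrow> Bad l e)} \<le> 9 * r\<^sup>2"
    using r0 by (simp add: E.emeasure_eq_measure)
  note Bm[measurable]
  have "E.prob {e \<in> space E. \<not> binary_tree g \<eta> (Suc n) e} \<le>
    E.prob ({e \<in> space E. \<not> (\<exists>l. large_boxes 3 g \<eta> l e)} \<union>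
      {e \<in> space E. (\<exists>l. large_boxes 3 g \<eta> l e) \<and> (\<forall>l. large_boxes 3 g \<eta> l e \<longrightarrow> Bad l e)})"
  proof (rule E.finite_measure_mono)
    show "{e \<in> space E. \<not> binary_tree g \<eta> (Suc n) e} \<subseteq>
      {e \<in> space E. \<not> (\<exists>l. large_boxes 3 g \<eta> l e)} \<union>
      {e \<in> space E. (\<exists>l. large_boxes 3 g \<eta> l e) \<and> (\<forall>l. large_boxes 3 g \<eta> l e \<longrightarrow> Bad l e)}"
    proof (rule subsetI, rule ccontr)
      fix e assume e: "e \<in> {e \<in> space E. \<not> binary_tree g \<eta> (Suc n) e}"
        and ne: "e \<notin> {e \<in> space E. \<not> (\<exists>l. large_boxes 3 g \<eta> l e)} \<union>
          {e \<in> space E. (\<exists>l. large_boxes 3 g \<eta> l e) \<and> (\<forall>l. large_boxes 3 g \<eta> l e \<longrightarrow> Bad l e)}"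
      then obtain l where nb: "\<not> binary_tree g \<eta> (Suc n) e" and lb: "large_boxes 3 g \<eta> l e" and nB: "\<not> Bad l e"
        by auto
      obtain x y z where l: "l = [x, y, z]"
        using lb by (auto simp: large_boxes_def numeral_3_eq_3 length_Suc_conv)
      have sz: "length u = g" "\<eta> \<le> bsize e u" if "u \<in> {x, y, z}" for u
        using lb that unfolding large_boxes_def l by auto
      have neq: "x \<noteq> y" "y \<noteq> z" "x \<noteq> z" using lb unfolding large_boxes_def l by auto
      have two: "?N (subtree a e) \<or> ?N (subtree b e)" if "a \<in> {x, y, z}" "b \<in> {x, y, z}" "a \<noteq> b" for a b
        using nb sz[OF that(1)] sz[OF that(2)] that(3) unfolding binary_tree.simps by blast
      have "Bad l e"
        using two[of x y] two[of y z] two[of x z] neq unfolding Bad_def l by auto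
      then show False using nB by simp
    qed
  qed measurable
  also have "\<dots> \<le> E.prob {e \<in> space E. \<not> (\<exists>l. large_boxes 3 g \<eta> l e)} +
      E.prob {e \<in> space E. (\<exists>l. large_boxes 3 g \<eta> l e) \<and> (\<forall>l. large_boxes 3 g \<eta> l e \<longrightarrow> Bad l e)}"
    by (rule measure_Un_le) measurable
  finally show ?thesis using sel many by simp
qed

text \<open>The bound \<open>2 * \<epsilon>\<close> is stable under the recursion, since
  \<open>9 * (2 * \<epsilon>)\<^sup>2 \<le> \<epsilon>\<close> for
  \<open>\<epsilon> \<le> 1 / 36\<close>; it passes to the limit because the failure events increase
  with the depth.\<close>

lemma prob_binary_tree:
  assumes many: "E.prob {e \<in> space E. \<not> (\<exists>l. large_boxes 3 g \<eta> l e)} \<le> \<epsilon>" and \<epsilon>: "0 \<le> \<epsilon>" "\<epsilon> \<le> 1 / 36"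
  shows "E.prob {e \<in> space E. \<not> (\<forall>n. binary_tree g \<eta> n e)} \<le> 2 * \<epsilon>"
proof -
  have n: "E.prob {e \<in> space E. \<not> binary_tree g \<eta> n e} \<le> 2 * \<epsilon>" for n
  proof (induction n)
    case (Suc n)
    have "E.prob {e \<in> space E. \<not> binary_tree g \<eta> (Suc n) e} \<le> \<epsilon> + 9 * (2 * \<epsilon>)\<^sup>2"
      by (rule prob_binary_tree_Suc[OF Suc many])
    also have "9 * (2 * \<epsilon>)\<^sup>2 = (36 * \<epsilon>) * \<epsilon>" by (simp add: power2_eq_square)
    also have "\<dots> \<le> 1 * \<epsilon>" using \<epsilon> by (intro mult_right_mono) auto
    finally show ?case by simp
  qed (use \<epsilon> in simp)
  have "(\<lambda>n. E.prob {e \<in> space E. \<not> binary_tree g \<eta> n e}) \<longlonglongrightarrow> E.prob (\<Union>n. {e \<in> space E. \<not> binary_tree g \<eta> n e})"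
  proof (rule E.finite_Lim_measure_incseq)
    show "range (\<lambda>n. {e \<in> space E. \<not> binary_tree g \<eta> n e}) \<subseteq> E.events"
    proof safe
      fix n show "{e \<in> space E. \<not> binary_tree g \<eta> n e} \<in> E.events" by measurable
    qed
    show "incseq (\<lambda>n. {e \<in> space E. \<not> binary_tree g \<eta> n e})"
      using binary_tree_antimono by (intro incseq_SucI) blast
  qed
  moreover have "(\<Union>n. {e \<in> space E. \<not> binary_tree g \<eta> n e}) = {e \<in> space E. \<not> (\<forall>n. binary_tree g \<eta> n e)}" by auto
  ultimately show ?thesis using n by (intro LIMSEQ_le_const2) auto
qed

end

context nongeometric_splitting
begin

text \<open>If fewer than three boxes carry the whole mass, one of them is large; this is unlikely since the
  expected sum of the squared sizes decays exponentially.\<close>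

lemma ex_prob_large_boxes:
  assumes \<epsilon>: "\<epsilon> > 0"
  shows "\<exists>g \<eta>. 0 < \<eta> \<and> \<eta> \<le> 1 \<and> E.prob {e \<in> space E. \<not> (\<exists>l. large_boxes 3 g \<eta> l e)} \<le> \<epsilon>"
proof -
  let ?L = "Lreal \<nu> 2"
  have L: "0 \<le> ?L" "?L < 1" "Lfun \<nu> 2 = ennreal ?L"
    using Lreal_pos[of 2] Lreal_less_1[of 2] Lfun_eq_Lreal[of 2] by auto
  have "(\<lambda>g. ?L ^ g) \<longlonglongrightarrow> 0" using L by (intro LIMSEQ_realpow_zero) auto
  then have "\<forall>\<^sub>F g in sequentially. ?L ^ g < \<epsilon> / 18" using \<epsilon> by (intro order_tendstoD(2)) auto
  then obtain g where g: "?L ^ g < \<epsilon> / 18" by (auto simp: eventually_sequentially)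
  define A where "A n = {e \<in> space E. \<not> (\<exists>l. large_boxes 3 g (1 / real (Suc n)) l e)}" for n
  have Am [measurable]: "A n \<in> E.events" for n unfolding A_def by measurable
  \<comment> \<open>On the left no three boxes of generation \<open>g\<close> have positive size. If
    the sum of squares were below \<open>1 / 9\<close>, every box would be below
    \<open>1 / 3\<close>, and more than \<open>2 / 3\<close> of the mass would need three of
    them.\<close>
  have sub: "(\<Inter>n. A n) \<subseteq> {e \<in> space E. ennreal (1 / 9) \<le> S 2 g e}"
  proof safe
    fix e assume e: "e \<in> (\<Inter>n. A n)"
    then show es: "e \<in> space E" by (auto simp: A_def)
    show "ennreal (1 / 9) \<le> S 2 g e"
    proof (rule ccontr)
      assume "\<not> ennreal (1 / 9) \<le> S 2 g e"
      then have S: "S 2 g e < ennreal (1 / 9)" by simp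
      have small: "bsize e i < 1 / 3" if "length i = g" for i
      proof -
        have "ennreal (bsize e i powr 2) \<le> S 2 g e" unfolding S_def by (rule gsum_ge[OF that])
        also note S
        finally have "(bsize e i)\<^sup>2 < (1 / 3)\<^sup>2" by (simp add: powr_numeral power2_eq_square ennreal_less_iff)
        then show ?thesis by (rule power2_less_imp_less) simp
      qed
      have "ennreal (2 / 3) < gsum g (\<lambda>i. ennreal (bsize e i))"
        using gsum_bsize[OF es] by (simp add: ennreal_less_one_iff)
      from less_gsumD[OF this] obtain B where B: "finite B" "\<And>i. i \<in> B \<Longrightarrow> length i = g"
        "ennreal (2 / 3) < (\<Sum>i\<in>B. ennreal (bsize e i))" by blast
      define B' where "B' = {i \<in> B. bsize e i > 0}"
      have B': "finite B'" "\<And>i. i \<in> B' \<Longrightarrow> length i = g \<and> bsize e i > 0" using B by (auto simp: B'_def)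
      have "(\<Sum>i\<in>B. ennreal (bsize e i)) = ennreal (\<Sum>i\<in>B. bsize e i)" by (rule sum_ennreal) simp
      also have "(\<Sum>i\<in>B. bsize e i) = (\<Sum>i\<in>B'. bsize e i)"
        using B(1) bsize_nonneg[of e] by (intro sum.mono_neutral_right) (auto simp: B'_def order_le_less)
      finally have "2 / 3 < (\<Sum>i\<in>B'. bsize e i)" using B(3) by (simp add: ennreal_less_iff)
      also have "\<dots> \<le> (\<Sum>i\<in>B'. 1 / 3)" using B' small by (intro sum_mono less_imp_le) auto
      also have "\<dots> = real (card B') / 3" by simp
      finally have "3 \<le> card B'" by simp
      then obtain U where U: "U \<subseteq> B'" "card U = 3" using obtain_subset_with_card_n by metis
      have finU: "finite U" using U B'(1) finite_subset by blast
      obtain l where l: "set l = U" "distinct l" using finite_distinct_list[OF finU] by blast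
      have len: "length l = 3" using l U(2) distinct_card by fastforce
      have Une: "U \<noteq> {}" using U(2) by auto
      define \<eta> where "\<eta> = Min (bsize e ` U)"
      have \<eta>: "\<eta> > 0" unfolding \<eta>_def using finU Une U(1) B'(2) by (subst Min_gr_iff) auto
      obtain n where n: "1 / real (Suc n) < \<eta>" using nat_approx_posE[OF \<eta>] by blast
      have "1 / real (Suc n) \<le> bsize e u" if "u \<in> U" for u
      proof -
        have "\<eta> \<le> bsize e u" unfolding \<eta>_def using finU that by (intro Min_le) auto
        then show ?thesis using n by simp
      qed
      then have "large_boxes 3 g (1 / real (Suc n)) l e"
        using l len U(1) B'(2) by (auto simp: large_boxes_def)
      then show False using e by (auto simp: A_def)
    qed
  qed
  have "emeasure E {e \<in> space E. ennreal (1 / 9) \<le> S 2 g e} \<le> ennreal (9 * ?L ^ g)"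
  proof -
    have "emeasure E {e \<in> space E. ennreal (1 / 9) \<le> S 2 g e} = (\<integral>\<^sup>+ e. indicator {e \<in> space E. ennreal (1 / 9) \<le> S 2 g e} e \<partial>E)"
      by (rule nn_integral_indicator[symmetric]) measurable
    also have "\<dots> \<le> (\<integral>\<^sup>+ e. ennreal 9 * S 2 g e \<partial>E)"
    proof (rule nn_integral_mono)
      fix e
      show "indicator {e \<in> space E. ennreal (1 / 9) \<le> S 2 g e} e \<le> ennreal 9 * S 2 g e"
      proof (cases "ennreal (1 / 9) \<le> S 2 g e")
        case True
        have "1 = ennreal 9 * ennreal (1 / 9)" by (subst ennreal_mult[symmetric]) auto
        also have "\<dots> \<le> ennreal 9 * S 2 g e" by (intro mult_left_mono True) auto
        finally show ?thesis by (auto simp: indicator_def)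
      qed simp
    qed
    also have "\<dots> = ennreal 9 * ennreal ?L ^ g"
      by (subst nn_integral_cmult) (auto simp: nn_integral_S L(3))
    also have "\<dots> = ennreal (9 * ?L ^ g)" using L(1) by (simp add: ennreal_power ennreal_mult)
    finally show ?thesis .
  qed
  then have S9: "E.prob {e \<in> space E. ennreal (1 / 9) \<le> S 2 g e} \<le> 9 * ?L ^ g"
    using L(1) by (simp add: E.emeasure_eq_measure)
  have "(\<lambda>n. E.prob (A n)) \<longlonglongrightarrow> E.prob (\<Inter>n. A n)"
  proof (rule E.finite_Lim_measure_decseq)
    show "range A \<subseteq> E.events" using Am by auto
    show "decseq A"
    proof (rule decseq_SucI)
      fix n
      have "1 / real (Suc (Suc n)) \<le> 1 / real (Suc n)" by (intro divide_left_mono) auto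
      then show "A (Suc n) \<subseteq> A n" unfolding A_def large_boxes_def by force
    qed
  qed
  moreover have "E.prob (\<Inter>n. A n) < \<epsilon>"
  proof -
    have "E.prob (\<Inter>n. A n) \<le> 9 * ?L ^ g"
      using E.finite_measure_mono[OF sub] S9 by simp
    also have "\<dots> < \<epsilon>" using g \<epsilon> by simp
    finally show ?thesis .
  qed
  ultimately have "\<forall>\<^sub>F n in sequentially. E.prob (A n) < \<epsilon>" by (rule order_tendstoD(2))
  then obtain n where "E.prob (A n) < \<epsilon>" by (auto simp: eventually_sequentially)
  then show ?thesis unfolding A_def by (intro exI[of _ g] exI[of _ "1 / real (Suc n)"]) auto
qed

end

section \<open>Independent restarts below the tree\<close>

context splitting
begin

text \<open>For a fixed list the \<open>m\<close> subtrees are independent of each other and of the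
  first \<open>g\<close> generations; \<open>emeasure_selected_le\<close> extends this to the list
  found in the environment.\<close>

lemma prob_all_subtrees_fail:
  assumes G [measurable]: "Measurable.pred E G" and q: "E.prob {e \<in> space E. G e} \<ge> q" "q \<le> 1"
  shows "E.prob {e \<in> space E. (\<exists>l. large_boxes m g \<eta> l e) \<and>
    (\<forall>l. large_boxes m g \<eta> l e \<longrightarrow> (\<forall>u\<in>set l. \<not> G (subtree u e)))} \<le> (1 - q) ^ m"
proof -
  define Bad where "Bad l e \<longleftrightarrow> (\<forall>u\<in>set l. \<not> G (subtree u e))" for l :: "nat list list" and e
  note pred_subtree[OF G, measurable]
  have Bm: "Measurable.pred E (Bad l)" for l unfolding Bad_def by measurable
  let ?H = "\<lambda>e. indicator {e. \<not> G e} e :: ennreal"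
  have Hint: "(\<integral>\<^sup>+ e. ?H e \<partial>E) \<le> ennreal (1 - q)"
  proof -
    have "(\<integral>\<^sup>+ e. ?H e \<partial>E) = (\<integral>\<^sup>+ e. indicator (space E - {e \<in> space E. G e}) e \<partial>E)"
      by (intro nn_integral_cong) (auto simp: indicator_def)
    also have "\<dots> = emeasure E (space E - {e \<in> space E. G e})" by (rule nn_integral_indicator) measurable
    also have "\<dots> = ennreal (1 - E.prob {e \<in> space E. G e})"
      unfolding E.emeasure_eq_measure by (subst E.prob_compl) auto
    finally show ?thesis using q by (simp add: ennreal_leI)
  qed
  have "emeasure E {e \<in> space E. (\<exists>l. large_boxes m g \<eta> l e) \<and> (\<forall>l. large_boxes m g \<eta> l e \<longrightarrow> Bad l e)} \<le> ennreal ((1 - q) ^ m)"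
  proof (rule emeasure_selected_le[OF measurable_large_boxes depends_on_large_boxes Bm])
    fix l and F :: "(nat list \<Rightarrow> nat measure) \<Rightarrow> ennreal"
    assume F: "F \<in> borel_measurable E" "depends_on {u. length u < g} F" and ex: "\<exists>e. large_boxes m g \<eta> l e"
    have l: "card (set l) = m" "\<And>u. u \<in> set l \<Longrightarrow> length u = g"
      using ex by (auto simp: large_boxes_def distinct_card)
    have Hm: "?H \<in> borel_measurable E" by measurable
    have "(\<integral>\<^sup>+ e. F e * indicator {e. Bad l e} e \<partial>E) \<le> (\<integral>\<^sup>+ e. F e * (\<Prod>u\<in>set l. ?H (subtree u e)) \<partial>E)"
    proof (intro nn_integral_mono mult_left_mono)
      fix e show "indicator {e. Bad l e} e \<le> (\<Prod>u\<in>set l. ?H (subtree u e))"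
        by (cases "Bad l e") (auto simp: Bad_def)
    qed simp
    also have "\<dots> = (\<integral>\<^sup>+ e. F e \<partial>E) * (\<Prod>u\<in>set l. \<integral>\<^sup>+ e. ?H e \<partial>E)"
      by (rule nn_integral_subtrees[OF F _ l(2) Hm]) auto
    also have "\<dots> \<le> (\<integral>\<^sup>+ e. F e \<partial>E) * (\<Prod>u\<in>set l. ennreal (1 - q))"
      by (intro mult_left_mono) (auto intro!: power_mono Hint)
    also have "(\<Prod>u\<in>set l. ennreal (1 - q)) = ennreal ((1 - q) ^ m)"
      using q(2) by (simp add: l(1) ennreal_power)
    finally show "(\<integral>\<^sup>+ e. F e * indicator {e. Bad l e} e \<partial>E) \<le> (\<integral>\<^sup>+ e. F e \<partial>E) * ennreal ((1 - q) ^ m)" .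
  qed
  then show ?thesis using q(2) by (simp add: E.emeasure_eq_measure Bad_def)
qed

lemma S_ge_subtree: "ennreal (bsize e u powr J) * S J k (subtree u e) \<le> S J (length u + k) e"
proof -
  have "ennreal (bsize e u powr J) * S J k (subtree u e) = gsum k (\<lambda>i. ennreal (bsize e (i @ u) powr J))"
    unfolding S_def gsum_cmult[symmetric] by (intro gsum_cong) (simp add: bsize_append powr_mult ennreal_mult)
  also have "\<dots> \<le> S J (length u + k) e"
    unfolding S_def gsum_add by (rule gsum_ge[of u, where f="\<lambda>u. gsum k (\<lambda>i. ennreal (bsize e (i @ u) powr J))"]) simp
  finally show ?thesis .
qed

end

context tilted
begin

text \<open>Below the \<open>2 ^ n k\<close> boxes at tree level \<open>n k\<close>, each attempt
  succeeds with probability at least \<open>k powr - K\<close>, so all fail with probability at most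
  \<open>exp (- k)\<close>. Since \<open>n k\<close> is of order \<open>ln k\<close>, such a box is
  still at least a power of \<open>1 / k\<close> in size, and only the exponent changes.\<close>

lemma AE_S_lower_on_tree:
  assumes J: "1 \<le> J" and K: "K > 0" and \<eta>: "0 < \<eta>" "\<eta> \<le> 1"
    and ev: "eventually (\<lambda>k. E.prob {e \<in> space E. ennreal (real k powr - K * \<Lambda> powr (J * real k / \<theta>)) \<le> S J k e}
      \<ge> real k powr - K) sequentially"
  shows "AE e in E. (\<forall>n. binary_tree g \<eta> n e) \<longrightarrow>
    (\<exists>K>0. eventually (\<lambda>k. ennreal (real k powr - K * \<Lambda> powr (J * real k / \<theta>)) \<le> S J k e) sequentially)"
proof -
  define G where "G k e \<longleftrightarrow> ennreal (real k powr - K * \<Lambda> powr (J * real k / \<theta>)) \<le> S J k e" for k e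
  have Gm [measurable]: "Measurable.pred E (G k)" for k unfolding G_def by measurable
  \<comment> \<open>Chosen so that \<open>2 ^ n k \<ge> k powr (K + 1)\<close>, one power of
    \<open>k\<close> more than the reciprocal success probability.\<close>
  define n where "n k = nat \<lceil>(K + 1) * log 2 (real k)\<rceil>" for k
  define Fail where "Fail k = {e \<in> space E. (\<exists>l. large_boxes (2 ^ n k) (n k * g) (\<eta> ^ n k) l e) \<and>
    (\<forall>l. large_boxes (2 ^ n k) (n k * g) (\<eta> ^ n k) l e \<longrightarrow> (\<forall>u\<in>set l. \<not> G k (subtree u e)))}" for k
  note pred_subtree[OF Gm, measurable]
  have Fm: "Fail k \<in> E.events" for k unfolding Fail_def by measurable
  have "eventually (\<lambda>k. norm (E.prob (Fail k)) \<le> exp (- 1) ^ k) sequentially"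
    using ev eventually_ge_at_top[of 1]
  proof eventually_elim
    case (elim k)
    let ?q = "real k powr - K"
    have k: "real k \<ge> 1" using elim by simp
    have q: "0 < ?q" "?q \<le> 1"
      using k K powr_mono[of "- K" 0 "real k"] by auto
    have "E.prob (Fail k) \<le> (1 - ?q) ^ (2 ^ n k)"
      unfolding Fail_def by (rule prob_all_subtrees_fail[OF Gm _ q(2)]) (use elim in \<open>simp add: G_def\<close>)
    also have "\<dots> \<le> exp (- ?q) ^ (2 ^ n k)"
      using q exp_ge_add_one_self[of "- ?q"] by (intro power_mono) auto
    also have "\<dots> = exp (- (?q * 2 ^ n k))"
      by (simp add: exp_of_nat_mult[symmetric] mult.commute)
    also have "\<dots> \<le> exp (- real k)"
    proof -
      have "real k powr (K + 1) = 2 powr ((K + 1) * log 2 (real k))"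
        using k by (simp add: powr_def log_def)
      also have "\<dots> \<le> 2 powr real (n k)"
        unfolding n_def by (intro powr_mono) linarith+
      also have "\<dots> = 2 ^ n k" by (simp add: powr_realpow)
      finally have "?q * real k powr (K + 1) \<le> ?q * 2 ^ n k" using q by (intro mult_left_mono) auto
      moreover have "?q * real k powr (K + 1) = real k" using k by (simp add: powr_add[symmetric])
      ultimately show ?thesis by simp
    qed
    also have "\<dots> = exp (- 1) ^ k" by (simp add: exp_of_nat_mult[symmetric])
    finally show ?case by simp
  qed
  moreover have "summable (\<lambda>k. exp (- 1 :: real) ^ k)" by (rule summable_geometric) simp
  ultimately have "summable (\<lambda>k. E.prob (Fail k))" by (rule summable_comparison_test_ev)
  then have "AE e in E. eventually (\<lambda>k. e \<in> space E - Fail k) sequentially"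
    by (intro borel_cantelli_AE1 Fm) (auto simp: E.emeasure_eq_measure)
  then show ?thesis
    using AE_space
  proof eventually_elim
    case (elim e)
    show ?case
    proof
      assume tree: "\<forall>n. binary_tree g \<eta> n e"
      \<comment> \<open>\<open>k powr - a\<close> is \<eta> to the power
        \<open>(K + 1) * log 2 k * J\<close>; the rounding in \<open>n k\<close> costs one more
        factor \<open>\<eta> powr J\<close>, covered by one power of \<open>k\<close> beyond
        \<open>k0\<close>.\<close>
      define a where "a = - ((K + 1) * J * ln \<eta> / ln 2)"
      have a: "a \<ge> 0" using K J \<eta> by (simp add: a_def divide_nonpos_pos mult_nonneg_nonpos)
      define K' where "K' = K + a + 1"
      have K': "K' > 0" using K a by (simp add: K'_def)
      obtain k0 :: nat where k0: "\<eta> powr - J \<le> real k0" using real_arch_simple by blast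
      have "eventually (\<lambda>k. ennreal (real k powr - K' * \<Lambda> powr (J * real k / \<theta>)) \<le> S J k e) sequentially"
        using elim(1) eventually_ge_at_top[of "max 1 k0"]
      proof eventually_elim
        case el: (elim k)
        have k: "real k \<ge> 1" "\<eta> powr - J \<le> real k" using el(2) k0 by auto
        obtain l where l: "large_boxes (2 ^ n k) (n k * g) (\<eta> ^ n k) l e"
          using binary_tree_large_boxes[of \<eta> g "n k" e] tree \<eta> by auto
        with el(1) obtain l u where l: "large_boxes (2 ^ n k) (n k * g) (\<eta> ^ n k) l e" "u \<in> set l" "G k (subtree u e)"
          unfolding Fail_def by auto
        have u: "\<eta> ^ n k \<le> bsize e u" using l by (auto simp: large_boxes_def)
        have nk: "real (n k) \<le> (K + 1) * log 2 (real k) + 1"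
          using K k by (simp add: n_def of_nat_nat)
        have "real k powr - a * real k powr - 1 \<le> real k powr - a * \<eta> powr J"
        proof (rule mult_left_mono)
          show "real k powr - 1 \<le> \<eta> powr J"
            using k \<eta> by (simp add: powr_minus field_simps)
        qed simp
        also have "\<dots> = \<eta> powr (((K + 1) * log 2 (real k) + 1) * J)"
          using k \<eta> by (simp add: powr_def log_def a_def exp_add[symmetric] field_simps)
        also have "\<dots> \<le> \<eta> powr (real (n k) * J)"
          using nk J \<eta> by (intro powr_mono' mult_right_mono) auto
        also have "\<dots> = (\<eta> ^ n k) powr J" using \<eta> by (simp add: powr_powr flip: powr_realpow)
        also have "\<dots> \<le> bsize e u powr J" using u \<eta> J by (intro powr_mono2) auto
        finally have b: "real k powr - a * real k powr - 1 \<le> bsize e u powr J" .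
        have "real k powr - K' * \<Lambda> powr (J * real k / \<theta>) =
          (real k powr - a * real k powr - 1) * (real k powr - K * \<Lambda> powr (J * real k / \<theta>))"
        proof -
          have e: "- K' = - a + - 1 + - K" by (simp add: K'_def)
          show ?thesis unfolding e powr_add by (simp only: mult_ac)
        qed
        also have "\<dots> \<le> bsize e u powr J * (real k powr - K * \<Lambda> powr (J * real k / \<theta>))"
          using b by (intro mult_right_mono) auto
        finally have "ennreal (real k powr - K' * \<Lambda> powr (J * real k / \<theta>)) \<le>
          ennreal (bsize e u powr J) * ennreal (real k powr - K * \<Lambda> powr (J * real k / \<theta>))"
          by (subst ennreal_mult[symmetric]) (auto intro!: ennreal_leI)
        also have "\<dots> \<le> ennreal (bsize e u powr J) * S J k (subtree u e)"
          using l(3) by (intro mult_left_mono) (auto simp: G_def)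
        also have "\<dots> \<le> S J (length u + k) e" by (rule S_ge_subtree)
        \<comment> \<open>The successful attempt ends \<open>n k * g\<close> generations below
          generation \<open>k\<close>; power sums decrease along generations.\<close>
        also have "\<dots> \<le> S J k e" by (rule S_antimono[OF elim(2) J]) simp
        finally show ?case .
      qed
      then show "\<exists>K>0. eventually (\<lambda>k. ennreal (real k powr - K * \<Lambda> powr (J * real k / \<theta>)) \<le> S J k e) sequentially"
        using K' by blast
    qed
  qed
qed

text \<open>A tree with given \<open>g\<close> and \<eta> exists only with probability close to 1. A
  sequence of pairs with failure bounds tending to 0 yields almost surely some tree, at the price of
  a constant \<open>K\<close> that depends on the environment.\<close>

lemma AE_S_lower:
  assumes phi: "phi \<nu> \<theta> \<ge> 0" and J: "\<theta> \<le> J" and \<theta>J: "\<theta> = J \<or> phi \<nu> \<theta> = 0"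
  shows "AE e in E. \<exists>K>0. eventually (\<lambda>k. ennreal (real k powr - K * \<Lambda> powr (J * real k / \<theta>)) \<le> S J k e) sequentially"
    (is "AE e in E. ?concl e")
proof -
  obtain K where K: "K > 0" and ev: "eventually (\<lambda>k. E.prob {e \<in> space E. ennreal (real k powr - K * \<Lambda> powr (J * real k / \<theta>)) \<le> S J k e}
    \<ge> real k powr - K) sequentially"
    using prob_S_lower[OF assms] by blast
  have J1: "1 \<le> J" using J \<theta> by simp
  define \<epsilon> where "\<epsilon> m = 1 / (36 * real (Suc m))" for m
  have \<epsilon>: "\<epsilon> m > 0" "\<epsilon> m \<le> 1 / 36" for m by (auto simp: \<epsilon>_def field_simps)
  have "\<forall>m. \<exists>g \<eta>. 0 < \<eta> \<and> \<eta> \<le> 1 \<and> E.prob {e \<in> space E. \<not> (\<exists>l. large_boxes 3 g \<eta> l e)} \<le> \<epsilon> m"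
    using ex_prob_large_boxes \<epsilon>(1) by blast
  then have "\<exists>g. \<forall>m. \<exists>\<eta>. 0 < \<eta> \<and> \<eta> \<le> 1 \<and> E.prob {e \<in> space E. \<not> (\<exists>l. large_boxes 3 (g m) \<eta> l e)} \<le> \<epsilon> m"
    by (rule choice)
  then obtain g where g: "\<forall>m. \<exists>\<eta>. 0 < \<eta> \<and> \<eta> \<le> 1 \<and> E.prob {e \<in> space E. \<not> (\<exists>l. large_boxes 3 (g m) \<eta> l e)} \<le> \<epsilon> m"
    by (rule exE)
  have "\<exists>\<eta>. \<forall>m. 0 < \<eta> m \<and> \<eta> m \<le> 1 \<and> E.prob {e \<in> space E. \<not> (\<exists>l. large_boxes 3 (g m) (\<eta> m) l e)} \<le> \<epsilon> m"
    by (rule choice[OF g])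
  then obtain \<eta> where "\<forall>m. 0 < \<eta> m \<and> \<eta> m \<le> 1 \<and> E.prob {e \<in> space E. \<not> (\<exists>l. large_boxes 3 (g m) (\<eta> m) l e)} \<le> \<epsilon> m"
    by (rule exE)
  then have g\<eta>: "0 < \<eta> m \<and> \<eta> m \<le> 1 \<and> E.prob {e \<in> space E. \<not> (\<exists>l. large_boxes 3 (g m) (\<eta> m) l e)} \<le> \<epsilon> m" for m
    by (rule spec)
  define T where "T m e \<longleftrightarrow> (\<forall>n. binary_tree (g m) (\<eta> m) n e)" for m e
  have Tm [measurable]: "Measurable.pred E (T m)" for m unfolding T_def by measurable
  have pT: "E.prob {e \<in> space E. \<not> T m e} \<le> 2 * \<epsilon> m" for m
    unfolding T_def
    by (rule prob_binary_tree[OF conjunct2[OF conjunct2[OF g\<eta>[of m]]] less_imp_le[OF \<epsilon>(1)] \<epsilon>(2)])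
  have "E.prob {e \<in> space E. \<forall>m. \<not> T m e} \<le> 0"
  proof (rule LIMSEQ_le_const)
    have "(\<lambda>m. 1 / real (Suc m)) \<longlonglongrightarrow> 0" by (rule LIMSEQ_Suc) (rule lim_1_over_n)
    from tendsto_mult_left[OF this, of "1 / 18"]
    have "(\<lambda>m. 1 / 18 * (1 / real (Suc m))) \<longlonglongrightarrow> 0" by simp
    moreover have "2 * \<epsilon> m = 1 / 18 * (1 / real (Suc m))" for m by (simp add: \<epsilon>_def field_simps)
    ultimately show "(\<lambda>m. 2 * \<epsilon> m) \<longlonglongrightarrow> 0" by simp
    have "E.prob {e \<in> space E. \<forall>m. \<not> T m e} \<le> 2 * \<epsilon> m" for m
    proof -
      have "E.prob {e \<in> space E. \<forall>m. \<not> T m e} \<le> E.prob {e \<in> space E. \<not> T m e}"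
        by (intro E.finite_measure_mono) auto
      then show ?thesis using pT[of m] by simp
    qed
    then show "\<exists>N. \<forall>m\<ge>N. E.prob {e \<in> space E. \<forall>m. \<not> T m e} \<le> 2 * \<epsilon> m" by blast
  qed
  then have "emeasure E {e \<in> space E. \<forall>m. \<not> T m e} = 0"
    using measure_nonneg[of E "{e \<in> space E. \<forall>m. \<not> T m e}"] by (simp add: E.emeasure_eq_measure)
  then have "AE e in E. \<exists>m. T m e"
    by (subst AE_iff_measurable[of "{e \<in> space E. \<forall>m. \<not> T m e}"]) auto
  moreover have "AE e in E. \<forall>m. T m e \<longrightarrow> ?concl e"
    unfolding AE_all_countable T_def
    using g\<eta> by (intro allI AE_S_lower_on_tree[OF J1 K _ _ ev]) auto
  ultimately show ?thesis by eventually_elim blast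
qed

end

section \<open>Collisions of independent balls\<close>

lemma prob_Pi_pmf_all_in:
  assumes "finite I"
  shows "measure_pmf.prob (Pi_pmf I d (\<lambda>_. \<kappa>)) {f. \<forall>x\<in>I. f x \<in> A} = measure_pmf.prob \<kappa> A ^ card I"
proof -
  have "{f. \<forall>x\<in>I. f x \<in> A} = Pi I (\<lambda>_. A)" by auto
  then show ?thesis using measure_Pi_pmf_Pi[OF assms, of d "\<lambda>_. \<kappa>" "\<lambda>_. A"] by simp
qed

lemma prob_hit:
  assumes "finite I"
  shows "measure_pmf.prob (Pi_pmf I d (\<lambda>_. \<kappa>)) {f. \<exists>x\<in>I. f x = i} = 1 - (1 - pmf \<kappa> i) ^ card I"
proof -
  let ?P = "Pi_pmf I d (\<lambda>_. \<kappa>)"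
  have "measure_pmf.prob ?P {f. \<exists>x\<in>I. f x = i} = measure_pmf.prob ?P (UNIV - {f. \<forall>x\<in>I. f x \<in> - {i}})"
    by (rule arg_cong[where f="measure_pmf.prob ?P"]) auto
  also have "\<dots> = 1 - measure_pmf.prob ?P {f. \<forall>x\<in>I. f x \<in> - {i}}"
    using measure_pmf.prob_compl[of "{f. \<forall>x\<in>I. f x \<in> - {i}}" ?P] by simp
  also have "measure_pmf.prob ?P {f. \<forall>x\<in>I. f x \<in> - {i}} = measure_pmf.prob \<kappa> (- {i}) ^ card I"
    by (rule prob_Pi_pmf_all_in[OF assms])
  also have "measure_pmf.prob \<kappa> (- {i}) = 1 - pmf \<kappa> i"
    using measure_pmf.prob_compl[of "{i}" \<kappa>] by (simp add: Compl_eq_Diff_UNIV measure_pmf_single)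
  finally show ?thesis .
qed

text \<open>Inclusion--exclusion and \<open>1 - a - b \<le> (1 - a) * (1 - b)\<close>: balls that
  hit one box are missing for the other.\<close>

lemma prob_hit_both_le:
  assumes I: "finite I" and ne: "i \<noteq> i'"
  shows "measure_pmf.prob (Pi_pmf I d (\<lambda>_. \<kappa>)) {f. (\<exists>x\<in>I. f x = i) \<and> (\<exists>x\<in>I. f x = i')} \<le>
    (1 - (1 - pmf \<kappa> i) ^ card I) * (1 - (1 - pmf \<kappa> i') ^ card I)"
proof -
  let ?P = "Pi_pmf I d (\<lambda>_. \<kappa>)" and ?m = "card I" and ?a = "pmf \<kappa> i" and ?b = "pmf \<kappa> i'"
  let ?A = "{f. \<exists>x\<in>I. f x = i}" and ?B = "{f. \<exists>x\<in>I. f x = i'}"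
  have ab: "?a + ?b \<le> 1"
  proof -
    have "?a + ?b = measure_pmf.prob \<kappa> {i, i'}"
      using ne by (subst measure_measure_pmf_finite) auto
    then show ?thesis by simp
  qed
  have ab': "measure_pmf.prob \<kappa> (- {i, i'}) = 1 - ?a - ?b"
  proof -
    have "measure_pmf.prob \<kappa> (- {i, i'}) = 1 - measure_pmf.prob \<kappa> {i, i'}"
      using measure_pmf.prob_compl[of "{i, i'}" \<kappa>] by (simp add: Compl_eq_Diff_UNIV)
    also have "measure_pmf.prob \<kappa> {i, i'} = ?a + ?b"
      using ne by (subst measure_measure_pmf_finite) auto
    finally show ?thesis by simp
  qed
  have "measure_pmf.prob ?P (?A \<union> ?B) = 1 - (1 - ?a - ?b) ^ ?m"
  proof -
    have "measure_pmf.prob ?P (?A \<union> ?B) = measure_pmf.prob ?P (UNIV - {f. \<forall>x\<in>I. f x \<in> - {i, i'}})"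
      by (rule arg_cong[where f="measure_pmf.prob ?P"]) auto
    also have "\<dots> = 1 - measure_pmf.prob ?P {f. \<forall>x\<in>I. f x \<in> - {i, i'}}"
      using measure_pmf.prob_compl[of "{f. \<forall>x\<in>I. f x \<in> - {i, i'}}" ?P] by simp
    also have "measure_pmf.prob ?P {f. \<forall>x\<in>I. f x \<in> - {i, i'}} = (1 - ?a - ?b) ^ ?m"
      unfolding ab'[symmetric] by (rule prob_Pi_pmf_all_in[OF I])
    finally show ?thesis .
  qed
  moreover have "measure_pmf.prob ?P (?A \<union> ?B) = measure_pmf.prob ?P ?A + measure_pmf.prob ?P ?B - measure_pmf.prob ?P (?A \<inter> ?B)"
    by (rule measure_Un3) (auto simp: measure_pmf.fmeasurable_eq_sets)
  ultimately have "measure_pmf.prob ?P (?A \<inter> ?B) = 1 - (1 - ?a) ^ ?m - (1 - ?b) ^ ?m + (1 - ?a - ?b) ^ ?m"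
    using prob_hit[OF I, of d \<kappa> i] prob_hit[OF I, of d \<kappa> i'] by simp
  also have "(1 - ?a - ?b) ^ ?m \<le> ((1 - ?a) * (1 - ?b)) ^ ?m"
    using ab by (intro power_mono) (auto simp: algebra_simps)
  also have "((1 - ?a) * (1 - ?b)) ^ ?m = (1 - ?a) ^ ?m * (1 - ?b) ^ ?m" by (rule power_mult_distrib)
  finally have "measure_pmf.prob ?P (?A \<inter> ?B) \<le> (1 - (1 - ?a) ^ ?m) * (1 - (1 - ?b) ^ ?m)"
    by (simp add: left_diff_distrib right_diff_distrib)
  moreover have "?A \<inter> ?B = {f. (\<exists>x\<in>I. f x = i) \<and> (\<exists>x\<in>I. f x = i')}" by auto
  ultimately show ?thesis by simp
qed

text \<open>With \<open>y = m * q\<close>, one has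
  \<open>(1 - q) ^ m \<le> exp (- y) \<le> 1 / (1 + y)\<close>.\<close>

lemma hit_prob_ge:
  fixes q t :: real
  assumes q: "0 \<le> q" "q \<le> 1" and t: "real m * q \<le> t"
  shows "real m * q / (1 + t) \<le> 1 - (1 - q) ^ m"
proof -
  let ?y = "real m * q"
  have y: "0 \<le> ?y" using q by simp
  have "(1 - q) ^ m \<le> exp (- q) ^ m"
    using q exp_ge_add_one_self[of "- q"] by (intro power_mono) auto
  also have "\<dots> = exp (- ?y)" by (simp add: exp_of_nat_mult[symmetric])
  also have "\<dots> \<le> 1 / (1 + ?y)"
    using exp_ge_add_one_self[of ?y] y by (simp add: exp_minus field_simps)
  finally have "?y / (1 + ?y) \<le> 1 - (1 - q) ^ m" using y by (simp add: field_simps)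
  moreover have "?y / (1 + t) \<le> ?y / (1 + ?y)" using y t by (intro divide_left_mono) auto
  ultimately show ?thesis by simp
qed

text \<open>The outer index is the group, the inner one the ball. Product pmfs take default values
  outside their index sets; arrays with exactly these defaults are the ones whose probability is a
  plain product.\<close>

definition sample :: "nat \<Rightarrow> nat \<Rightarrow> 'a \<Rightarrow> 'a pmf \<Rightarrow> (nat \<Rightarrow> nat \<Rightarrow> 'a) pmf" where
  "sample j m d \<kappa> = Pi_pmf {..<j} (\<lambda>_. d) (\<lambda>_. Pi_pmf {..<m} d (\<lambda>_. \<kappa>))"

text \<open>Balls are thrown in \<open>j\<close> groups of \<open>m\<close> balls, and only boxes hit by each of the groups are counted.
  Negative correlation makes the variance of their number at most its mean.\<close>

lemma prob_no_collision_le: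
  fixes t :: real
  assumes B: "finite B" and t: "0 < t" and m: "0 < m" and \<sigma>: "0 < (\<Sum>i\<in>B. pmf \<kappa> i ^ j)"
  shows "measure_pmf.prob (sample j m d \<kappa>) {f. \<not> (\<exists>i\<in>B. \<forall>g<j. \<exists>l<m. f g l = i)} \<le>
    real j * exp (- t) + ((1 + t) / real m) ^ j / (\<Sum>i\<in>B. pmf \<kappa> i ^ j)"
\<comment> \<open>A box with at least \<open>t\<close> expected balls per group is by itself hit by
  every group, except with probability \<open>j * exp (- t)\<close>. If there is none, hitting
  probabilities are linear in the box sizes up to the factor \<open>1 + t\<close>, and the second
  moment method applies.\<close>
proof (cases "\<exists>i\<in>B. t \<le> real m * pmf \<kappa> i")
  case True
  then obtain i where i: "i \<in> B" "t \<le> real m * pmf \<kappa> i" by blast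
  let ?P = "sample j m d \<kappa>"
  have "measure_pmf.prob ?P {f. \<not> (\<exists>i\<in>B. \<forall>g<j. \<exists>l<m. f g l = i)} \<le>
    measure_pmf.prob ?P {f. \<not> (\<forall>g\<in>{..<j}. f g \<in> {h. \<exists>l\<in>{..<m}. h l = i})}"
  proof (rule measure_pmf.finite_measure_mono)
    show "{f. \<not> (\<exists>i\<in>B. \<forall>g<j. \<exists>l<m. f g l = i)} \<subseteq> {f. \<not> (\<forall>g\<in>{..<j}. f g \<in> {h. \<exists>l\<in>{..<m}. h l = i})}"
      using i(1) by (simp add: subset_eq Bex_def Ball_def)
  qed simp
  also have "{f. \<not> (\<forall>g\<in>{..<j}. f g \<in> {h. \<exists>l\<in>{..<m}. h l = i})} = UNIV - {f. \<forall>g\<in>{..<j}. f g \<in> {h. \<exists>l\<in>{..<m}. h l = i}}"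
    by blast
  also have "measure_pmf.prob ?P \<dots> = 1 - measure_pmf.prob ?P {f. \<forall>g\<in>{..<j}. f g \<in> {h. \<exists>l\<in>{..<m}. h l = i}}"
    using measure_pmf.prob_compl[of "{f. \<forall>g\<in>{..<j}. f g \<in> {h. \<exists>l\<in>{..<m}. h l = i}}" ?P]
    by simp
  also have "measure_pmf.prob ?P {f. \<forall>g\<in>{..<j}. f g \<in> {h. \<exists>l\<in>{..<m}. h l = i}} = (1 - (1 - pmf \<kappa> i) ^ m) ^ j"
    unfolding sample_def by (subst prob_Pi_pmf_all_in, simp, subst prob_hit) simp_all
  also have "1 - (1 - (1 - pmf \<kappa> i) ^ m) ^ j \<le> real j * exp (- t)"
  proof -
    have "(1 - pmf \<kappa> i) ^ m \<le> exp (- pmf \<kappa> i) ^ m"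
      using exp_ge_add_one_self[of "- pmf \<kappa> i"] by (intro power_mono) (auto simp: pmf_le_1)
    also have "\<dots> = exp (- (real m * pmf \<kappa> i))" by (simp add: exp_of_nat_mult[symmetric])
    also have "\<dots> \<le> exp (- t)" using i(2) by simp
    finally have *: "(1 - pmf \<kappa> i) ^ m \<le> exp (- t)" .
    have le1: "(1 - pmf \<kappa> i) ^ m \<le> 1" by (intro power_le_one) (auto simp: pmf_le_1)
    have "1 + real j * (- ((1 - pmf \<kappa> i) ^ m)) \<le> (1 + - ((1 - pmf \<kappa> i) ^ m)) ^ j"
      using le1 by (intro Bernoulli_inequality) auto
    moreover have "real j * (1 - pmf \<kappa> i) ^ m \<le> real j * exp (- t)" using * by (intro mult_left_mono) auto
    ultimately show ?thesis by simp
  qed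
  also have "\<dots> \<le> real j * exp (- t) + ((1 + t) / real m) ^ j / (\<Sum>i\<in>B. pmf \<kappa> i ^ j)"
    using t \<sigma> by simp
  finally show ?thesis .
next
  case False
  then have small: "real m * pmf \<kappa> i \<le> t" if "i \<in> B" for i using that by (auto simp: not_le)
  let ?P = "sample j m d \<kappa>" and ?\<sigma> = "\<Sum>i\<in>B. pmf \<kappa> i ^ j"
  define w where "w i = 1 - (1 - pmf \<kappa> i) ^ m" for i
  have w0: "0 \<le> w i" for i unfolding w_def by (simp add: power_le_one pmf_le_1)
  define hit where "hit i = {f :: nat \<Rightarrow> nat \<Rightarrow> 'a. \<forall>g\<in>{..<j}. f g \<in> {h. \<exists>l\<in>{..<m}. h l = i}}" for i
  have hit: "measure_pmf.prob ?P (hit i) = w i ^ j" for i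
    unfolding hit_def sample_def w_def by (subst prob_Pi_pmf_all_in, simp, subst prob_hit) simp_all
  have hit2: "measure_pmf.prob ?P (hit i \<inter> hit i') \<le> w i ^ j * w i' ^ j" if "i \<noteq> i'" for i i'
  proof -
    have "hit i \<inter> hit i' = {f. \<forall>g\<in>{..<j}. f g \<in> {h. (\<exists>l\<in>{..<m}. h l = i) \<and> (\<exists>l\<in>{..<m}. h l = i')}}"
      by (auto simp: hit_def)
    then have "measure_pmf.prob ?P (hit i \<inter> hit i') =
      measure_pmf.prob (Pi_pmf {..<m} d (\<lambda>_. \<kappa>)) {h. (\<exists>l\<in>{..<m}. h l = i) \<and> (\<exists>l\<in>{..<m}. h l = i')} ^ j"
      unfolding sample_def by (simp only: prob_Pi_pmf_all_in[OF finite_lessThan] card_lessThan)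
    also have "\<dots> \<le> (w i * w i') ^ j"
      using prob_hit_both_le[OF finite_lessThan that, of m d \<kappa>] by (intro power_mono) (auto simp: w_def)
    finally show ?thesis by (simp add: power_mult_distrib)
  qed
  define Z where "Z f = (\<Sum>i\<in>B. indicator (hit i) f :: real)" for f
  define x where "x = (\<Sum>i\<in>B. w i ^ j)"
  have "((real m / (1 + t)) ^ j) * ?\<sigma> \<le> x"
    unfolding x_def sum_distrib_left
  proof (rule sum_mono)
    fix i assume i: "i \<in> B"
    have "(real m / (1 + t)) ^ j * pmf \<kappa> i ^ j = (real m * pmf \<kappa> i / (1 + t)) ^ j"
      by (simp add: power_mult_distrib[symmetric])
    also have "\<dots> \<le> w i ^ j"
      unfolding w_def using t small[OF i] by (intro power_mono hit_prob_ge) (auto simp: pmf_le_1)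
    finally show "(real m / (1 + t)) ^ j * pmf \<kappa> i ^ j \<le> w i ^ j" .
  qed
  moreover have "0 < ((real m / (1 + t)) ^ j) * ?\<sigma>" using t m \<sigma> by simp
  ultimately have x: "0 < x" "1 / x \<le> 1 / (((real m / (1 + t)) ^ j) * ?\<sigma>)"
    by (auto intro!: divide_left_mono mult_pos_pos)
  have int: "integrable (measure_pmf ?P) (\<lambda>f. indicator A f :: real)" for A
    by (rule measure_pmf.integrable_const_bound[where B=1]) auto
  have EZ: "measure_pmf.expectation ?P Z = x"
    unfolding Z_def x_def by (simp add: int hit)
  have Z2: "(Z f)\<^sup>2 = (\<Sum>i\<in>B. \<Sum>i'\<in>B. indicator (hit i \<inter> hit i') f)" for f
    unfolding Z_def power2_eq_square sum_product by (simp add: indicator_inter_arith)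
  have "measure_pmf.expectation ?P (\<lambda>f. (Z f)\<^sup>2) = (\<Sum>i\<in>B. \<Sum>i'\<in>B. measure_pmf.prob ?P (hit i \<inter> hit i'))"
    unfolding Z2 by (simp add: int)
  also have "\<dots> \<le> (\<Sum>i\<in>B. \<Sum>i'\<in>B. w i ^ j * w i' ^ j + (if i = i' then w i ^ j else 0))"
  proof (intro sum_mono)
    fix i i'
    show "measure_pmf.prob ?P (hit i \<inter> hit i') \<le> w i ^ j * w i' ^ j + (if i = i' then w i ^ j else 0)"
      using hit2[of i i'] hit[of i] w0[of i] by (cases "i = i'") auto
  qed
  also have "\<dots> = x * x + x"
    unfolding x_def using B by (simp add: sum.distrib sum_product)
  finally have EZ2: "measure_pmf.expectation ?P (\<lambda>f. (Z f)\<^sup>2) \<le> x * x + x" .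
  have intZ: "integrable (measure_pmf ?P) Z" "integrable (measure_pmf ?P) (\<lambda>f. (Z f)\<^sup>2)"
    unfolding Z2 unfolding Z_def by (auto intro!: Bochner_Integration.integrable_sum int)
  \<comment> \<open>Chebyshev's inequality: \<open>(Z - x)\<^sup>2\<close> is
    \<open>x\<^sup>2\<close> where \<open>Z = 0\<close>, and the variance is at most
    \<open>x\<close>.\<close>
  have "measure_pmf.prob ?P {f. Z f = 0} * x\<^sup>2 = measure_pmf.expectation ?P (\<lambda>f. x\<^sup>2 * indicator {f. Z f = 0} f)"
    by (simp add: int mult.commute)
  also have "\<dots> \<le> measure_pmf.expectation ?P (\<lambda>f. (Z f)\<^sup>2 - 2 * x * Z f + x\<^sup>2)"
  proof (rule integral_mono)
    show "integrable (measure_pmf ?P) (\<lambda>f. x\<^sup>2 * indicator {f. Z f = 0} f)" using int by simp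
    show "integrable (measure_pmf ?P) (\<lambda>f. (Z f)\<^sup>2 - 2 * x * Z f + x\<^sup>2)" using intZ by simp
    fix f
    have "0 \<le> (Z f - x)\<^sup>2" by simp
    then show "x\<^sup>2 * indicator {f. Z f = 0} f \<le> (Z f)\<^sup>2 - 2 * x * Z f + x\<^sup>2"
      by (auto simp: indicator_def power2_eq_square algebra_simps)
  qed
  also have "\<dots> = measure_pmf.expectation ?P (\<lambda>f. (Z f)\<^sup>2) - 2 * x * x + x\<^sup>2"
    using intZ EZ by simp
  also have "\<dots> \<le> x" using EZ2 by (simp add: power2_eq_square)
  finally have "measure_pmf.prob ?P {f. Z f = 0} \<le> 1 / x" using x(1) by (simp add: field_simps power2_eq_square)
  moreover have "measure_pmf.prob ?P {f. \<not> (\<exists>i\<in>B. \<forall>g<j. \<exists>l<m. f g l = i)} \<le> measure_pmf.prob ?P {f. Z f = 0}"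
  proof (rule measure_pmf.finite_measure_mono)
    show "{f. \<not> (\<exists>i\<in>B. \<forall>g<j. \<exists>l<m. f g l = i)} \<subseteq> {f. Z f = 0}"
    proof safe
      fix f assume *: "\<not> (\<exists>i\<in>B. \<forall>g<j. \<exists>l<m. f g l = i)"
      have "f \<notin> hit i" if "i \<in> B" for i
        using * that unfolding hit_def by (simp add: Ball_def Bex_def)
      then show "Z f = 0" unfolding Z_def by (intro sum.neutral) simp
    qed
  qed simp
  moreover have "1 / (((real m / (1 + t)) ^ j) * ?\<sigma>) = ((1 + t) / real m) ^ j / ?\<sigma>"
    using t m by (simp add: power_divide field_simps)
  moreover have "0 \<le> real j * exp (- t)" by simp
  ultimately show ?thesis using x(2) by linarith
qed

section \<open>The joint law of environment and balls\<close>

context splitting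
begin

text \<open>Law of the box of a single ball at generation \<open>k\<close>, given the environment;
  meaningful on \<open>space E\<close>, where the sizes of a generation sum to 1.\<close>

definition box_pmf :: "nat \<Rightarrow> (nat list \<Rightarrow> nat measure) \<Rightarrow> nat list pmf" where
  "box_pmf k e = embed_pmf (\<lambda>i. if length i = k then bsize e i else 0)"

lemma pmf_box_pmf: "e \<in> space E \<Longrightarrow> pmf (box_pmf k e) i = (if length i = k then bsize e i else 0)"
  unfolding box_pmf_def
proof (rule pmf_embed_pmf)
  assume e: "e \<in> space E"
  have "(\<integral>\<^sup>+ i. ennreal (if length i = k then bsize e i else 0) \<partial>count_space UNIV) = gsum k (\<lambda>i. ennreal (bsize e i))"
    unfolding gsum_def by (subst nn_integral_count_space_indicator) (auto intro!: nn_integral_cong simp: indicator_def)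
  then show "(\<integral>\<^sup>+ i. ennreal (if length i = k then bsize e i else 0) \<partial>count_space UNIV) = 1"
    using gsum_bsize[OF e] by simp
qed auto

end

context nested_occupancy
begin

lemma nu_eq: "\<nu> = distr M prob_on_labels (\<rho> [])"
  using splitting_law by simp

lemma measurable_rho [measurable]: "\<rho> i \<in> measurable M prob_on_labels"
  using splitting_indep by (simp add: indep_vars_def)

lemma splitting_nu: "splitting \<nu>"
proof -
  interpret N: prob_space \<nu> unfolding nu_eq by (rule prob_space_distr) measurable
  show ?thesis by unfold_locales (simp add: nu_eq)
qed

sublocale sp: splitting \<nu> by (rule splitting_nu)

abbreviation env :: "'w \<Rightarrow> nat list \<Rightarrow> nat measure" where
  "env \<omega> \<equiv> \<lambda>i. \<rho> i \<omega>"

lemma sets_E: "sets sp.E = sets (\<Pi>\<^sub>M i\<in>UNIV. prob_on_labels)"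
  by (intro sets_PiM_cong) (auto simp: sp.sets_nu)

lemma measurable_env: "env \<in> measurable M (\<Pi>\<^sub>M i\<in>UNIV. prob_on_labels)"
  by (rule measurable_PiM_single') (auto simp: space_PiM measurable_space[OF measurable_rho])

lemma measurable_env_E [measurable]: "env \<in> measurable M sp.E"
  using measurable_env by (simp add: sets_E cong: measurable_cong_sets)

lemma distr_env: "distr M sp.E env = sp.E"
proof -
  have "distr M (\<Pi>\<^sub>M i\<in>UNIV. prob_on_labels) (\<lambda>\<omega>. \<lambda>i\<in>UNIV. \<rho> i \<omega>) = (\<Pi>\<^sub>M i\<in>UNIV. distr M prob_on_labels (\<rho> i))"
    using splitting_indep by (subst (asm) indep_vars_iff_distr_eq_PiM') auto
  also have "\<dots> = sp.E" by (simp add: splitting_law)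
  finally show ?thesis
    by (simp add: restrict_UNIV sets_E cong: distr_cong)
qed

abbreviation F :: "'w measure" where "F \<equiv> environment M \<rho>"

lemma space_F: "space F = space M"
  by (simp add: environment_def)

lemma sets_F: "sets F = {env -` A \<inter> space M | A. A \<in> sets sp.E}"
  unfolding environment_def sets_E using measurable_space[OF measurable_env]
  by (subst sets_vimage_algebra2) auto

lemma subalgebra_F: "subalgebra M F"
  unfolding subalgebra_def space_F sets_F using measurable_sets[OF measurable_env_E] by auto

sublocale fm: finite_measure_subalgebra M F
  by unfold_locales (rule subalgebra_F)

lemma env_space: "\<omega> \<in> space M \<Longrightarrow> env \<omega> \<in> space sp.E"
  using measurable_space[OF measurable_env_E] .

lemma AE_env: "AE e in sp.E. P e \<Longrightarrow> AE \<omega> in M. P (env \<omega>)"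
  using AE_distrD[OF measurable_env_E, of P] unfolding distr_env .

lemma measurable_X_PiM: "X l \<in> measurable M (\<Pi>\<^sub>M k\<in>UNIV. count_space UNIV)"
  using balls_cond_indep by (simp add: cond_indep_vars_def)

lemma measurable_X [measurable]: "(\<lambda>\<omega>. X l \<omega> k) \<in> measurable M (count_space UNIV)"
  using measurable_compose[OF measurable_X_PiM measurable_component_singleton[of k UNIV]] by simp

abbreviation bs :: "'w \<Rightarrow> nat list \<Rightarrow> real" where "bs \<omega> \<equiv> bsize (env \<omega>)"

lemma box_size_eq_bs: "box_size \<rho> \<omega> i = bs \<omega> i"
  by (rule box_size_eq_bsize)

lemma measurable_bs [measurable]: "(\<lambda>\<omega>. bs \<omega> i) \<in> borel_measurable M"
  by (rule measurable_compose[OF measurable_env_E sp.measurable_bsize])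

lemma bs_le_1: "\<omega> \<in> space M \<Longrightarrow> bs \<omega> i \<le> 1"
  by (intro sp.bsize_le_1 env_space)

lemma real_cond_exp_indicator_AE:
  assumes "AE \<omega> in M. \<omega> \<in> A \<longleftrightarrow> \<omega> \<in> B" and [measurable]: "A \<in> events" "B \<in> events"
  shows "AE \<omega> in M. real_cond_exp M F (indicator A) \<omega> = real_cond_exp M F (indicator B) \<omega>"
  by (rule fm.real_cond_exp_cong) (use assms in \<open>auto simp: indicator_def elim: eventually_mono\<close>)

lemma prob_eq_expectation:
  assumes "A \<in> events" "AE \<omega> in M. real_cond_exp M F (indicator A) \<omega> = f \<omega>"
    and [measurable]: "f \<in> borel_measurable M"
  shows "prob A = expectation f"
proof -
  have i: "integrable M (indicator A :: 'w \<Rightarrow> real)" using assms(1) by (simp add: emeasure_eq_measure)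
  have "prob A = expectation (indicator A)" using assms(1) by simp
  also have "\<dots> = expectation (real_cond_exp M F (indicator A))"
    by (rule fm.real_cond_exp_int(2)[OF i, symmetric])
  also have "\<dots> = expectation f" using assms(2) by (intro integral_cong_AE) auto
  finally show ?thesis .
qed

text \<open>The transition probabilities out of generation \<open>k\<close> exhaust the whole mass, so almost surely
  the box at generation \<open>Suc k\<close> is a child of the box at generation \<open>k\<close>.\<close>

lemma ball_box_step:
  assumes IH: "\<And>i. length i = k \<Longrightarrow> AE \<omega> in M. real_cond_exp M F (indicator {\<omega>' \<in> space M. X l \<omega>' k = i}) \<omega> = bs \<omega> i"
  shows "AE \<omega> in M. length (X l \<omega> k) = k \<and> (\<exists>c. X l \<omega> (Suc k) = c # X l \<omega> k)"
    and "\<And>i. length i = Suc k \<Longrightarrow>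
      AE \<omega> in M. real_cond_exp M F (indicator {\<omega>' \<in> space M. X l \<omega>' (Suc k) = i}) \<omega> = bs \<omega> i"
proof -
  \<comment> \<open>\<open>tl i\<close> is the parent of \<open>i\<close>, so \<open>D i\<close> is
    the event whose conditional probability \<open>ball_step\<close> provides.\<close>
  define D where "D i = {\<omega> \<in> space M. X l \<omega> k = tl i \<and> X l \<omega> (Suc k) = i}" for i
  have Dm [measurable]: "D i \<in> events" for i unfolding D_def by measurable
  have Dc: "AE \<omega> in M. real_cond_exp M F (indicator (D i)) \<omega> = bs \<omega> i" if i: "length i = Suc k" for i
  proof -
    obtain c u where cu: "i = c # u" "length u = k" using i by (cases i) auto
    have D: "D i = {\<omega>' \<in> space M. X l \<omega>' (length u) = u \<and> X l \<omega>' (Suc (length u)) = c # u}"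
      using cu by (auto simp: D_def)
    have "AE \<omega> in M. real_cond_exp M F (indicator {\<omega>' \<in> space M. X l \<omega>' (length u) = u}) \<omega> = bs \<omega> u"
      using IH[OF cu(2)] by (simp only: cu(2))
    then show ?thesis
      using ball_step[of l u c] unfolding D by eventually_elim (simp add: cu(1))
  qed
  have pD: "emeasure M (D i) = (\<integral>\<^sup>+ \<omega>. ennreal (bs \<omega> i) \<partial>M)" if i: "length i = Suc k" for i
  proof -
    have "prob (D i) = expectation (\<lambda>\<omega>. bs \<omega> i)" by (rule prob_eq_expectation[OF Dm Dc[OF i]]) measurable
    moreover have "integrable M (\<lambda>\<omega>. bs \<omega> i)"
      by (rule integrable_const_bound[where B=1]) (auto simp: bs_le_1)
    ultimately show ?thesis by (simp add: emeasure_eq_measure nn_integral_eq_integral)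
  qed
  define U where "U = (\<Union>i\<in>{i. length i = Suc k}. D i)"
  have Um [measurable]: "U \<in> events" unfolding U_def by (intro sets.countable_UN') auto
  have "emeasure M U = (\<integral>\<^sup>+ i. emeasure M (D i) \<partial>count_space {i. length i = Suc k})"
    unfolding U_def by (rule emeasure_UN_countable) (auto simp: disjoint_family_on_def D_def)
  also have "\<dots> = gsum (Suc k) (\<lambda>i. \<integral>\<^sup>+ \<omega>. ennreal (bs \<omega> i) \<partial>M)"
    unfolding gsum_def by (intro nn_integral_cong) (simp add: pD)
  also have "\<dots> = (\<integral>\<^sup>+ \<omega>. gsum (Suc k) (\<lambda>i. ennreal (bs \<omega> i)) \<partial>M)"
    by (rule nn_integral_gsum[symmetric]) measurable
  also have "\<dots> = (\<integral>\<^sup>+ \<omega>. 1 \<partial>M)"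
    by (intro nn_integral_cong sp.gsum_bsize env_space)
  finally have "emeasure M U = 1" by (simp add: emeasure_space_1)
  then have "prob U = 1" by (simp add: measure_def)
  then have AEU: "AE \<omega> in M. \<omega> \<in> U" by (simp add: prob_eq_1)
  then show "AE \<omega> in M. length (X l \<omega> k) = k \<and> (\<exists>c. X l \<omega> (Suc k) = c # X l \<omega> k)"
  proof eventually_elim
    case (elim \<omega>)
    then obtain i where i: "length i = Suc k" "\<omega> \<in> D i" by (auto simp: U_def)
    then show ?case by (cases i) (auto simp: D_def)
  qed
  fix i :: "nat list" assume i: "length i = Suc k"
  have "AE \<omega> in M. \<omega> \<in> {\<omega>' \<in> space M. X l \<omega>' (Suc k) = i} \<longleftrightarrow> \<omega> \<in> D i"
    using AEU by eventually_elim (auto simp: U_def D_def)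
  then have "AE \<omega> in M. real_cond_exp M F (indicator {\<omega>' \<in> space M. X l \<omega>' (Suc k) = i}) \<omega> = real_cond_exp M F (indicator (D i)) \<omega>"
    by (rule real_cond_exp_indicator_AE) measurable
  then show "AE \<omega> in M. real_cond_exp M F (indicator {\<omega>' \<in> space M. X l \<omega>' (Suc k) = i}) \<omega> = bs \<omega> i"
    using Dc[OF i] by eventually_elim simp
qed

lemma ball_box: "length i = k \<Longrightarrow> AE \<omega> in M. real_cond_exp M F (indicator {\<omega>' \<in> space M. X l \<omega>' k = i}) \<omega> = bs \<omega> i"
proof (induction k arbitrary: i)
  case 0
  then have i: "i = []" by simp
  have "AE \<omega> in M. \<omega> \<in> {\<omega>' \<in> space M. X l \<omega>' 0 = i} \<longleftrightarrow> \<omega> \<in> space M"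
    using ball_start[of l] by eventually_elim (simp add: i)
  then have "AE \<omega> in M. real_cond_exp M F (indicator {\<omega>' \<in> space M. X l \<omega>' 0 = i}) \<omega> = real_cond_exp M F (indicator (space M)) \<omega>"
    by (rule real_cond_exp_indicator_AE) measurable
  moreover have "AE \<omega> in M. real_cond_exp M F (indicator (space M)) \<omega> = indicator (space M) \<omega>"
  proof (rule fm.real_cond_exp_F_meas)
    have "space M \<in> sets F" using sets.top[of F] by (simp add: space_F)
    then show "(indicator (space M) :: 'w \<Rightarrow> real) \<in> borel_measurable F" by simp
  qed (simp add: emeasure_space_1)
  ultimately show ?case using AE_space by eventually_elim (simp add: i)
next
  case (Suc k)
  show ?case by (rule ball_box_step(2)[OF Suc.IH Suc.prems])
qed

lemma AE_ball_path: "AE \<omega> in M. \<forall>l k. length (X l \<omega> k) = k \<and> (\<exists>c. X l \<omega> (Suc k) = c # X l \<omega> k)"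
  unfolding AE_all_countable by (intro allI ball_box_step(1) ball_box)

text \<open>Extends the formula to nodes of the wrong length, which a ball almost surely never
  occupies, so that products over arbitrary arrays need no side condition.\<close>

lemma ball_box': "AE \<omega> in M. real_cond_exp M F (indicator {\<omega>' \<in> space M. X l \<omega>' k = i}) \<omega> = (if length i = k then bs \<omega> i else 0)"
proof (cases "length i = k")
  case False
  have "AE \<omega> in M. \<omega> \<in> {\<omega>' \<in> space M. X l \<omega>' k = i} \<longleftrightarrow> \<omega> \<in> {}"
    using AE_ball_path by eventually_elim (use False in auto)
  then have "AE \<omega> in M. real_cond_exp M F (indicator {\<omega>' \<in> space M. X l \<omega>' k = i}) \<omega> = real_cond_exp M F (indicator {}) \<omega>"
    by (rule real_cond_exp_indicator_AE) measurable
  moreover have "AE \<omega> in M. real_cond_exp M F (indicator {}) \<omega> = indicator {} \<omega>"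
    by (rule fm.real_cond_exp_F_meas) auto
  ultimately show ?thesis by eventually_elim (use False in simp)
qed (use ball_box in simp)

text \<open>The joint law of the environment and finitely many balls at one generation. Conditional
  independence and \<open>ball_box'\<close> give the conditional probability; it may be integrated
  over an event of the environment as this event lies in \<open>F\<close>. Later estimates use this
  formula and no conditional expectations.\<close>

lemma emeasure_env_balls:
  assumes A: "A \<in> sets sp.E" and J: "finite J"
  shows "emeasure M {\<omega> \<in> space M. env \<omega> \<in> A \<and> (\<forall>l\<in>J. X l \<omega> k = c l)} =
    (\<integral>\<^sup>+ e. indicator A e * ennreal (\<Prod>l\<in>J. if length (c l) = k then bsize e (c l) else 0) \<partial>sp.E)"
proof -
  let ?p = "\<lambda>\<omega>. \<Prod>l\<in>J. if length (c l) = k then bs \<omega> (c l) else 0"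
  let ?B = "{\<omega> \<in> space M. \<forall>l\<in>J. X l \<omega> k = c l}"
  let ?A = "env -` A \<inter> space M"
  have Bm [measurable]: "?B \<in> events" using J by measurable
  have Am [measurable]: "?A \<in> events" using measurable_sets[OF measurable_env_E A] .
  have AF: "?A \<in> sets F" unfolding sets_F using A by auto
  have pm [measurable]: "?p \<in> borel_measurable M" by (intro borel_measurable_prod) auto
  have sets1: "(\<lambda>f. f k) -` {i} \<inter> space (\<Pi>\<^sub>M k\<in>UNIV. count_space UNIV) \<in> sets (\<Pi>\<^sub>M k\<in>UNIV. count_space UNIV)" for i :: "nat list"
    by (rule measurable_sets[OF measurable_component_singleton]) auto
  have eqs: "{\<omega>' \<in> space M. X l \<omega>' \<in> (\<lambda>f. f k) -` {i} \<inter> space (\<Pi>\<^sub>M k\<in>UNIV. count_space UNIV)} = {\<omega>' \<in> space M. X l \<omega>' k = i}" for l i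
    by (auto simp: space_PiM)
  have eqs2: "{\<omega>' \<in> space M. \<forall>l\<in>J. X l \<omega>' \<in> (\<lambda>f. f k) -` {c l} \<inter> space (\<Pi>\<^sub>M k\<in>UNIV. count_space UNIV)} = ?B"
    by (auto simp: space_PiM)
  have "AE \<omega> in M. real_cond_exp M F (indicator {\<omega>' \<in> space M. \<forall>l\<in>J. X l \<omega>' \<in> (\<lambda>f. f k) -` {c l} \<inter> space (\<Pi>\<^sub>M k\<in>UNIV. count_space UNIV)}) \<omega> =
      (\<Prod>l\<in>J. real_cond_exp M F (indicator {\<omega>' \<in> space M. X l \<omega>' \<in> (\<lambda>f. f k) -` {c l} \<inter> space (\<Pi>\<^sub>M k\<in>UNIV. count_space UNIV)}) \<omega>)"
    using balls_cond_indep[unfolded cond_indep_vars_def, THEN conjunct2, rule_format, of J "\<lambda>l. (\<lambda>f. f k) -` {c l} \<inter> space (\<Pi>\<^sub>M k\<in>UNIV. count_space UNIV)"] J sets1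
    by auto
  then have 1: "AE \<omega> in M. real_cond_exp M F (indicator ?B) \<omega> = (\<Prod>l\<in>J. real_cond_exp M F (indicator {\<omega>' \<in> space M. X l \<omega>' k = c l}) \<omega>)"
    unfolding eqs eqs2 .
  have "AE \<omega> in M. \<forall>l\<in>J. real_cond_exp M F (indicator {\<omega>' \<in> space M. X l \<omega>' k = c l}) \<omega> = (if length (c l) = k then bs \<omega> (c l) else 0)"
    using J by (intro AE_finite_allI ball_box')
  with 1 have ce: "AE \<omega> in M. real_cond_exp M F (indicator ?B) \<omega> = ?p \<omega>"
    by eventually_elim (auto intro!: prod.cong)
  have p01: "0 \<le> ?p \<omega>" "\<omega> \<in> space M \<Longrightarrow> ?p \<omega> \<le> 1" for \<omega>
    by (auto intro!: prod_nonneg prod_le_1 simp: bs_le_1)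
  have i: "integrable M (indicator ?B :: 'w \<Rightarrow> real)" by (simp add: emeasure_eq_measure)
  have "prob (?A \<inter> ?B) = (\<integral>\<omega>\<in>?A. indicator ?B \<omega> \<partial>M)"
    unfolding set_lebesgue_integral_def by (simp add: indicator_inter_arith[symmetric])
  also have "\<dots> = (\<integral>\<omega>\<in>?A. real_cond_exp M F (indicator ?B) \<omega> \<partial>M)"
    by (rule fm.real_cond_exp_intA[OF i AF])
  also have "\<dots> = (\<integral>\<omega>. indicator ?A \<omega> * ?p \<omega> \<partial>M)"
    unfolding set_lebesgue_integral_def using ce
    by (intro integral_cong_AE) (auto elim!: eventually_mono)
  finally have "emeasure M (?A \<inter> ?B) = ennreal (\<integral>\<omega>. indicator ?A \<omega> * ?p \<omega> \<partial>M)"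
    by (simp add: emeasure_eq_measure)
  also have "\<dots> = (\<integral>\<^sup>+ \<omega>. ennreal (indicator ?A \<omega> * ?p \<omega>) \<partial>M)"
  proof (rule nn_integral_eq_integral[symmetric])
    show "integrable M (\<lambda>\<omega>. indicator ?A \<omega> * ?p \<omega>)"
    proof (rule integrable_const_bound[where B=1])
      show "(\<lambda>\<omega>. indicator ?A \<omega> * ?p \<omega>) \<in> borel_measurable M"
        by (intro borel_measurable_times borel_measurable_indicator Am pm)
    qed (use p01 in \<open>auto simp: indicator_def\<close>)
  qed (use p01 in auto)
  also have "\<dots> = (\<integral>\<^sup>+ \<omega>. indicator A (env \<omega>) * ennreal (?p \<omega>) \<partial>M)"
    by (intro nn_integral_cong) (auto simp: indicator_def)
  also have "\<dots> = (\<integral>\<^sup>+ e. indicator A e * ennreal (\<Prod>l\<in>J. if length (c l) = k then bsize e (c l) else 0) \<partial>distr M sp.E env)"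
    using A by (subst nn_integral_distr) auto
  finally have "emeasure M (?A \<inter> ?B) = (\<integral>\<^sup>+ e. indicator A e * ennreal (\<Prod>l\<in>J. if length (c l) = k then bsize e (c l) else 0) \<partial>sp.E)"
    by (simp only: distr_env)
  moreover have "?A \<inter> ?B = {\<omega> \<in> space M. env \<omega> \<in> A \<and> (\<forall>l\<in>J. X l \<omega> k = c l)}" by auto
  ultimately show ?thesis by simp
qed

end

section \<open>Boxes with many balls\<close>

context nested_occupancy
begin

text \<open>Phrased with \<open>j\<close>-element sets of balls because the union bound runs over
  them.\<close>

definition crowded_box :: "nat \<Rightarrow> nat \<Rightarrow> nat \<Rightarrow> nat list \<Rightarrow> 'w \<Rightarrow> bool" where
  "crowded_box n j k i \<omega> \<longleftrightarrow> (\<exists>J\<in>{J. J \<subseteq> {..<n} \<and> card J = j}. \<forall>l\<in>J. X l \<omega> k = i)"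

definition crowded :: "nat \<Rightarrow> nat \<Rightarrow> nat \<Rightarrow> 'w \<Rightarrow> bool" where
  "crowded n j k \<omega> \<longleftrightarrow> (\<exists>i. length i = k \<and> bs \<omega> i > 0 \<and> crowded_box n j k i \<omega>)"

lemma finite_subsets_card: "finite {J. J \<subseteq> {..<n :: nat} \<and> card J = j}"
  by (rule finite_subset[of _ "Pow {..<n}"]) auto

lemma crowded_box_iff: "crowded_box n j k i \<omega> \<longleftrightarrow> j \<le> card {l. l < n \<and> X l \<omega> k = i}"
proof
  assume "crowded_box n j k i \<omega>"
  then obtain J where J: "J \<subseteq> {..<n}" "card J = j" "\<forall>l\<in>J. X l \<omega> k = i" unfolding crowded_box_def by blast
  have "card J \<le> card {l. l < n \<and> X l \<omega> k = i}" using J by (intro card_mono) auto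
  then show "j \<le> card {l. l < n \<and> X l \<omega> k = i}" using J by simp
next
  assume "j \<le> card {l. l < n \<and> X l \<omega> k = i}"
  then obtain J where "J \<subseteq> {l. l < n \<and> X l \<omega> k = i}" "card J = j" by (rule obtain_subset_with_card_n)
  then show "crowded_box n j k i \<omega>" unfolding crowded_box_def by blast
qed

lemma measurable_crowded_box [measurable]: "Measurable.pred M (crowded_box n j k i)"
  unfolding crowded_box_def
proof (rule pred_intros_finite(4)[OF finite_subsets_card])
  fix J assume "J \<in> {J. J \<subseteq> {..<n} \<and> card J = j}"
  then have "finite J" using finite_subset by blast
  then show "Measurable.pred M (\<lambda>\<omega>. \<forall>l\<in>J. X l \<omega> k = i)" by measurable
qed

lemma measurable_crowded [measurable]: "Measurable.pred M (crowded n j k)"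
  unfolding crowded_def by measurable

lemma saturation_height_eq: "saturation_height \<rho> X n j \<omega> = Inf (enat ` {k. \<not> crowded n j k \<omega>})"
  unfolding saturation_height_def crowded_def crowded_box_iff box_size_eq_bs not_ex
  by (intro arg_cong[where f=Inf] arg_cong[where f="image enat"]) (auto simp: not_le)

lemma min_power_le_powr:
  fixes y \<theta> :: real
  assumes "0 \<le> y" "1 \<le> \<theta>" "\<theta> \<le> real j"
  shows "(if y \<le> 1 then y ^ j else y) \<le> y powr \<theta>"
proof (cases "y = 0")
  case True
  have "0 < j" using assms by linarith
  then show ?thesis using True by (simp add: power_0_left)
next
  case False
  then have y: "0 < y" using assms by simp
  show ?thesis
  proof (cases "y \<le> 1")
    case True
    have "y powr real j \<le> y powr \<theta>" using True y assms by (intro powr_mono') auto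
    then show ?thesis using True y by (simp add: powr_realpow)
  next
    case False
    then show ?thesis using powr_mono[of 1 \<theta> y] assms y by simp
  qed
qed

text \<open>If \<open>n p \<le> 1\<close>, the union bound over \<open>j\<close>-element sets gives
  \<open>(n p) ^ j\<close>; otherwise the expected number of balls gives \<open>n p\<close>. Both
  are at most \<open>(n p) powr \<theta>\<close> for
  \<open>1 \<le> \<theta> \<le> j\<close>.\<close>

lemma emeasure_crowded_box_le:
  assumes i: "length i = k" and \<theta>: "1 \<le> \<theta>" "\<theta> \<le> real j"
  shows "emeasure M {\<omega> \<in> space M. crowded_box n j k i \<omega>} \<le> ennreal (real n powr \<theta>) * (\<integral>\<^sup>+ e. ennreal (bsize e i powr \<theta>) \<partial>sp.E)"
proof -
  define A where "A = {e \<in> space sp.E. real n * bsize e i \<le> 1}"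
  define A' where "A' = {e \<in> space sp.E. \<not> real n * bsize e i \<le> 1}"
  have A [measurable]: "A \<in> sets sp.E" "A' \<in> sets sp.E" unfolding A_def A'_def by measurable
  let ?JJ = "{J. J \<subseteq> {..<n} \<and> card J = j}"
  let ?V = "\<lambda>J. {\<omega> \<in> space M. env \<omega> \<in> A \<and> (\<forall>l\<in>J. X l \<omega> k = i)}"
  let ?W = "\<lambda>l. {\<omega> \<in> space M. env \<omega> \<in> A' \<and> (\<forall>l\<in>{l}. X l \<omega> k = i)}"
  have finJ: "finite J" if "J \<in> ?JJ" for J using that finite_subset by blast
  have envA: "{\<omega> \<in> space M. env \<omega> \<in> A0} \<in> events" if "A0 \<in> sets sp.E" for A0
    using measurable_sets[OF measurable_env_E that] by (simp add: vimage_def Int_def conj_commute)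
  have Vm: "?V J \<in> events" if "J \<in> ?JJ" for J
  proof -
    have "{\<omega> \<in> space M. \<forall>l\<in>J. X l \<omega> k = i} \<in> events" using finJ[OF that] by measurable
    from sets.Int[OF envA[OF A(1)] this] show ?thesis by (simp add: Int_def conj_ac)
  qed
  have Wm: "?W l \<in> events" for l
  proof -
    have "{\<omega> \<in> space M. \<forall>l\<in>{l}. X l \<omega> k = i} \<in> events" by measurable
    from sets.Int[OF envA[OF A(2)] this] show ?thesis by (simp add: Int_def conj_ac)
  qed
  have j0: "0 < j" using \<theta> by linarith
  have "emeasure M {\<omega> \<in> space M. crowded_box n j k i \<omega>} \<le> emeasure M ((\<Union>J\<in>?JJ. ?V J) \<union> (\<Union>l\<in>{..<n}. ?W l))"
  proof (rule emeasure_mono)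
    show "{\<omega> \<in> space M. crowded_box n j k i \<omega>} \<subseteq> (\<Union>J\<in>?JJ. ?V J) \<union> (\<Union>l\<in>{..<n}. ?W l)"
    proof
      fix \<omega> assume "\<omega> \<in> {\<omega> \<in> space M. crowded_box n j k i \<omega>}"
      then obtain J where J: "\<omega> \<in> space M" "J \<in> ?JJ" "\<forall>l\<in>J. X l \<omega> k = i" unfolding crowded_box_def by blast
      show "\<omega> \<in> (\<Union>J\<in>?JJ. ?V J) \<union> (\<Union>l\<in>{..<n}. ?W l)"
      proof (cases "env \<omega> \<in> A")
        case True
        then show ?thesis using J by blast
      next
        case False
        then have "env \<omega> \<in> A'" using env_space[OF J(1)] by (simp add: A_def A'_def)
        moreover obtain l where "l \<in> J" using J(2) j0 by fastforce
        ultimately show ?thesis using J by blast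
      qed
    qed
    show "(\<Union>J\<in>?JJ. ?V J) \<union> (\<Union>l\<in>{..<n}. ?W l) \<in> events"
      using Vm Wm by (intro sets.Un sets.finite_UN finite_subsets_card) auto
  qed
  also have "\<dots> \<le> emeasure M (\<Union>J\<in>?JJ. ?V J) + emeasure M (\<Union>l\<in>{..<n}. ?W l)"
    using Vm Wm by (intro emeasure_subadditive sets.finite_UN finite_subsets_card) auto
  also have "\<dots> \<le> (\<Sum>J\<in>?JJ. emeasure M (?V J)) + (\<Sum>l<n. emeasure M (?W l))"
    using Vm Wm by (intro add_mono emeasure_subadditive_finite finite_subsets_card) auto
  also have "(\<Sum>J\<in>?JJ. emeasure M (?V J)) = (\<Sum>J\<in>?JJ. \<integral>\<^sup>+ e. indicator A e * ennreal (bsize e i ^ j) \<partial>sp.E)"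
  proof (rule sum.cong[OF refl])
    fix J assume J: "J \<in> ?JJ"
    show "emeasure M (?V J) = (\<integral>\<^sup>+ e. indicator A e * ennreal (bsize e i ^ j) \<partial>sp.E)"
      using emeasure_env_balls[OF A(1) finJ[OF J], of k "\<lambda>_. i"] J i by simp
  qed
  also have "(\<Sum>l<n. emeasure M (?W l)) = (\<Sum>l<n. \<integral>\<^sup>+ e. indicator A' e * ennreal (bsize e i) \<partial>sp.E)"
  proof (rule sum.cong[OF refl])
    fix l
    show "emeasure M (?W l) = (\<integral>\<^sup>+ e. indicator A' e * ennreal (bsize e i) \<partial>sp.E)"
      using emeasure_env_balls[OF A(2), of "{l}" k "\<lambda>_. i"] i by simp
  qed
  also have "(\<Sum>J\<in>?JJ. \<integral>\<^sup>+ e. indicator A e * ennreal (bsize e i ^ j) \<partial>sp.E) =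
      of_nat (n choose j) * (\<integral>\<^sup>+ e. indicator A e * ennreal (bsize e i ^ j) \<partial>sp.E)"
    using n_subsets[of "{..<n}" j] by simp
  also have "\<dots> \<le> of_nat (n ^ j) * (\<integral>\<^sup>+ e. indicator A e * ennreal (bsize e i ^ j) \<partial>sp.E)"
  proof (intro mult_right_mono of_nat_mono)
    show "n choose j \<le> n ^ j"
      by (cases "j \<le> n") (auto simp: binomial_le_pow binomial_eq_0)
  qed simp
  also have "of_nat (n ^ j) * (\<integral>\<^sup>+ e. indicator A e * ennreal (bsize e i ^ j) \<partial>sp.E) +
      (\<Sum>l<n. \<integral>\<^sup>+ e. indicator A' e * ennreal (bsize e i) \<partial>sp.E) =
    (\<integral>\<^sup>+ e. of_nat (n ^ j) * (indicator A e * ennreal (bsize e i ^ j)) + of_nat n * (indicator A' e * ennreal (bsize e i)) \<partial>sp.E)"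
  proof -
    have "(\<Sum>l<n. \<integral>\<^sup>+ e. indicator A' e * ennreal (bsize e i) \<partial>sp.E) = of_nat n * (\<integral>\<^sup>+ e. indicator A' e * ennreal (bsize e i) \<partial>sp.E)"
      by simp
    also have "\<dots> = (\<integral>\<^sup>+ e. of_nat n * (indicator A' e * ennreal (bsize e i)) \<partial>sp.E)"
      by (rule nn_integral_cmult[symmetric]) measurable
    finally show ?thesis
      by (subst nn_integral_add, measurable) (subst nn_integral_cmult, auto)
  qed
  also have "\<dots> \<le> (\<integral>\<^sup>+ e. ennreal (real n powr \<theta>) * ennreal (bsize e i powr \<theta>) \<partial>sp.E)"
  proof (rule nn_integral_mono)
    fix e assume e: "e \<in> space sp.E"
    have "of_nat (n ^ j) * (indicator A e * ennreal (bsize e i ^ j)) + of_nat n * (indicator A' e * ennreal (bsize e i)) =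
      ennreal (if real n * bsize e i \<le> 1 then (real n * bsize e i) ^ j else real n * bsize e i)"
      using e by (auto simp: A_def A'_def ennreal_of_nat_eq_real_of_nat power_mult_distrib ennreal_mult)
    also have "\<dots> \<le> ennreal ((real n * bsize e i) powr \<theta>)"
      using \<theta> by (intro ennreal_leI min_power_le_powr) auto
    also have "\<dots> = ennreal (real n powr \<theta>) * ennreal (bsize e i powr \<theta>)"
      by (simp add: powr_mult ennreal_mult)
    finally show "of_nat (n ^ j) * (indicator A e * ennreal (bsize e i ^ j)) + of_nat n * (indicator A' e * ennreal (bsize e i))
      \<le> ennreal (real n powr \<theta>) * ennreal (bsize e i powr \<theta>)" .
  qed
  also have "\<dots> = ennreal (real n powr \<theta>) * (\<integral>\<^sup>+ e. ennreal (bsize e i powr \<theta>) \<partial>sp.E)"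
    by (rule nn_integral_cmult) measurable
  finally show ?thesis by (simp add: add_mono)
qed

lemma emeasure_crowded_le:
  assumes \<theta>: "1 \<le> \<theta>" "\<theta> \<le> real j"
  shows "emeasure M {\<omega> \<in> space M. crowded n j k \<omega>} \<le> ennreal (real n powr \<theta>) * Lfun \<nu> \<theta> ^ k"
proof -
  have "emeasure M {\<omega> \<in> space M. crowded n j k \<omega>} = (\<integral>\<^sup>+ \<omega>. indicator {\<omega> \<in> space M. crowded n j k \<omega>} \<omega> \<partial>M)"
    by (rule nn_integral_indicator[symmetric]) measurable
  also have "\<dots> \<le> (\<integral>\<^sup>+ \<omega>. gsum k (\<lambda>i. indicator {\<omega> \<in> space M. crowded_box n j k i \<omega>} \<omega>) \<partial>M)"
  proof (rule nn_integral_mono)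
    fix \<omega>
    show "indicator {\<omega> \<in> space M. crowded n j k \<omega>} \<omega> \<le> gsum k (\<lambda>i. indicator {\<omega> \<in> space M. crowded_box n j k i \<omega>} \<omega>)"
    proof (cases "\<omega> \<in> space M \<and> crowded n j k \<omega>")
      case True
      then obtain i where i: "length i = k" "crowded_box n j k i \<omega>" by (auto simp: crowded_def)
      have "(1 :: ennreal) = indicator {\<omega> \<in> space M. crowded_box n j k i \<omega>} \<omega>" using i True by simp
      also have "\<dots> \<le> gsum k (\<lambda>i. indicator {\<omega> \<in> space M. crowded_box n j k i \<omega>} \<omega>)"
        by (rule gsum_ge[OF i(1), where f="\<lambda>i. indicator {\<omega> \<in> space M. crowded_box n j k i \<omega>} \<omega>"])
      finally show ?thesis using True by simp
    qed auto
  qed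
  also have "\<dots> = gsum k (\<lambda>i. emeasure M {\<omega> \<in> space M. crowded_box n j k i \<omega>})"
    by (subst nn_integral_gsum) (auto intro!: gsum_cong nn_integral_indicator)
  also have "\<dots> \<le> gsum k (\<lambda>i. ennreal (real n powr \<theta>) * (\<integral>\<^sup>+ e. ennreal (bsize e i powr \<theta>) \<partial>sp.E))"
    by (intro gsum_mono emeasure_crowded_box_le \<theta>)
  also have "\<dots> = ennreal (real n powr \<theta>) * (\<integral>\<^sup>+ e. sp.S \<theta> k e \<partial>sp.E)"
    unfolding sp.S_def gsum_cmult by (subst nn_integral_gsum) auto
  also have "\<dots> = ennreal (real n powr \<theta>) * Lfun \<nu> \<theta> ^ k"
    by (simp add: sp.nn_integral_S \<theta>)
  finally show ?thesis .
qed

text \<open>A ball enters a box of size 0 with probability 0. This matters because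
  \<open>crowded\<close> asks for a box of positive size.\<close>

lemma AE_ball_box_pos: "AE \<omega> in M. \<forall>l k. 0 < bs \<omega> (X l \<omega> k)"
proof -
  have *: "AE \<omega> in M. \<forall>i. \<not> (X l \<omega> k = i \<and> bs \<omega> i = 0)" for l k
    unfolding AE_all_countable
  proof
    fix i
    let ?A = "{e \<in> space sp.E. bsize e i = 0}"
    have A: "?A \<in> sets sp.E" by measurable
    have "emeasure M {\<omega> \<in> space M. env \<omega> \<in> ?A \<and> (\<forall>l\<in>{l}. X l \<omega> k = i)} =
        (\<integral>\<^sup>+ e. indicator ?A e * ennreal (\<Prod>l\<in>{l}. if length i = k then bsize e i else 0) \<partial>sp.E)"
      by (rule emeasure_env_balls[OF A]) simp
    also have "\<dots> = (\<integral>\<^sup>+ e. 0 \<partial>sp.E)"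
      by (intro nn_integral_cong) (simp add: indicator_def)
    finally have "emeasure M {\<omega> \<in> space M. env \<omega> \<in> ?A \<and> (\<forall>l\<in>{l}. X l \<omega> k = i)} = 0" by simp
    moreover have "{\<omega> \<in> space M. env \<omega> \<in> ?A \<and> (\<forall>l\<in>{l}. X l \<omega> k = i)} = {\<omega> \<in> space M. \<not> \<not> (X l \<omega> k = i \<and> bs \<omega> i = 0)}"
      using env_space by auto
    ultimately have "emeasure M {\<omega> \<in> space M. \<not> \<not> (X l \<omega> k = i \<and> bs \<omega> i = 0)} = 0" by simp
    then show "AE \<omega> in M. \<not> (X l \<omega> k = i \<and> bs \<omega> i = 0)"
      by (subst AE_iff_measurable[OF _ refl]) auto
  qed
  have "AE \<omega> in M. \<forall>l k. \<forall>i. \<not> (X l \<omega> k = i \<and> bs \<omega> i = 0)"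
    by (rule AE_all_countable[THEN iffD2, OF allI], rule AE_all_countable[THEN iffD2, OF allI], rule *)
  then show ?thesis
  proof eventually_elim
    case (elim \<omega>)
    show ?case
    proof (intro allI)
      fix l k
      have "bs \<omega> (X l \<omega> k) \<noteq> 0" using elim by blast
      then show "0 < bs \<omega> (X l \<omega> k)" by (simp add: less_le)
    qed
  qed
qed

text \<open>Arrays that are constant outside a finite rectangle are determined by finitely many
  entries; this allows decomposing an event by the positions of finitely many balls.\<close>

lemma countable_finite_arrays:
  "countable {c :: nat \<Rightarrow> nat \<Rightarrow> 'b :: countable. \<forall>g l. \<not> (g < j \<and> l < m) \<longrightarrow> c g l = d}"
proof -
  let ?T = "{c :: nat \<Rightarrow> nat \<Rightarrow> 'b. \<forall>g l. \<not> (g < j \<and> l < m) \<longrightarrow> c g l = d}"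
  let ?f = "\<lambda>c :: nat \<Rightarrow> nat \<Rightarrow> 'b. map (\<lambda>g. map (c g) [0..<m]) [0..<j]"
  have "inj_on ?f ?T"
  proof (rule inj_onI)
    fix c c' assume c: "c \<in> ?T" "c' \<in> ?T" and eq: "?f c = ?f c'"
    show "c = c'"
    proof (intro ext)
      fix g l
      show "c g l = c' g l"
      proof (cases "g < j \<and> l < m")
        case True
        then have "?f c ! g ! l = c g l" "?f c' ! g ! l = c' g l" by simp_all
        then show ?thesis using eq by simp
      qed (use c in auto)
    qed
  qed
  then show ?thesis by (rule countableI'[where f="to_nat \<circ> ?f", OF comp_inj_on]) simp
qed

text \<open>Carries the collision estimate from pmfs to the balls. Ball \<open>g * m + l\<close>
  becomes ball \<open>l\<close> of group \<open>g\<close>, and the event is split according to the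
  array of boxes of the first \<open>j * m\<close> balls.\<close>

lemma emeasure_uncrowded_le:
  fixes s t :: real
  assumes A: "A \<in> sets sp.E" and S: "\<And>e. e \<in> A \<Longrightarrow> ennreal s < sp.S (real j) k e" and s: "0 < s"
    and j: "0 < j" and m: "0 < m" "j * m \<le> n" and t: "0 < t"
  shows "emeasure M {\<omega> \<in> space M. env \<omega> \<in> A \<and> \<not> crowded n j k \<omega>} \<le>
    ennreal (real j * exp (- t) + ((1 + t) / real m) ^ j / s)"
proof -
  \<comment> \<open>Membership in \<open>T\<close> makes the probability under \<open>sample\<close>
    a plain product, and the countability of \<open>T\<close> permits summing over arrays.\<close>
  define T :: "(nat \<Rightarrow> nat \<Rightarrow> nat list) set" where "T = {c. \<forall>g l. \<not> (g < j \<and> l < m) \<longrightarrow> c g l = []}"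
  define C :: "(nat \<Rightarrow> nat \<Rightarrow> nat list) set" where "C = {f. \<not> (\<exists>i. length i = k \<and> (\<forall>g<j. \<exists>l<m. f g l = i))}"
  have cT: "countable (T \<inter> C)"
    using countable_finite_arrays[of j m "[] :: nat list"] by (auto simp: T_def intro: countable_subset)
  define ev where "ev c = {\<omega> \<in> space M. env \<omega> \<in> A \<and> (\<forall>l\<in>{..<j * m}. X l \<omega> k = c (l div m) (l mod m))}" for c
  have envA: "{\<omega> \<in> space M. env \<omega> \<in> A} \<in> events"
    using measurable_sets[OF measurable_env_E A] by (simp add: vimage_def Int_def conj_commute)
  have evm: "ev c \<in> events" for c
  proof -
    have "{\<omega> \<in> space M. \<forall>l\<in>{..<j * m}. X l \<omega> k = c (l div m) (l mod m)} \<in> events" by measurable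
    from sets.Int[OF envA this] show ?thesis by (simp add: Int_def conj_ac ev_def)
  qed
  let ?b = "real j * exp (- t) + ((1 + t) / real m) ^ j / s"
  let ?w = "\<lambda>e c. \<Prod>g<j. \<Prod>l<m. if length (c g l) = k then bsize e (c g l) else 0"
  have evp: "emeasure M (ev c) = (\<integral>\<^sup>+ e. indicator A e * ennreal (?w e c) \<partial>sp.E)" for c
  proof -
    have "(\<Prod>l\<in>{..<j * m}. if length (c (l div m) (l mod m)) = k then bsize e (c (l div m) (l mod m)) else 0) = ?w e c" for e
    proof -
      have "?w e c = (\<Prod>(g, l)\<in>{..<j} \<times> {..<m}. if length (c g l) = k then bsize e (c g l) else 0)"
        by (rule prod.cartesian_product)
      also have "\<dots> = (\<Prod>l\<in>{..<j * m}. if length (c (l div m) (l mod m)) = k then bsize e (c (l div m) (l mod m)) else 0)"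
      proof (rule prod.reindex_bij_witness[of _ "\<lambda>x. (x div m, x mod m)" "\<lambda>(g, l). g * m + l"])
        fix z assume z: "z \<in> {..<j} \<times> {..<m}"
        then obtain g l where gl: "z = (g, l)" "g < j" "l < m" by auto
        have "g * m + l < Suc g * m" using gl by simp
        also have "\<dots> \<le> j * m" using gl by (intro mult_le_mono1) simp
        finally show "(case z of (g, l) \<Rightarrow> g * m + l) \<in> {..<j * m}" by (simp add: gl)
      qed (use m in \<open>auto simp: less_mult_imp_div_less\<close>)
      finally show ?thesis by simp
    qed
    then show ?thesis
      unfolding ev_def using emeasure_env_balls[OF A finite_lessThan, of "j * m" k "\<lambda>l. c (l div m) (l mod m)"] by simp
  qed
  have wpmf: "?w e c = pmf (sample j m [] (sp.box_pmf k e)) c" if "c \<in> T" "e \<in> space sp.E" for c e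
  proof -
    have "pmf (sample j m [] (sp.box_pmf k e)) c = (\<Prod>g<j. pmf (Pi_pmf {..<m} [] (\<lambda>_. sp.box_pmf k e)) (c g))"
      unfolding sample_def using that(1) by (intro pmf_Pi') (auto simp: T_def fun_eq_iff)
    also have "\<dots> = (\<Prod>g<j. \<Prod>l<m. pmf (sp.box_pmf k e) (c g l))"
      using that(1) by (intro prod.cong refl pmf_Pi') (auto simp: T_def)
    finally show ?thesis by (simp add: sp.pmf_box_pmf[OF that(2)])
  qed
  have bound: "measure_pmf.prob (sample j m [] (sp.box_pmf k e)) (T \<inter> C) \<le> ?b" if e: "e \<in> A" for e
  proof -
    have es: "e \<in> space sp.E" using sets.sets_into_space[OF A] e by auto
    obtain B where B: "finite B" "\<And>i. i \<in> B \<Longrightarrow> length i = k" "ennreal s < (\<Sum>i\<in>B. ennreal (bsize e i powr real j))"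
      using less_gsumD[OF S[OF e, unfolded sp.S_def]] by blast
    let ?\<sigma> = "\<Sum>i\<in>B. pmf (sp.box_pmf k e) i ^ j"
    have "(\<Sum>i\<in>B. ennreal (bsize e i powr real j)) = ennreal ?\<sigma>"
      using B(2) j by (subst sum_ennreal) (auto intro!: sum.cong arg_cong[where f=ennreal] simp: sp.pmf_box_pmf[OF es] powr_realpow')
    then have \<sigma>: "s < ?\<sigma>" using B(3) s by (simp add: ennreal_less_iff)
    have "measure_pmf.prob (sample j m [] (sp.box_pmf k e)) (T \<inter> C) \<le>
      measure_pmf.prob (sample j m [] (sp.box_pmf k e)) {f. \<not> (\<exists>i\<in>B. \<forall>g<j. \<exists>l<m. f g l = i)}"
      using B(2) by (intro measure_pmf.finite_measure_mono) (auto simp: C_def)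
    also have "\<dots> \<le> real j * exp (- t) + ((1 + t) / real m) ^ j / ?\<sigma>"
      using \<sigma> s by (intro prob_no_collision_le B(1) t m(1)) auto
    also have "\<dots> \<le> ?b"
      using \<sigma> s t m by (intro add_left_mono divide_left_mono) auto
    finally show ?thesis .
  qed
  have "emeasure M {\<omega> \<in> space M. env \<omega> \<in> A \<and> \<not> crowded n j k \<omega>} \<le> emeasure M (\<Union>c\<in>T \<inter> C. ev c)"
  proof (rule emeasure_mono_AE)
    show "(\<Union>c\<in>T \<inter> C. ev c) \<in> events" using cT evm by (intro sets.countable_UN') auto
    show "AE \<omega> in M. \<omega> \<in> {\<omega> \<in> space M. env \<omega> \<in> A \<and> \<not> crowded n j k \<omega>} \<longrightarrow> \<omega> \<in> (\<Union>c\<in>T \<inter> C. ev c)"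
      using AE_ball_box_pos
    proof eventually_elim
      case (elim \<omega>)
      show ?case
      proof
        assume \<omega>: "\<omega> \<in> {\<omega> \<in> space M. env \<omega> \<in> A \<and> \<not> crowded n j k \<omega>}"
        define c where "c g l = (if g < j \<and> l < m then X (g * m + l) \<omega> k else [])" for g l
        have "c \<in> T" by (simp add: T_def c_def)
        moreover have "c \<in> C"
        proof (rule ccontr)
          assume "c \<notin> C"
          then obtain i where i: "length i = k" "\<forall>g<j. \<exists>l<m. c g l = i" by (auto simp: C_def)
          \<comment> \<open>One ball from each group: the groups are disjoint, so these are
            \<open>j\<close> distinct balls in box \<open>i\<close>.\<close>
          then obtain f where f: "\<And>g. g < j \<Longrightarrow> f g < m \<and> c g (f g) = i" by metis
          define J where "J = (\<lambda>g. g * m + f g) ` {..<j}"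
          have inj: "inj_on (\<lambda>g. g * m + f g) {..<j}"
          proof (rule inj_onI)
            fix a b assume ab: "a \<in> {..<j}" "b \<in> {..<j}" "a * m + f a = b * m + f b"
            have "f a < m" "f b < m" using f[of a] f[of b] ab(1,2) by auto
            then have "(a * m + f a) div m = a" "(b * m + f b) div m = b" by auto
            then show "a = b" unfolding ab(3) by (rule trans[OF sym])
          qed
          have "g * m + f g < n" if "g < j" for g
          proof -
            have "g * m + f g < Suc g * m" using f[OF that] by simp
            also have "\<dots> \<le> j * m" using that by (intro mult_le_mono1) simp
            finally show ?thesis using m(2) by simp
          qed
          then have "J \<subseteq> {..<n}" by (auto simp: J_def)
          moreover have "card J = j" unfolding J_def using card_image[OF inj] by simp
          moreover have J: "\<forall>l\<in>J. X l \<omega> k = i"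
          proof
            fix l assume "l \<in> J"
            then obtain g where g: "g < j" "l = g * m + f g" by (auto simp: J_def)
            have "f g < m" "c g (f g) = i" using f[OF g(1)] by auto
            then show "X l \<omega> k = i" using g unfolding c_def by simp
          qed
          ultimately have cb: "crowded_box n j k i \<omega>" unfolding crowded_box_def by blast
          have "0 < bs \<omega> i"
          proof -
            have "J \<noteq> {}" using j by (auto simp: J_def)
            then obtain l where l: "l \<in> J" by blast
            then have "X l \<omega> k = i" using J by blast
            moreover have "0 < bs \<omega> (X l \<omega> k)" using elim by (rule spec2)
            ultimately show ?thesis by (simp only:)
          qed
          then show False using i cb \<omega> by (auto simp: crowded_def)
        qed
        moreover have "\<omega> \<in> ev c"
          using \<omega> m by (auto simp: ev_def c_def less_mult_imp_div_less)
        ultimately show "\<omega> \<in> (\<Union>c\<in>T \<inter> C. ev c)" by blast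
      qed
    qed
  qed
  also have "\<dots> \<le> (\<integral>\<^sup>+ c. emeasure M (ev c) \<partial>count_space (T \<inter> C))"
  proof -
    have "disjoint_family_on ev (T \<inter> C)"
      unfolding disjoint_family_on_def
    proof (intro ballI impI)
      fix c c' assume c: "c \<in> T \<inter> C" "c' \<in> T \<inter> C" "c \<noteq> c'"
      then obtain g l where gl: "c g l \<noteq> c' g l" by (metis ext)
      then have "g < j" "l < m" using c by (auto simp: T_def)
      have lt: "g * m + l < j * m"
      proof -
        have "g * m + l < Suc g * m" using \<open>l < m\<close> by simp
        also have "\<dots> \<le> j * m" using \<open>g < j\<close> by (intro mult_le_mono1) simp
        finally show ?thesis .
      qed
      have dm: "(g * m + l) div m = g" "(g * m + l) mod m = l" using \<open>l < m\<close> by auto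
      show "ev c \<inter> ev c' = {}"
      proof (rule ccontr)
        assume "ev c \<inter> ev c' \<noteq> {}"
        then obtain \<omega> where "\<omega> \<in> ev c" "\<omega> \<in> ev c'" by blast
        moreover have "X (g * m + l) \<omega> k = d g l" if "\<omega> \<in> ev d" for d
          using bspec[of "{..<j * m}" "\<lambda>x. X x \<omega> k = d (x div m) (x mod m)" "g * m + l"] that lt
          unfolding dm ev_def by simp
        ultimately have "X (g * m + l) \<omega> k = c g l" "X (g * m + l) \<omega> k = c' g l" by blast+
        then show False using gl by simp
      qed
    qed
    then show ?thesis using emeasure_UN_countable[OF evm cT] by simp
  qed
  also have "\<dots> = (\<integral>\<^sup>+ c. \<integral>\<^sup>+ e. indicator A e * ennreal (?w e c) \<partial>sp.E \<partial>count_space (T \<inter> C))"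
    by (simp only: evp)
  also have "\<dots> = (\<integral>\<^sup>+ e. \<integral>\<^sup>+ c. indicator A e * ennreal (?w e c) \<partial>count_space (T \<inter> C) \<partial>sp.E)"
    using A by (intro nn_integral_count_space_nn_integral[symmetric] cT) auto
  also have "\<dots> \<le> (\<integral>\<^sup>+ e. ennreal ?b \<partial>sp.E)"
  proof (rule nn_integral_mono)
    fix e assume es: "e \<in> space sp.E"
    show "(\<integral>\<^sup>+ c. indicator A e * ennreal (?w e c) \<partial>count_space (T \<inter> C)) \<le> ennreal ?b"
    proof (cases "e \<in> A")
      case True
      then have "(\<integral>\<^sup>+ c. indicator A e * ennreal (?w e c) \<partial>count_space (T \<inter> C)) =
        (\<integral>\<^sup>+ c. ennreal (pmf (sample j m [] (sp.box_pmf k e)) c) \<partial>count_space (T \<inter> C))"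
        using es by (intro nn_integral_cong) (simp add: wpmf)
      also have "\<dots> = emeasure (measure_pmf (sample j m [] (sp.box_pmf k e))) (T \<inter> C)"
        by (rule nn_integral_pmf)
      also have "\<dots> \<le> ennreal ?b"
        using bound[OF True] by (simp add: measure_pmf.emeasure_eq_measure ennreal_leI)
      finally show ?thesis .
    qed simp
  qed
  finally show ?thesis using sp.E.emeasure_space_1 by simp
qed

end

section \<open>Asymptotics of the height\<close>

lemma eventually_log_less: "c > 0 \<Longrightarrow> eventually (\<lambda>s::nat. ln (real s) \<le> c * real s) sequentially"
proof -
  assume c: "c > 0"
  have "\<forall>\<^sub>F s in sequentially. ln (real s) / real s < c"
    using lim_ln_over_n c by (rule order_tendstoD(2))
  then show ?thesis using eventually_gt_at_top[of 0] by eventually_elim (simp add: field_simps)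
qed

text \<open>\<open>n \<ge> exp 3\<close> means \<open>ln n \<ge> 3\<close>, so
  \<open>s \<le> 3 * ln n \<le> (ln n)\<^sup>2\<close>; and \<open>ln (ln n) \<ge> 1\<close> lets
  additive constants be absorbed.\<close>

lemma ln_dyadic_le:
  fixes n s :: nat
  assumes n: "exp 3 \<le> real n" and s: "real s \<le> log 2 (real n) + 1" "1 \<le> s"
  shows "ln (real s) \<le> 2 * ln (ln (real n))" "1 \<le> ln (ln (real n))"
proof -
  have n0: "real n > 0" using n exp_gt_zero[of 3] by linarith
  have l3: "3 \<le> ln (real n)" using n n0 by (simp add: ln_ge_iff)
  have "exp (1 :: real) \<le> 3" using exp_le by simp
  then show "1 \<le> ln (ln (real n))" using l3 by (subst ln_ge_iff) auto
  have ln2: "ln 2 \<ge> (1 / 2 :: real)" using ln2_ge_two_thirds by simp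
  have "real s \<le> ln (real n) / ln 2 + 1" using s by (simp add: log_def)
  also have "ln (real n) / ln 2 \<le> ln (real n) / (1 / 2)" using l3 ln2 by (intro divide_left_mono) auto
  also have "ln (real n) / (1 / 2) + 1 \<le> 3 * ln (real n)" using l3 by simp
  also have "\<dots> \<le> ln (real n) * ln (real n)" using l3 by (intro mult_right_mono) auto
  finally have "real s \<le> ln (real n) * ln (real n)" by simp
  then have "ln (real s) \<le> ln (ln (real n) * ln (real n))"
    using s(2) l3 by (subst ln_le_cancel_iff) auto
  also have "\<dots> = 2 * ln (ln (real n))" using l3 by (simp add: ln_mult)
  finally show "ln (real s) \<le> 2 * ln (ln (real n))" .
qed

text \<open>By monotonicity \<open>h n\<close> is compared with the value at the next power of two.
  Rounding up changes \<open>s * ln 2\<close> by at most \<open>ln 2 < 1\<close>, which gives the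
  summand \<open>C\<close> of \<open>K\<close>, while \<open>2 * A\<close> comes from
  \<open>ln s \<le> 2 * ln (ln n)\<close>.\<close>

lemma dyadic_upper:
  fixes h :: "nat \<Rightarrow> real"
  assumes mono: "\<And>n m. n \<le> m \<Longrightarrow> h n \<le> h m" and C: "C > 0" and A: "A \<ge> 0"
    and ev: "eventually (\<lambda>s. h (2 ^ s) \<le> C * real s * ln 2 + A * ln (real s) + 1) sequentially"
  shows "\<exists>K\<ge>0. eventually (\<lambda>n. h n \<le> C * ln (real n) + K * ln (ln (real n))) sequentially"
proof -
  obtain s0 where s0: "\<And>s. s \<ge> s0 \<Longrightarrow> h (2 ^ s) \<le> C * real s * ln 2 + A * ln (real s) + 1"
    using ev by (auto simp: eventually_sequentially)
  define K where "K = C + 2 * A + 1"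
  have "eventually (\<lambda>n. h n \<le> C * ln (real n) + K * ln (ln (real n))) sequentially"
    using eventually_ge_at_top[of "max (2 ^ (s0 + 1)) (nat \<lceil>exp (3 :: real)\<rceil>)"]
  proof eventually_elim
    case (elim n)
    have n: "exp 3 \<le> real n" "2 ^ (s0 + 1) \<le> n" using elim by linarith+
    have n0: "real n > 0" using n(1) exp_gt_zero[of 3] by linarith
    have "real (2 ^ (s0 + 1)) \<le> real n" using n(2) by (simp only: of_nat_le_iff)
    then have "log 2 (2 ^ (s0 + 1)) \<le> log 2 (real n)" using n0 by (subst log_le_cancel_iff) auto
    moreover have "log 2 ((2 :: real) ^ (s0 + 1)) = real (s0 + 1)" by (rule log_pow_cancel) auto
    ultimately have lg: "real (s0 + 1) \<le> log 2 (real n)" by (simp only:)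
    define s where "s = nat \<lceil>log 2 (real n)\<rceil>"
    have s: "log 2 (real n) \<le> real s" "real s \<le> log 2 (real n) + 1" unfolding s_def using lg by linarith+
    have ss: "s \<ge> s0" "s \<ge> 1" using s(1) lg by linarith+
    have "real n = 2 powr (log 2 (real n))" using n0 by simp
    also have "\<dots> \<le> 2 powr real s" using s by (intro powr_mono) auto
    also have "\<dots> = real (2 ^ s)" by (simp add: powr_realpow)
    finally have "n \<le> 2 ^ s" by (simp only: of_nat_le_iff)
    then have "h n \<le> h (2 ^ s)" by (rule mono)
    also have "\<dots> \<le> C * (real s * ln 2) + A * ln (real s) + 1" using s0[OF ss(1)] by (simp only: mult.assoc)
    also have "\<dots> \<le> C * (ln (real n) + 1) + A * (2 * ln (ln (real n))) + 1"
    proof (intro add_mono mult_left_mono order_refl)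
      have "real s * ln 2 \<le> (log 2 (real n) + 1) * ln 2" using s by (intro mult_right_mono) auto
      also have "\<dots> = ln (real n) + ln 2" by (simp add: log_def field_simps)
      finally show "real s * ln 2 \<le> ln (real n) + 1" using ln_2_less_1 by simp
      show "ln (real s) \<le> 2 * ln (ln (real n))" by (rule ln_dyadic_le(1)[OF n(1) s(2) ss(2)])
    qed (use C A in auto)
    also have "\<dots> = C * ln (real n) + (C + 1) * 1 + 2 * A * ln (ln (real n))" by (simp add: algebra_simps)
    also have "\<dots> \<le> C * ln (real n) + (C + 1) * ln (ln (real n)) + 2 * A * ln (ln (real n))"
      using ln_dyadic_le(2)[OF n(1) s(2) ss(2)] C A by (intro add_mono mult_left_mono) auto
    also have "\<dots> = C * ln (real n) + K * ln (ln (real n))" by (simp add: K_def algebra_simps)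
    finally show ?case .
  qed
  moreover have "K \<ge> 0" using C A by (simp add: K_def)
  ultimately show ?thesis by blast
qed

lemma dyadic_lower:
  fixes h :: "nat \<Rightarrow> real"
  assumes mono: "\<And>n m. n \<le> m \<Longrightarrow> h n \<le> h m" and C: "C > 0" and A: "A \<ge> 0"
    and ev: "eventually (\<lambda>s. h (2 ^ s) \<ge> C * real s * ln 2 - A * ln (real s) - 1) sequentially"
  shows "\<exists>K\<ge>0. eventually (\<lambda>n. h n \<ge> C * ln (real n) - K * ln (ln (real n))) sequentially"
proof -
  obtain s0 where s0: "\<And>s. s \<ge> s0 \<Longrightarrow> h (2 ^ s) \<ge> C * real s * ln 2 - A * ln (real s) - 1"
    using ev by (auto simp: eventually_sequentially)
  define K where "K = C + 2 * A + 1"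
  have "eventually (\<lambda>n. h n \<ge> C * ln (real n) - K * ln (ln (real n))) sequentially"
    using eventually_ge_at_top[of "max (2 ^ (s0 + 1)) (nat \<lceil>exp (3 :: real)\<rceil>)"]
  proof eventually_elim
    case (elim n)
    have n: "exp 3 \<le> real n" "2 ^ (s0 + 1) \<le> n" using elim by linarith+
    have n0: "real n > 0" using n(1) exp_gt_zero[of 3] by linarith
    have "real (2 ^ (s0 + 1)) \<le> real n" using n(2) by (simp only: of_nat_le_iff)
    then have "log 2 (2 ^ (s0 + 1)) \<le> log 2 (real n)" using n0 by (subst log_le_cancel_iff) auto
    moreover have "log 2 ((2 :: real) ^ (s0 + 1)) = real (s0 + 1)" by (rule log_pow_cancel) auto
    ultimately have lg: "real (s0 + 1) \<le> log 2 (real n)" by (simp only:)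
    define s where "s = nat \<lfloor>log 2 (real n)\<rfloor>"
    have s: "log 2 (real n) - 1 \<le> real s" "real s \<le> log 2 (real n)" unfolding s_def using lg by linarith+
    have ss: "s \<ge> s0" "s \<ge> 1" unfolding s_def using lg by linarith+
    have s1: "real s \<le> log 2 (real n) + 1" using s by simp
    have "real (2 ^ s) = 2 powr real s" by (simp add: powr_realpow)
    also have "\<dots> \<le> 2 powr (log 2 (real n))" using s by (intro powr_mono) auto
    also have "\<dots> = real n" using n0 by simp
    finally have "2 ^ s \<le> n" by (simp only: of_nat_le_iff)
    have "C * ln (real n) - K * ln (ln (real n)) = C * ln (real n) - (C + 1) * ln (ln (real n)) - 2 * A * ln (ln (real n))"
      by (simp add: K_def algebra_simps)
    also have "\<dots> \<le> C * ln (real n) - (C + 1) * 1 - 2 * A * ln (ln (real n))"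
      using ln_dyadic_le(2)[OF n(1) s1 ss(2)] C A by (intro diff_mono mult_left_mono) auto
    also have "\<dots> = C * (ln (real n) - 1) - A * (2 * ln (ln (real n))) - 1" by (simp add: algebra_simps)
    also have "\<dots> \<le> C * (real s * ln 2) - A * ln (real s) - 1"
    proof (intro diff_mono mult_left_mono order_refl)
      have "ln (real n) - ln 2 = (log 2 (real n) - 1) * ln 2" by (simp add: log_def field_simps)
      also have "\<dots> \<le> real s * ln 2" using s by (intro mult_right_mono) auto
      finally show "ln (real n) - 1 \<le> real s * ln 2" using ln_2_less_1 by simp
      show "ln (real s) \<le> 2 * ln (ln (real n))" by (rule ln_dyadic_le(1)[OF n(1) s1 ss(2)])
    qed (use C A in auto)
    also have "\<dots> \<le> h (2 ^ s)" using s0[OF ss(1)] by (simp only: mult.assoc)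
    also have "\<dots> \<le> h n" by (rule mono) fact
    finally show ?case .
  qed
  moreover have "K \<ge> 0" using C A by (simp add: K_def)
  ultimately show ?thesis by blast
qed

lemma asymp_equiv_ln:
  fixes h :: "nat \<Rightarrow> real"
  assumes C: "C > 0" and ev: "eventually (\<lambda>n. \<bar>h n - C * ln (real n)\<bar> \<le> K * ln (ln (real n))) sequentially"
  shows "h \<sim>[sequentially] (\<lambda>n. C * ln (real n))"
proof (rule asymp_equivI', rule LIM_zero_cancel)
  have "filterlim (\<lambda>n. ln (real n)) at_top sequentially"
    by (rule filterlim_compose[OF ln_at_top filterlim_real_sequentially])
  from filterlim_compose[OF ln_x_over_x_tendsto_0 this]
  have "(\<lambda>n. K / C * (ln (ln (real n)) / ln (real n))) \<longlonglongrightarrow> K / C * 0" by (intro tendsto_intros)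
  then have lim: "(\<lambda>n. K / C * (ln (ln (real n)) / ln (real n))) \<longlonglongrightarrow> 0" by simp
  show "(\<lambda>n. h n / (C * ln (real n)) - 1) \<longlonglongrightarrow> 0"
  proof (rule Lim_null_comparison[OF _ lim])
    show "\<forall>\<^sub>F n in sequentially. norm (h n / (C * ln (real n)) - 1) \<le> K / C * (ln (ln (real n)) / ln (real n))"
      using ev eventually_ge_at_top[of 2]
    proof eventually_elim
      case (elim n)
      have l: "0 < ln (real n)" using elim(2) by simp
      have "h n / (C * ln (real n)) - 1 = (h n - C * ln (real n)) / (C * ln (real n))"
        using l C by (simp add: field_simps)
      then have "norm (h n / (C * ln (real n)) - 1) = \<bar>h n - C * ln (real n)\<bar> / (C * ln (real n))"
        using l C by (simp add: abs_mult)
      also have "\<dots> \<le> K * ln (ln (real n)) / (C * ln (real n))"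
        using elim l C by (intro divide_right_mono) auto
      finally show ?case by simp
    qed
  qed
qed

section \<open>Monotonicity of crowding in generations and balls\<close>

context nested_occupancy
begin

lemma crowded_SucD:
  assumes path: "\<forall>l k. length (X l \<omega> k) = k \<and> (\<exists>c. X l \<omega> (Suc k) = c # X l \<omega> k)"
    and cr: "crowded n j (Suc k) \<omega>"
  shows "crowded n j k \<omega>"
proof -
  obtain i where i: "length i = Suc k" "bs \<omega> i > 0" "crowded_box n j (Suc k) i \<omega>" using cr by (auto simp: crowded_def)
  then obtain c u where u: "i = c # u" "length u = k" by (cases i) auto
  have "bs \<omega> u > 0"
    using i(2) bsize_nonneg[of "env \<omega>" u] measure_nonneg[of "env \<omega> u" "{c}"] by (auto simp: u zero_less_mult_iff)
  moreover have "X l \<omega> k = u" if "X l \<omega> (Suc k) = i" for l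
  proof -
    obtain c' where "X l \<omega> (Suc k) = c' # X l \<omega> k" using path[rule_format, of l k] by (elim conjE exE)
    then show ?thesis using that u by simp
  qed
  then have "crowded_box n j k u \<omega>" using i(3) unfolding crowded_box_def by blast
  ultimately show ?thesis using u(2) by (auto simp: crowded_def)
qed

text \<open>Balls sharing a box share all its ancestors. Hence the uncrowded generations are closed
  upwards, and a single crowded generation bounds the height from below.\<close>

lemma crowded_antimono:
  assumes path: "\<forall>l k. length (X l \<omega> k) = k \<and> (\<exists>c. X l \<omega> (Suc k) = c # X l \<omega> k)"
    and "k \<le> k'" "crowded n j k' \<omega>"
  shows "crowded n j k \<omega>"
  using assms(2,3)
proof (induction k' rule: dec_induct)
  case (step m)
  show ?case by (rule step.IH[OF crowded_SucD[OF path step.prems]])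
qed simp

lemma crowded_mono_balls:
  assumes "n \<le> m" "crowded n j k \<omega>"
  shows "crowded m j k \<omega>"
proof -
  obtain i J where i: "length i = k" "bs \<omega> i > 0" and J: "J \<subseteq> {..<n}" "card J = j" "\<forall>l\<in>J. X l \<omega> k = i"
    using assms(2) unfolding crowded_def crowded_box_def by blast
  have "J \<subseteq> {..<m}" using J(1) assms(1) by fastforce
  then have "crowded_box m j k i \<omega>" using J(2,3) unfolding crowded_box_def by blast
  then show ?thesis using i unfolding crowded_def by blast
qed

lemma saturation_height_le: "\<not> crowded n j k \<omega> \<Longrightarrow> saturation_height \<rho> X n j \<omega> \<le> enat k"
  unfolding saturation_height_eq by (rule Inf_lower) auto

lemma saturation_height_gt:
  assumes path: "\<forall>l k. length (X l \<omega> k) = k \<and> (\<exists>c. X l \<omega> (Suc k) = c # X l \<omega> k)"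
    and "crowded n j k \<omega>"
  shows "enat k < saturation_height \<rho> X n j \<omega>"
proof -
  have "enat (Suc k) \<le> saturation_height \<rho> X n j \<omega>"
    unfolding saturation_height_eq
  proof (rule Inf_greatest)
    fix x assume "x \<in> enat ` {k. \<not> crowded n j k \<omega>}"
    then obtain k' where k': "x = enat k'" "\<not> crowded n j k' \<omega>" by blast
    then have "\<not> k' \<le> k" using crowded_antimono[OF path] assms(2) by blast
    then show "enat (Suc k) \<le> x" using k' by simp
  qed
  then show ?thesis by (simp add: Suc_ile_eq)
qed

lemma saturation_height_mono: "n \<le> m \<Longrightarrow> saturation_height \<rho> X n j \<omega> \<le> saturation_height \<rho> X m j \<omega>"
  unfolding saturation_height_eq by (rule Inf_superset_mono) (use crowded_mono_balls in blast)

end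

section \<open>Borel--Cantelli along powers of two\<close>

locale nongeometric_occupancy = nested_occupancy M \<nu> \<rho> X
  for M :: "'w measure" and \<nu> \<rho> X +
  assumes nongeo: "\<not> geometric_law \<nu>"
begin

sublocale ng: nongeometric_splitting \<nu>
  by unfold_locales (rule nongeo)

text \<open>For \<open>n = 2 ^ s\<close> the first moment bound is
  \<open>exp (\<theta> * s * ln 2 + k * ln \<Lambda>)\<close>, and
  \<open>ln \<Lambda> = - \<theta> / C\<close> makes \<open>k = C * s * ln 2\<close> the break-even
  generation. The extra \<open>2 * C / \<theta> * ln s\<close> generations turn this into the
  summable \<open>1 / s\<^sup>2\<close>.\<close>

lemma AE_uncrowded_dyadic:
  assumes \<theta>: "1 < \<theta>" "\<theta> \<le> real j" and C: "C = - \<theta> / ln (Lreal \<nu> \<theta>)"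
  shows "AE \<omega> in M. eventually (\<lambda>s. \<not> crowded (2 ^ s) j (nat \<lceil>C * real s * ln 2 + 2 * C / \<theta> * ln (real s)\<rceil>) \<omega>) sequentially"
proof -
  interpret t: tilted \<nu> \<theta> by unfold_locales (rule \<theta>(1))
  have lnL: "ln t.\<Lambda> < 0" using t.\<Lambda> by simp
  have Cpos: "C > 0" using \<theta> lnL by (simp add: C divide_pos_neg zero_less_divide_iff)
  have L: "ln t.\<Lambda> = - \<theta> / C" using lnL \<theta> by (simp add: C)
  define k where "k s = nat \<lceil>C * real s * ln 2 + 2 * C / \<theta> * ln (real s)\<rceil>" for s
  define A where "A s = {\<omega> \<in> space M. crowded (2 ^ s) j (k s) \<omega>}" for s
  have Am: "A s \<in> events" for s unfolding A_def by measurable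
  have "eventually (\<lambda>s. norm (prob (A s)) \<le> inverse (real s ^ 2)) sequentially"
    using eventually_ge_at_top[of 1]
  proof eventually_elim
    case (elim s)
    have s: "real s \<ge> 1" using elim by simp
    have ks: "C * real s * ln 2 + 2 * C / \<theta> * ln (real s) \<le> real (k s)" unfolding k_def by linarith
    have "emeasure M (A s) \<le> ennreal (real (2 ^ s) powr \<theta>) * Lfun \<nu> \<theta> ^ k s"
      unfolding A_def using \<theta> by (intro emeasure_crowded_le) auto
    also have "\<dots> = ennreal (real (2 ^ s) powr \<theta> * t.\<Lambda> ^ k s)"
      using t.\<Lambda> by (simp add: ennreal_power ennreal_mult)
    finally have "prob (A s) \<le> real (2 ^ s) powr \<theta> * t.\<Lambda> ^ k s"
      using t.\<Lambda> by (simp add: emeasure_eq_measure)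
    also have "real (2 ^ s) powr \<theta> = exp (\<theta> * (real s * ln 2))" by (simp add: powr_def ln_realpow)
    also have "t.\<Lambda> ^ k s = exp (real (k s) * ln t.\<Lambda>)" using t.\<Lambda>(1) by (simp add: exp_of_nat_mult)
    also have "exp (\<theta> * (real s * ln 2)) * exp (real (k s) * ln t.\<Lambda>) = exp (\<theta> * (real s * ln 2) + real (k s) * ln t.\<Lambda>)"
      by (simp add: exp_add)
    also have "\<dots> \<le> exp (\<theta> * (real s * ln 2) + (C * real s * ln 2 + 2 * C / \<theta> * ln (real s)) * ln t.\<Lambda>)"
      using mult_right_mono_neg[OF ks, of "ln t.\<Lambda>"] lnL by simp
    also have "\<theta> * (real s * ln 2) + (C * real s * ln 2 + 2 * C / \<theta> * ln (real s)) * ln t.\<Lambda> = - (2 * ln (real s))"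
      unfolding L using Cpos \<theta> by (simp add: field_simps)
    also have "exp (- (2 * ln (real s))) = inverse (real s ^ 2)"
      using s by (simp add: exp_minus exp_double)
    finally show ?case by simp
  qed
  moreover have "summable (\<lambda>s. inverse (real s ^ 2))" by (rule inverse_power_summable) simp
  ultimately have "summable (\<lambda>s. prob (A s))" by (rule summable_comparison_test_ev)
  then have "AE \<omega> in M. eventually (\<lambda>s. \<omega> \<in> space M - A s) sequentially"
    by (intro borel_cantelli_AE1 Am) (auto simp: emeasure_eq_measure)
  then show ?thesis
  proof eventually_elim
    case (elim \<omega>)
    then show ?case by eventually_elim (auto simp: A_def k_def)
  qed
qed

text \<open>The correction below the break-even generation gains a factor
  \<open>s ^ (j + Q + 2)\<close>: \<open>s ^ j\<close> pays for the factor
  \<open>(1 + t) ^ j\<close> of the collision bound, \<open>s ^ Q\<close> for the loss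
  \<open>k powr - Q\<close> in the power sum, and \<open>1 / s\<^sup>2\<close> remains. The
  environment bound stands as a premise inside the event because its exponent is random, whereas
  \<open>Q\<close> is fixed here.\<close>

lemma AE_crowded_dyadic:
  fixes Q :: nat
  assumes \<theta>: "1 < \<theta>" and j: "0 < j" and C: "C = - \<theta> / ln (Lreal \<nu> \<theta>)"
    and k_def: "\<And>s. k s = nat \<lfloor>C * real s * ln 2 - C / real j * (real j + real Q + 2) * ln (real s)\<rfloor>"
  shows "AE \<omega> in M. eventually (\<lambda>s. ennreal (real (k s) powr - real Q * Lreal \<nu> \<theta> powr (real j * real (k s) / \<theta>)) \<le> sp.S (real j) (k s) (env \<omega>)
     \<longrightarrow> crowded (2 ^ s) j (k s) \<omega>) sequentially"
    and "filterlim k at_top sequentially"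
proof -
  interpret t: tilted \<nu> \<theta> by unfold_locales (rule \<theta>)
  have lnL: "ln t.\<Lambda> < 0" using t.\<Lambda> by simp
  have Cpos: "C > 0" using \<theta> lnL by (simp add: C divide_pos_neg zero_less_divide_iff)
  have L: "ln t.\<Lambda> = - \<theta> / C" using lnL \<theta> by (simp add: C)
  define D where "D = C / real j * (real j + real Q + 2)"
  have D: "D > 0" using Cpos j by (simp add: D_def)
  have ln2: "ln 2 > (0 :: real)" "ln 2 < (1 :: real)" using ln_2_less_1 by auto
  have kD: "k s = nat \<lfloor>C * real s * ln 2 - D * ln (real s)\<rfloor>" for s by (simp add: k_def D_def)
  have "filterlim (\<lambda>s. C * ln 2 / 2 * real s) at_top sequentially"
    using Cpos ln2 by (intro filterlim_tendsto_pos_mult_at_top[OF tendsto_const _ filterlim_real_sequentially]) auto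
  moreover have "eventually (\<lambda>s. C * ln 2 / 2 * real s \<le> C * real s * ln 2 - D * ln (real s)) sequentially"
  proof -
    have "0 < C * ln 2 / (2 * D)" using Cpos ln2 D by simp
    from eventually_log_less[OF this] show ?thesis
    proof eventually_elim
      case (elim s)
      then have "D * ln (real s) \<le> D * (C * ln 2 / (2 * D) * real s)" using D by (intro mult_left_mono) auto
      also have "\<dots> = C * ln 2 / 2 * real s" using D by simp
      finally show ?case by (simp add: algebra_simps)
    qed
  qed
  ultimately have lim: "filterlim (\<lambda>s. C * real s * ln 2 - D * ln (real s)) at_top sequentially"
    by (rule filterlim_at_top_mono)
  show klim: "filterlim k at_top sequentially"
    unfolding filterlim_at_top
  proof
    fix Z :: nat
    have "eventually (\<lambda>s. real Z \<le> C * real s * ln 2 - D * ln (real s)) sequentially"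
      using lim unfolding filterlim_at_top by blast
    then show "eventually (\<lambda>s. Z \<le> k s) sequentially"
      by eventually_elim (simp add: kD le_nat_floor)
  qed
  define \<sigma> where "\<sigma> s = real (k s) powr - real Q * t.\<Lambda> powr (real j * real (k s) / \<theta>)" for s
  define B where "B s = {e \<in> space sp.E. ennreal (\<sigma> s) \<le> sp.S (real j) (k s) e}" for s
  have Bm: "B s \<in> sets sp.E" for s unfolding B_def by measurable
  define A where "A s = {\<omega> \<in> space M. env \<omega> \<in> B s \<and> \<not> crowded (2 ^ s) j (k s) \<omega>}" for s
  have Am: "A s \<in> events" for s
  proof -
    have 1: "env -` B s \<inter> space M \<in> events" by (rule measurable_sets[OF measurable_env_E Bm])
    have 2: "{\<omega> \<in> space M. \<not> crowded (2 ^ s) j (k s) \<omega>} \<in> events" by measurable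
    have "A s = (env -` B s \<inter> space M) \<inter> {\<omega> \<in> space M. \<not> crowded (2 ^ s) j (k s) \<omega>}" by (auto simp: A_def)
    then show ?thesis using sets.Int[OF 1 2] by simp
  qed
  define c where "c = real j + 2 * ((4 * real j) ^ j * C ^ Q)"
  have "eventually (\<lambda>s. 1 \<le> k s) sequentially" using klim unfolding filterlim_at_top by blast
  moreover have "eventually (\<lambda>s. 2 * j \<le> 2 ^ s) sequentially"
  proof -
    have "eventually (\<lambda>s. s \<ge> 2 * j) sequentially" by (rule eventually_ge_at_top)
    then show ?thesis by eventually_elim (meson less_exp less_imp_le order_trans)
  qed
  moreover have "eventually (\<lambda>s. 0 \<le> C * real s * ln 2 - D * ln (real s)) sequentially"
    using lim unfolding filterlim_at_top by blast
  ultimately have "eventually (\<lambda>s. norm (prob (A s)) \<le> c * inverse (real s ^ 2)) sequentially"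
    using eventually_ge_at_top[of 2]
  proof eventually_elim
    case (elim s)
    have s: "real s \<ge> 2" "real s \<ge> 1" "real s > 0" using elim by auto
    have lns: "ln (real s) > 0" using s by simp
    \<comment> \<open>\<open>j\<close> groups of equal size among the \<open>2 ^ s\<close> balls;
      once \<open>2 * j \<le> 2 ^ s\<close>, the rounding loses at most a factor 2.\<close>
    define m where "m = 2 ^ s div j"
    \<comment> \<open>Makes \<open>exp (- t)\<close> equal to \<open>1 / s\<^sup>2\<close>.\<close>
    define t where "t = 2 * ln (real s)"
    have t0: "0 < t" using lns by (simp add: t_def)
    have mj: "j * m \<le> 2 ^ s" unfolding m_def by simp
    have m2: "real (2 ^ s) \<le> 2 * real j * real m"
    proof -
      have "2 ^ s = j * m + 2 ^ s mod j" unfolding m_def by simp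
      also have "2 ^ s mod j \<le> j" using j by (simp add: less_imp_le)
      finally have "2 ^ s \<le> j * m + j" by simp
      then have "2 * 2 ^ s \<le> 2 * (j * m) + 2 ^ s" using elim(2) by linarith
      then have "2 ^ s \<le> 2 * j * m" by simp
      then have "real (2 ^ s) \<le> real (2 * j * m)" by (simp only: of_nat_le_iff)
      then show ?thesis by simp
    qed
    have m0: "0 < m"
    proof (rule ccontr)
      assume "\<not> 0 < m"
      then have "real (2 ^ s) \<le> 0" using m2 by simp
      moreover have "0 < real (2 ^ s)" by simp
      ultimately show False by linarith
    qed
    have k1: "real (k s) \<ge> 1" using elim(1) by simp
    have kle: "real (k s) \<le> C * real s * ln 2 - D * ln (real s)" using elim(3) by (simp add: kD)
    have kC: "real (k s) \<le> C * real s"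
    proof -
      have "C * real s * ln 2 \<le> C * real s * 1" using Cpos s ln2 by (intro mult_left_mono) auto
      moreover have "0 \<le> D * ln (real s)" using D lns by simp
      ultimately show ?thesis using kle by linarith
    qed
    have \<sigma>0: "\<sigma> s > 0" using k1 t.\<Lambda>(1) by (simp add: \<sigma>_def)
    \<comment> \<open>\<open>\<sigma> s / 2\<close> stands in place of \<open>\<sigma> s\<close>,
      since the collision estimate asks for a strict lower bound on the power sum.\<close>
    have "emeasure M (A s) \<le> ennreal (real j * exp (- t) + ((1 + t) / real m) ^ j / (\<sigma> s / 2))"
      unfolding A_def
    proof (rule emeasure_uncrowded_le[OF Bm _ _ j m0 mj t0])
      fix e assume "e \<in> B s"
      then have "ennreal (\<sigma> s) \<le> sp.S (real j) (k s) e" by (simp add: B_def)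
      moreover have "ennreal (\<sigma> s / 2) < ennreal (\<sigma> s)" using \<sigma>0 by (simp add: ennreal_less_iff)
      ultimately show "ennreal (\<sigma> s / 2) < sp.S (real j) (k s) e" by (rule less_le_trans[rotated])
    qed (use \<sigma>0 in simp)
    have "prob (A s) \<le> real j * exp (- t) + ((1 + t) / real m) ^ j / (\<sigma> s / 2)"
    proof -
      have "0 \<le> real j * exp (- t) + ((1 + t) / real m) ^ j / (\<sigma> s / 2)"
        using \<sigma>0 t0 m0 by (intro add_nonneg_nonneg divide_nonneg_pos zero_le_power) auto
      then show ?thesis
        using \<open>emeasure M (A s) \<le> _\<close> by (simp only: emeasure_eq_measure ennreal_le_iff)
    qed
    also have "\<dots> = real j * exp (- t) + 2 * (((1 + t) / real m) ^ j * inverse (\<sigma> s))"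
    proof -
      have "x / (y / 2) = 2 * (x * inverse y)" for x y :: real by (simp add: inverse_eq_divide)
      then show ?thesis by (rule arg_cong2[where f="(+)", OF refl])
    qed
    also have "exp (- t) = inverse (real s ^ 2)"
      using s by (simp add: t_def exp_minus exp_double)
    also have "((1 + t) / real m) ^ j * inverse (\<sigma> s) \<le> (4 * real j) ^ j * C ^ Q * inverse (real s ^ 2)"
    proof -
      have "1 + t \<le> 2 * real s" using ln_le_minus_one[of "real s"] s by (simp add: t_def)
      then have "(1 + t) / real m \<le> 2 * real s / real m" using m0 by (intro divide_right_mono) auto
      also have "\<dots> \<le> 4 * real j * real s / real (2 ^ s)"
      proof -
        have "real s * real (2 ^ s) \<le> real s * (2 * real j * real m)" using m2 s by (intro mult_left_mono) auto
        then show ?thesis using m0 by (simp add: field_simps)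
      qed
      finally have "((1 + t) / real m) ^ j \<le> (4 * real j * real s / real (2 ^ s)) ^ j"
        using t0 by (intro power_mono) auto
      also have "\<dots> = (4 * real j) ^ j * real s ^ j * exp (- (real j * (real s * ln 2)))"
      proof -
        have eq: "real (2 ^ s) ^ j = exp (real j * (real s * ln 2))"
          by (simp add: exp_of_nat_mult)
        show ?thesis unfolding power_divide eq by (simp only: power_mult_distrib exp_minus divide_inverse)
      qed
      finally have 1: "((1 + t) / real m) ^ j \<le> (4 * real j) ^ j * real s ^ j * exp (- (real j * (real s * ln 2)))" .
      have "inverse (t.\<Lambda> powr (real j * real (k s) / \<theta>)) = exp (real j * real (k s) / C)"
        using t.\<Lambda>(1) \<theta> by (simp add: powr_def L exp_minus[symmetric])
      also have "\<dots> \<le> exp (real j * (C * real s * ln 2 - D * ln (real s)) / C)"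
        using kle Cpos by (auto intro!: divide_right_mono mult_left_mono)
      also have "real j * (C * real s * ln 2 - D * ln (real s)) / C = real j * (real s * ln 2) + real (j + Q + 2) * (- ln (real s))"
        using Cpos j by (simp add: D_def field_simps)
      also have "exp \<dots> = exp (real j * (real s * ln 2)) * inverse (real s ^ (j + Q + 2))"
        using s by (simp only: exp_add exp_of_nat_mult) (simp add: exp_minus power_inverse)
      finally have 2: "inverse (t.\<Lambda> powr (real j * real (k s) / \<theta>)) \<le> exp (real j * (real s * ln 2)) * inverse (real s ^ (j + Q + 2))" .
      have "inverse (real (k s) powr - real Q) = real (k s) ^ Q"
        using k1 by (simp add: powr_minus powr_realpow)
      also have "\<dots> \<le> (C * real s) ^ Q" using kC by (intro power_mono) auto
      finally have 3: "inverse (real (k s) powr - real Q) \<le> (C * real s) ^ Q" .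
      have "inverse (\<sigma> s) = inverse (real (k s) powr - real Q) * inverse (t.\<Lambda> powr (real j * real (k s) / \<theta>))"
        by (simp add: \<sigma>_def)
      also have "\<dots> \<le> (C * real s) ^ Q * (exp (real j * (real s * ln 2)) * inverse (real s ^ (j + Q + 2)))"
        using Cpos s by (intro mult_mono 2 3) auto
      finally have "((1 + t) / real m) ^ j * inverse (\<sigma> s) \<le>
        ((4 * real j) ^ j * real s ^ j * exp (- (real j * (real s * ln 2)))) *
        ((C * real s) ^ Q * (exp (real j * (real s * ln 2)) * inverse (real s ^ (j + Q + 2))))"
        using 1 \<sigma>0 by (intro mult_mono) auto
      also have "\<dots> = (4 * real j) ^ j * C ^ Q * (exp (- (real j * (real s * ln 2))) * exp (real j * (real s * ln 2))) *
        (real s ^ (j + Q) * inverse (real s ^ (j + Q + 2)))"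
        by (simp add: power_mult_distrib power_add)
      also have "exp (- (real j * (real s * ln 2))) * exp (real j * (real s * ln 2)) = 1"
        by (simp add: exp_minus)
      also have "real s ^ (j + Q) * inverse (real s ^ (j + Q + 2)) = inverse (real s ^ 2)"
      proof -
        have "real s ^ (j + Q + 2) = real s ^ (j + Q) * real s ^ 2" by (rule power_add)
        moreover have "a * inverse (a * b) = inverse b" if "a \<noteq> 0" for a b :: real
          using that by (simp add: inverse_mult_distrib)
        moreover have "real s ^ (j + Q) \<noteq> 0" using s by simp
        ultimately show ?thesis by metis
      qed
      finally show ?thesis by simp
    qed
    finally have "prob (A s) \<le> c * inverse (real s ^ 2)"
      by (simp add: c_def algebra_simps)
    then show ?case by simp
  qed
  moreover have "summable (\<lambda>s. c * inverse (real s ^ 2))"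
    by (intro summable_mult inverse_power_summable) simp
  ultimately have "summable (\<lambda>s. prob (A s))" by (rule summable_comparison_test_ev)
  then have "AE \<omega> in M. eventually (\<lambda>s. \<omega> \<in> space M - A s) sequentially"
    by (intro borel_cantelli_AE1 Am) (auto simp: emeasure_eq_measure)
  then show "AE \<omega> in M. eventually (\<lambda>s. ennreal (real (k s) powr - real Q * Lreal \<nu> \<theta> powr (real j * real (k s) / \<theta>)) \<le> sp.S (real j) (k s) (env \<omega>)
     \<longrightarrow> crowded (2 ^ s) j (k s) \<omega>) sequentially"
  proof eventually_elim
    case (elim \<omega>)
    then show ?case
    proof eventually_elim
      case (elim s)
      then show ?case using env_space[of \<omega>] by (auto simp: A_def B_def \<sigma>_def)
    qed
  qed
qed

text \<open>The exponent \<open>K\<close> in the lower bound for the power sums depends on the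
  environment. The collision statement is therefore used almost surely for all natural numbers
  \<open>Q\<close> at once, and some \<open>Q \<ge> K\<close> is picked afterwards for each
  outcome.\<close>

lemma saturation_height_asymptotics:
  assumes j: "2 \<le> j"
  shows "C_const \<nu> j > 0"
    and "AE \<omega> in M. (\<forall>n. saturation_height \<rho> X n j \<omega> < \<infinity>) \<and>
      (\<exists>K. eventually (\<lambda>n. \<bar>real (the_enat (saturation_height \<rho> X n j \<omega>)) - C_const \<nu> j * ln (real n)\<bar> \<le> K * ln (ln (real n))) sequentially)"
proof -
  define C where "C = C_const \<nu> j"
  obtain \<theta> where \<theta>: "1 < \<theta>" "\<theta> \<le> real j" "phi \<nu> \<theta> \<ge> 0" "\<theta> = real j \<or> phi \<nu> \<theta> = 0"
    and C: "C = - \<theta> / ln (Lreal \<nu> \<theta>)"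
    using ng.C_const_cases[OF j] unfolding C_def by blast
  interpret t: tilted \<nu> \<theta> by unfold_locales (rule \<theta>(1))
  have lnL: "ln t.\<Lambda> < 0" using t.\<Lambda> by simp
  have Cpos: "C > 0" unfolding C using \<theta>(1) lnL by (intro divide_neg_neg) auto
  then show "C_const \<nu> j > 0" by (simp add: C_def)
  have j0: "0 < j" using j by simp
  define k where "k Q s = nat \<lfloor>C * real s * ln 2 - C / real j * (real j + real Q + 2) * ln (real s)\<rfloor>" for Q s :: nat
  have lower: "AE \<omega> in M. \<forall>Q. eventually (\<lambda>s. ennreal (real (k Q s) powr - real Q * t.\<Lambda> powr (real j * real (k Q s) / \<theta>)) \<le> sp.S (real j) (k Q s) (env \<omega>)
     \<longrightarrow> crowded (2 ^ s) j (k Q s) \<omega>) sequentially"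
    unfolding AE_all_countable by (intro allI AE_crowded_dyadic(1)[OF \<theta>(1) j0 C]) (simp add: k_def)
  have klim: "filterlim (k Q) at_top sequentially" for Q
    by (rule AE_crowded_dyadic(2)[OF \<theta>(1) j0 C]) (simp add: k_def)
  have env: "AE \<omega> in M. \<exists>K>0. eventually (\<lambda>k. ennreal (real k powr - K * t.\<Lambda> powr (real j * real k / \<theta>)) \<le> sp.S (real j) k (env \<omega>)) sequentially"
    by (rule AE_env[OF t.AE_S_lower[OF \<theta>(3,2,4)]])
  show "AE \<omega> in M. (\<forall>n. saturation_height \<rho> X n j \<omega> < \<infinity>) \<and>
      (\<exists>K. eventually (\<lambda>n. \<bar>real (the_enat (saturation_height \<rho> X n j \<omega>)) - C_const \<nu> j * ln (real n)\<bar> \<le> K * ln (ln (real n))) sequentially)"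
    using AE_uncrowded_dyadic[OF \<theta>(1,2) C] lower env AE_ball_path
  proof eventually_elim
    case (elim \<omega>)
    note up = elim(1) and low = elim(2) and path = elim(4)
    let ?H = "\<lambda>n. saturation_height \<rho> X n j \<omega>"
    define u where "u s = C * real s * ln 2 + 2 * C / \<theta> * ln (real s)" for s :: nat
    obtain s0 where s0: "\<And>s. s \<ge> s0 \<Longrightarrow> \<not> crowded (2 ^ s) j (nat \<lceil>u s\<rceil>) \<omega>"
      using up by (auto simp: eventually_sequentially u_def)
    \<comment> \<open>A large power of two with an uncrowded generation dominates
      \<open>n\<close>.\<close>
    have fin: "?H n < \<infinity>" for n
    proof -
      have "n \<le> 2 ^ max n s0" by (meson less_exp less_imp_le max.cobounded1 order_trans)
      then have "?H n \<le> ?H (2 ^ max n s0)" by (rule saturation_height_mono)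
      also have "\<dots> \<le> enat (nat \<lceil>u (max n s0)\<rceil>)" by (intro saturation_height_le s0) simp
      finally show ?thesis using enat_ord_code(4) order_le_less_trans by blast
    qed
    define h where "h n = real (the_enat (?H n))" for n
    have Hh: "?H n = enat (the_enat (?H n))" for n using fin[of n] by (cases "?H n") auto
    have hmono: "h n \<le> h m" if "n \<le> m" for n m
    proof -
      have "enat (the_enat (?H n)) \<le> enat (the_enat (?H m))"
        using saturation_height_mono[OF that, of j \<omega>] Hh[of n] Hh[of m] by simp
      then show ?thesis by (simp add: h_def)
    qed
    have "eventually (\<lambda>s. h (2 ^ s) \<le> C * real s * ln 2 + (2 * C / \<theta>) * ln (real s) + 1) sequentially"
      using eventually_ge_at_top[of "max 1 s0"]
    proof eventually_elim
      case (elim s)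
      have "0 \<le> u s" using elim Cpos \<theta>(1) by (simp add: u_def)
      have "enat (the_enat (?H (2 ^ s))) \<le> enat (nat \<lceil>u s\<rceil>)"
        unfolding Hh[symmetric] using elim by (intro saturation_height_le s0) simp
      then have "h (2 ^ s) \<le> real (nat \<lceil>u s\<rceil>)" by (simp add: h_def)
      also have "\<dots> \<le> u s + 1" using \<open>0 \<le> u s\<close> by linarith
      finally show ?case by (simp add: u_def)
    qed
    then obtain K1 where K1: "K1 \<ge> 0" "eventually (\<lambda>n. h n \<le> C * ln (real n) + K1 * ln (ln (real n))) sequentially"
      using dyadic_upper[where A="2 * C / \<theta>" and h=h, OF hmono Cpos] Cpos \<theta>(1) by auto
    obtain K where K: "K > 0" "eventually (\<lambda>k. ennreal (real k powr - K * t.\<Lambda> powr (real j * real k / \<theta>)) \<le> sp.S (real j) k (env \<omega>)) sequentially"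
      using elim(3) by blast
    obtain Q :: nat where Q: "K \<le> real Q" using real_arch_simple by blast
    define D where "D = C / real j * (real j + real Q + 2)"
    have D: "D \<ge> 0" using Cpos by (simp add: D_def)
    have "eventually (\<lambda>s. ennreal (real (k Q s) powr - K * t.\<Lambda> powr (real j * real (k Q s) / \<theta>)) \<le> sp.S (real j) (k Q s) (env \<omega>)) sequentially"
      using klim[of Q] K(2) by (rule eventually_compose_filterlim[rotated])
    moreover have "eventually (\<lambda>s. 1 \<le> k Q s) sequentially"
      using klim[of Q] unfolding filterlim_at_top by blast
    ultimately have "eventually (\<lambda>s. h (2 ^ s) \<ge> C * real s * ln 2 - D * ln (real s) - 1) sequentially"
      using low[rule_format, of Q]
    proof eventually_elim
      case (elim s)
      have "real (k Q s) powr - real Q \<le> real (k Q s) powr - K" using elim(2) Q by (intro powr_mono) auto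
      then have "ennreal (real (k Q s) powr - real Q * t.\<Lambda> powr (real j * real (k Q s) / \<theta>)) \<le>
          ennreal (real (k Q s) powr - K * t.\<Lambda> powr (real j * real (k Q s) / \<theta>))"
        by (intro ennreal_leI mult_right_mono) auto
      then have "crowded (2 ^ s) j (k Q s) \<omega>" using elim(1,3) by (blast intro: order_trans)
      then have "enat (k Q s) < enat (the_enat (?H (2 ^ s)))"
        unfolding Hh[symmetric] by (rule saturation_height_gt[OF path])
      then have "real (k Q s) \<le> h (2 ^ s)" by (simp add: h_def)
      moreover have "C * real s * ln 2 - D * ln (real s) - 1 \<le> real (k Q s)"
        unfolding k_def D_def by linarith
      ultimately show ?case by linarith
    qed
    then obtain K2 where K2: "K2 \<ge> 0" "eventually (\<lambda>n. h n \<ge> C * ln (real n) - K2 * ln (ln (real n))) sequentially"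
      using dyadic_lower[where h=h, OF hmono Cpos D] by auto
    have "eventually (\<lambda>n::nat. n \<ge> nat \<lceil>exp (3 :: real)\<rceil>) sequentially" by (rule eventually_ge_at_top)
    then have "eventually (\<lambda>n. \<bar>h n - C * ln (real n)\<bar> \<le> (K1 + K2) * ln (ln (real n))) sequentially"
      using K1(2) K2(2)
    proof eventually_elim
      case (elim n)
      have "exp 3 \<le> real n" using elim(1) by linarith
      moreover from this have "0 < real n" using exp_gt_zero[of 3] by linarith
      ultimately have "3 \<le> ln (real n)" by (simp add: ln_ge_iff)
      then have "0 \<le> ln (ln (real n))" by simp
      then have "0 \<le> K1 * ln (ln (real n))" "0 \<le> K2 * ln (ln (real n))" using K1 K2 by auto
      then show ?case using elim(2,3) by (simp add: distrib_right abs_le_iff)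
    qed
    then show ?case using fin unfolding h_def C_def by blast
  qed
qed

end

theorem theorem1:
  fixes M :: "'w measure"
    and \<nu> :: "nat measure measure"
    and \<rho> :: "nat list \<Rightarrow> 'w \<Rightarrow> nat measure"
    and X :: "nat \<Rightarrow> 'w \<Rightarrow> nat \<Rightarrow> nat list"
    and j :: nat
  assumes "nested_occupancy M \<nu> \<rho> X"
    and "\<not> geometric_law \<nu>"
    and "j \<ge> 2"
  shows "(AE \<omega> in M.
            (\<forall>n. saturation_height \<rho> X n j \<omega> < \<infinity>) \<and>
            (\<lambda>n. real (the_enat (saturation_height \<rho> X n j \<omega>)))
              \<sim>[sequentially] (\<lambda>n. C_const \<nu> j * ln (real n))) \<and>
         (AE \<omega> in M. \<exists>K::real. \<forall>\<^sub>F n in sequentially.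
            real (the_enat (saturation_height \<rho> X n j \<omega>))
              \<le> C_const \<nu> j * ln (real n) + K * ln (ln (real n))) \<and>
         (ereal (real j) < theta_star \<nu> \<or> moment_condition \<nu> \<longrightarrow>
          (AE \<omega> in M. \<exists>K::real. \<forall>\<^sub>F n in sequentially.
            \<bar>real (the_enat (saturation_height \<rho> X n j \<omega>)) - C_const \<nu> j * ln (real n)\<bar>
              \<le> K * ln (ln (real n))))"
proof -
  interpret nongeometric_occupancy M \<nu> \<rho> X
    by (intro nongeometric_occupancy.intro nongeometric_occupancy_axioms.intro assms)
  note asym = saturation_height_asymptotics[OF assms(3)]
  show ?thesis
  proof (intro conjI impI)
    show "AE \<omega> in M. (\<forall>n. saturation_height \<rho> X n j \<omega> < \<infinity>) \<and>
        (\<lambda>n. real (the_enat (saturation_height \<rho> X n j \<omega>))) \<sim>[sequentially] (\<lambda>n. C_const \<nu> j * ln (real n))"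
      using asym(2)
    proof eventually_elim
      case (elim \<omega>)
      then obtain K where "\<forall>\<^sub>F n in sequentially.
          \<bar>real (the_enat (saturation_height \<rho> X n j \<omega>)) - C_const \<nu> j * ln (real n)\<bar> \<le> K * ln (ln (real n))"
        by blast
      from asymp_equiv_ln[OF asym(1) this] elim show ?case by simp
    qed
    show "AE \<omega> in M. \<exists>K::real. \<forall>\<^sub>F n in sequentially.
        real (the_enat (saturation_height \<rho> X n j \<omega>)) \<le> C_const \<nu> j * ln (real n) + K * ln (ln (real n))"
      using asym(2)
    proof eventually_elim
      case (elim \<omega>)
      then obtain K where "\<forall>\<^sub>F n in sequentially.
          \<bar>real (the_enat (saturation_height \<rho> X n j \<omega>)) - C_const \<nu> j * ln (real n)\<bar> \<le> K * ln (ln (real n))"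
        by blast
      then have "\<forall>\<^sub>F n in sequentially.
          real (the_enat (saturation_height \<rho> X n j \<omega>)) \<le> C_const \<nu> j * ln (real n) + K * ln (ln (real n))"
        by eventually_elim linarith
      then show ?case by blast
    qed
    show "AE \<omega> in M. \<exists>K::real. \<forall>\<^sub>F n in sequentially.
        \<bar>real (the_enat (saturation_height \<rho> X n j \<omega>)) - C_const \<nu> j * ln (real n)\<bar> \<le> K * ln (ln (real n))"
      using asym(2) by eventually_elim blast
  qed
qed

end
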